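(* Let $p$ be an odd prime with $p\notin E$, where $E=\{3,5,7,11,13,17,19,23,29,31,37,41,43,47,53,59,61,67,71,73,79,97,101,103,109,127,131,139,151,157,163,181,193,199,211,223,229,241,271,277,281,283,307,313,331,337,349,367,373,379,397,409,421,457,463,541,547,571,601,613,631,661,673,691,727,751,757,811,859,883,967,991,1009,1021,1051,1093,1171,1201,1231,1291,1321,1381,1471,1531,1951,2311,2521,2731,3361,3571,4621,4831,10711,11971,14281,17851,35911\}$, and let $F$ be the field with $p$ elements. Then for every polynomial $f(x)\in F[x]$ of degree $4$ that has nonzero constant term and is not of the form $\alpha g(x)^2$ (with $\alpha\in F$, $g(x)\in F[x]$), there exists a primitive root $\beta\in F$ (a generator of the multiplicative group $F\setminus\{0\}$) such that $f(\beta)$ is a square in $F$.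
   Context: The set $E$ is the set of primes listed as exceptions in two tables of the paper. *)

theory Defs
  imports "HOL-Computational_Algebra.Computational_Algebra" "HOL-Library.Cardinality"
begin

definition exceptional_primes :: "nat set" where
  "exceptional_primes =
    {3, 5, 7, 11, 13, 17, 19, 23, 29, 31, 37, 41, 43, 47, 53, 59, 61, 67, 71, 73, 79, 97,
     101, 103, 109, 127, 131, 139, 151, 157, 163, 181, 193, 199, 211, 223, 229, 241, 271,
     277, 281, 283, 307, 313, 331, 337, 349, 367, 373, 379, 397, 409, 421, 457, 463, 541,
     547, 571, 601, 613, 631, 661, 673, 691, 727, 751, 757, 811, 859, 883, 967, 991, 1009,
     1021, 1051, 1093, 1171, 1201, 1231, 1291, 1321, 1381, 1471, 1531, 1951, 2311, 2521,
     2731, 3361, 3571, 4621, 4831, 10711, 11971, 14281, 17851, 35911}"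

definition primitive_root :: "'a::field \<Rightarrow> bool" where
  "primitive_root \<beta> \<longleftrightarrow> \<beta> \<noteq> 0 \<and> range (\<lambda>k::int. \<beta> powi k) = UNIV - {0}"

end

theory Submission
  imports "HOL-Algebra.Algebraic_Closure_Type" "HOL-Number_Theory.Number_Theory" "HOL-Analysis.Kronecker_Approximation_Theorem" Defs 
begin
hide_const (open) Coset.order up_ring.coeff up_ring.monom Polynomials.degree module.smult Divisibility.prime Divisibility.irreducible

text \<open>
  Fix a generator \<open>\<gamma>\<close> of the multiplicative group and let \<open>W i = 1 + \<eta> (f (\<gamma> ^ i))\<close> with the quadratic
  character \<open>\<eta>\<close>, so that \<open>W i > 0\<close> exactly when \<open>f (\<gamma> ^ i)\<close> is a square. One needs \<open>i\<close> coprime to \<open>p - 1\<close>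
  with \<open>W i > 0\<close>. Some of the prime divisors of \<open>p - 1\<close> are sieved out with multiplicative characters \<open>\<psi>\<close>
  and Weil's bounds \<open>\<bar>\<Sum>x. \<psi> x * \<eta> (f x)\<bar> \<le> 4 * sqrt p\<close> (for \<open>\<psi>\<close> nontrivial) and
  \<open>\<bar>\<Sum>x. \<eta> (f x)\<bar> \<le> 2 * sqrt p + 1\<close>; the remaining ones are removed trivially, using \<open>W i \<le> 2\<close>.
  This succeeds for every odd \<open>p\<close> outside the exceptional set: for \<open>p > 3190\<close> by lower bounds for products of
  distinct primes, and for smaller \<open>p\<close> by calculation.

  The Weil bounds come from the L-function of the character
  \<open>h \<mapsto> \<psi> (h 0) * \<eta> (\<Prod>t. h t)\<close> on monic polynomials, where \<open>t\<close> runs through the roots of \<open>f\<close>. It is a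
  polynomial whose inverse roots \<open>w\<close> have as power sums the negatives of the character sums over the extension
  fields. Over the fields with \<open>P\<^sup>2\<close> elements, \<open>P\<close> a power of \<open>p\<close>, Stepanov's method bounds these sums by a
  constant times \<open>P\<close>, which forces \<open>\<bar>w\<bar> \<le> sqrt p\<close>.
\<close>

section \<open>Roots over an algebraically closed field\<close>

text \<open>Apart from its degree, \<open>f\<close> enters through one point \<open>\<theta>\<close>
  of the algebraic closure: not being of the form \<open>\<alpha> * g\<^sup>2\<close> gives a root
  of odd multiplicity, and the nonzero constant term makes this root nonzero. Stepanov's argument
  treats only untwisted sums of \<open>\<eta>\<close>. A twist by \<open>\<psi>\<close> is constant
  on the fibres of the norm, and such a fibre is parametrised by
  \<open>t \<mapsto> a * t ^ (p - 1)\<close>. This map is unramified away from \<open>0\<close>, so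
  the odd multiplicity at \<open>\<theta>\<close> survives the substitution and each fibre sum is
  again untwisted. The resulting constant is poor, but only the growth with the extension degree
  matters, since the inverse roots do not depend on that degree. Extensions of even degree are
  singled out because Stepanov's construction uses the square root \<open>P\<close> of the field
  size; even power sums still control the largest absolute value. The bound with
  \<open>2 * sqrt p\<close> instead of \<open>4 * sqrt p\<close> comes from the smaller modulus
  \<open>f\<close> in place of \<open>X * f\<close> and from an inverse root equal to
  \<open>1\<close>.\<close>

lemma alg_closed_proots:
  fixes f :: "'k::alg_closed_field poly"
  shows "smult (lead_coeff f) (\<Prod>x\<in>#proots f. [:- x, 1:]) = f"
    and "size (proots f) = degree f"
proof -
  have "smult (lead_coeff f) (\<Prod>x\<in>#proots f. [:- x, 1:]) = f \<and> size (proots f) = degree f"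
  proof (cases "f = 0")
    case False
    then obtain A where A: "size A = degree f"
      "f = smult (lead_coeff f) (\<Prod>x\<in>#A. [:- x, 1:])"
      using alg_closed_imp_factorization by blast
    have "proots (\<Prod>x\<in>#A. [:- x, 1:]) = A"
    proof (induction A)
      case (add x A)
      have "(\<Prod>x\<in>#A. [:- x, 1:]) \<noteq> 0"
        by (induction A) (auto simp del: mult_pCons_left)
      then show ?case
        using add by (simp add: proots_mult del: mult_pCons_left)
    qed auto
    moreover have "proots f = proots (\<Prod>x\<in>#A. [:- x, 1:])"
      using False by (subst A(2)) (rule proots_smult, simp)
    ultimately have "proots f = A" by simp
    then show ?thesis
      using A by simp
  qed auto
  then show "smult (lead_coeff f) (\<Prod>x\<in>#proots f. [:- x, 1:]) = f"
    and "size (proots f) = degree f" by auto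
qed

lemma order_eq_1I:
  fixes f :: "'a::idom poly"
  assumes "poly f x = 0" "poly (pderiv f) x \<noteq> 0"
  shows "order x f = 1"
proof -
  have "f \<noteq> 0" using assms(2) by auto
  then have "order x f \<noteq> 0"
    using assms(1) by (simp add: order_root)
  moreover have "\<not> 2 \<le> order x f"
  proof
    assume "2 \<le> order x f"
    then have "[:- x, 1:] ^ 2 dvd f"
      by (simp add: order_divides)
    then obtain g where "f = [:- x, 1:] ^ 2 * g"
      by (elim dvdE)
    then have "f = [:- x, 1:] * ([:- x, 1:] * g)"
      by (simp only: power2_eq_square mult.assoc)
    then have "poly (pderiv f) x = 0"
      by (simp only: pderiv_mult) (simp add: pderiv_pCons)
    then show False
      using assms(2) by blast
  qed
  ultimately show ?thesis by linarith
qed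

lemma card_roots_simple:
  fixes f :: "'k::alg_closed_field poly"
  assumes "f \<noteq> 0" "\<And>x. poly f x = 0 \<Longrightarrow> poly (pderiv f) x \<noteq> 0"
  shows "card {x. poly f x = 0} = degree f"
proof -
  have "order x f = 1" if "poly f x = 0" for x
    by (rule order_eq_1I[OF that assms(2)[OF that]])
  then have "size (proots f) = card {x. poly f x = 0}"
    using assms(1) by (simp add: size_multiset_overloaded_eq)
  then show ?thesis
    by (simp add: alg_closed_proots)
qed

lemma poly_prod_mset: "poly (\<Prod>x\<in>#A. f x) y = (\<Prod>x\<in>#A. poly (f x) y)"
  for f :: "'a \<Rightarrow> 'b::comm_semiring_1 poly"
  by (induction A) auto

section \<open>Finite subfields of an algebraically closed field\<close>

text \<open>Every finite field of characteristic \<open>p\<close> is realised as a subset of one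
  type, so that passing to an extension never changes the type. The parameter \<open>K\<close> names
  this type.\<close>

locale char_p_closed =
  fixes p :: nat and K :: "'k::alg_closed_field itself"
  assumes prime_p: "prime p" and odd_p: "odd p" and CHAR_K: "CHAR('k) = p"
begin

text \<open>Fixed points of a power of Frobenius: for \<open>j > 0\<close> the field with
  \<open>p ^ j\<close> elements, for \<open>j = 0\<close> all of \<open>'k\<close>.\<close>

definition Fq :: "nat \<Rightarrow> 'k set" where
  "Fq j = {x. x ^ (p ^ j) = x}"

lemma p_gt_2: "p > 2"
  using prime_p odd_p by (metis odd_numeral order_le_less prime_ge_2_nat even_numeral)

lemma frob_add: "(x + y :: 'k) ^ (p ^ j) = x ^ (p ^ j) + y ^ (p ^ j)"
  by (rule freshmans_dream') (use prime_p CHAR_K in auto)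

lemma frob_sum: "(\<Sum>i\<in>A. f i :: 'k) ^ (p ^ j) = (\<Sum>i\<in>A. f i ^ (p ^ j))"
  by (induction A rule: infinite_finite_induct)
     (use p_gt_2 in \<open>auto simp: frob_add zero_power\<close>)

lemma frob_minus: "(- x :: 'k) ^ (p ^ j) = - (x ^ (p ^ j))"
  using odd_p by simp

lemma frob_diff: "(x - y :: 'k) ^ (p ^ j) = x ^ (p ^ j) - y ^ (p ^ j)"
  using frob_add[of x "- y"] by (simp add: frob_minus)

lemma frob_inj: "(x :: 'k) ^ (p ^ j) = y ^ (p ^ j) \<longleftrightarrow> x = y"
proof
  assume "x ^ (p ^ j) = y ^ (p ^ j)"
  then have "(x - y) ^ (p ^ j) = 0" by (simp add: frob_diff)
  then show "x = y" by simp
qed auto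

lemma Fq_0 [simp, intro]: "0 \<in> Fq j" using p_gt_2 by (simp add: Fq_def zero_power)
lemma Fq_1 [simp, intro]: "1 \<in> Fq j" by (simp add: Fq_def)
lemma Fq_add [intro]: "x \<in> Fq j \<Longrightarrow> y \<in> Fq j \<Longrightarrow> x + y \<in> Fq j" by (simp add: Fq_def frob_add)
lemma Fq_diff [intro]: "x \<in> Fq j \<Longrightarrow> y \<in> Fq j \<Longrightarrow> x - y \<in> Fq j" by (simp add: Fq_def frob_diff)
lemma Fq_minus [intro]: "x \<in> Fq j \<Longrightarrow> - x \<in> Fq j" unfolding Fq_def mem_Collect_eq frob_minus by simp
lemma Fq_mult [intro]: "x \<in> Fq j \<Longrightarrow> y \<in> Fq j \<Longrightarrow> x * y \<in> Fq j" by (simp add: Fq_def power_mult_distrib)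
lemma Fq_inverse [intro]: "x \<in> Fq j \<Longrightarrow> inverse x \<in> Fq j" by (simp add: Fq_def power_inverse)
lemma Fq_power [intro]: "x \<in> Fq j \<Longrightarrow> x ^ n \<in> Fq j"
  by (simp add: Fq_def) (metis mult.commute power_mult)
lemma Fq_sum [intro]: "(\<And>i. i \<in> A \<Longrightarrow> f i \<in> Fq j) \<Longrightarrow> sum f A \<in> Fq j"
  by (simp add: Fq_def frob_sum)

lemma Fq_frob: "x \<in> Fq j \<Longrightarrow> x ^ (p ^ j) = x" by (simp add: Fq_def)

text \<open>The derivative of \<open>X ^ (p ^ j) - X\<close> is \<open>- 1\<close> in characteristic
  \<open>p\<close>, so all roots are simple.\<close>

lemma card_Fq:
  assumes "j > 0"
  shows "card (Fq j) = p ^ j" "finite (Fq j)"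
proof -
  define f :: "'k poly" where "f = monom 1 (p ^ j) + - monom 1 1"
  have "p ^ j > 1"
    using p_gt_2 assms by (metis One_nat_def Suc_lessD numeral_2_eq_2 one_less_power)
  then have deg: "degree f = p ^ j"
    unfolding f_def by (subst degree_add_eq_left) (auto simp: degree_monom_eq)
  then have "f \<noteq> 0"
    using \<open>p ^ j > 1\<close> by (metis degree_0 not_one_less_zero)
  have "of_nat (p ^ j) = (0 :: 'k)"
    using assms CHAR_K by (simp add: of_nat_eq_0_iff_char_dvd del: of_nat_power)
  then have pd: "pderiv f = - 1"
    by (simp add: f_def pderiv_diff pderiv_monom monom_0 one_pCons del: of_nat_power)
  have root: "poly f x = 0 \<longleftrightarrow> x \<in> Fq j" for x
    by (simp add: f_def Fq_def poly_monom)
  show "card (Fq j) = p ^ j"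
    using card_roots_simple[OF \<open>f \<noteq> 0\<close>] pd deg root by simp
  then show "finite (Fq j)"
    using p_gt_2 by (metis card.infinite not_less0 zero_less_power zero_less_numeral less_trans)
qed

lemma infinite_K: "infinite (UNIV :: 'k set)"
proof
  assume fin: "finite (UNIV :: 'k set)"
  have "card (Fq (Suc n)) \<le> card (UNIV :: 'k set)" for n
    using fin by (intro card_mono) auto
  from this[of "card (UNIV :: 'k set)"] have "p ^ Suc (card (UNIV :: 'k set)) \<le> card (UNIV :: 'k set)"
    using card_Fq(1)[of "Suc (card (UNIV :: 'k set))"] by simp
  moreover have "n < p ^ n" for n
    using p_gt_2 by (simp add: less_exp power_gt_expt)
  ultimately show False
    by (meson Suc_lessD leD less_le_trans)
qed

section \<open>Euler's criterion and the quadratic character\<close>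

lemma Fq_pow_eq_1: "x \<in> Fq j \<Longrightarrow> x \<noteq> 0 \<Longrightarrow> x ^ (p ^ j - 1) = 1"
  using Fq_frob[of x j] p_gt_2
  by (metis mult_cancel_left1 power_eq_if power_not_zero not_numeral_less_zero mult.commute)

lemma half_Fq_order: "2 * ((p ^ j - 1) div 2) = p ^ j - 1"
  using odd_p p_gt_2 by simp

lemma Fq_half_pow: "x \<in> Fq j \<Longrightarrow> x \<noteq> 0 \<Longrightarrow> x ^ ((p ^ j - 1) div 2) = 1 \<or> x ^ ((p ^ j - 1) div 2) = - 1"
  using Fq_pow_eq_1[of x j] half_Fq_order[of j]
  by (metis power2_eq_1_iff power_mult mult.commute)

lemma one_neq_minus_one: "(1 :: 'k) \<noteq> - 1"
proof
  assume "(1 :: 'k) = - 1"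
  then have "of_nat 2 = (0 :: 'k)" by (simp add: eq_neg_iff_add_eq_0)
  then have "p dvd 2"
    using CHAR_K of_nat_eq_0_iff_char_dvd[of 2, where 'a='k] by simp
  then show False
    using p_gt_2 by (auto dest: dvd_imp_le)
qed

text \<open>The quadratic character of \<open>Fq j\<close>, read off from Euler's criterion.
  Arguments outside \<open>Fq j\<close> also receive a value, so multiplicativity is claimed only
  inside.\<close>

definition eta :: "nat \<Rightarrow> 'k \<Rightarrow> int" where
  "eta j x = (if x = 0 then 0 else if x ^ ((p ^ j - 1) div 2) = 1 then 1 else - 1)"

lemma eta_0 [simp]: "eta j 0 = 0" and eta_1 [simp]: "eta j 1 = 1"
  by (simp_all add: eta_def)

lemma eta_mult:
  assumes "x \<in> Fq j" "y \<in> Fq j"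
  shows "eta j (x * y) = eta j x * eta j y"
proof (cases "x = 0 \<or> y = 0")
  case False
  have y: "y ^ ((p ^ j - 1) div 2) = 1 \<or> y ^ ((p ^ j - 1) div 2) = - 1"
    using Fq_half_pow[OF assms(2)] False by blast
  have x: "x ^ ((p ^ j - 1) div 2) = 1 \<or> x ^ ((p ^ j - 1) div 2) = - 1"
    using Fq_half_pow[OF assms(1)] False by blast
  show ?thesis
    using x y one_neq_minus_one one_neq_minus_one[symmetric] False
    by (elim disjE) (simp_all only: eta_def power_mult_distrib mult_eq_0_iff if_False if_True mult_1 mult_1_right
        mult_minus1 mult_minus1_right minus_minus simp_thms de_Morgan_disj)
qed auto

lemma eta_abs: "\<bar>eta j x\<bar> \<le> 1" by (simp add: eta_def)

lemma eta_nonzero: "eta j x = 0 \<longleftrightarrow> x = 0" by (simp add: eta_def)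

lemma eta_square: "x \<noteq> 0 \<Longrightarrow> eta j x * eta j x = 1" by (simp add: eta_def)

lemma eta_power2: "x \<in> Fq j \<Longrightarrow> x \<noteq> 0 \<Longrightarrow> eta j (x ^ 2) = 1"
  using eta_mult[of x j x] eta_square[of x j] by (simp add: power2_eq_square)

section \<open>Norms to the prime field\<close>

definition Fnorm :: "nat \<Rightarrow> 'k \<Rightarrow> 'k" where
  "Fnorm j x = (\<Prod>i<j. x ^ (p ^ i))"

lemma Fnorm_mult: "Fnorm j (x * y) = Fnorm j x * Fnorm j y"
  by (simp add: Fnorm_def power_mult_distrib prod.distrib)

lemma Fnorm_power: "Fnorm j (x ^ n) = Fnorm j x ^ n"
  by (simp add: Fnorm_def prod_power_distrib mult.commute flip: power_mult)

lemma Fnorm_eq: "Fnorm j x = x ^ (\<Sum>i<j. p ^ i)"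
  by (simp add: Fnorm_def power_sum)

lemma geometric_nat: "(p - 1) * (\<Sum>i<j. p ^ i) = p ^ j - 1"
  using p_gt_2 by (induction j) (auto simp: algebra_simps)

text \<open>By the geometric sum in the exponent,
  \<open>Fnorm j x ^ (p - 1) = x ^ (p ^ j - 1)\<close>, which is \<open>1\<close> for nonzero
  \<open>x\<close> in \<open>Fq j\<close>.\<close>

lemma Fnorm_Fq: "x \<in> Fq j \<Longrightarrow> Fnorm j x \<in> Fq 1"
proof -
  assume x: "x \<in> Fq j"
  have "Fnorm j x ^ p = Fnorm j x"
  proof (cases "x = 0")
    case True
    then have "Fnorm j x = 0 \<or> Fnorm j x = 1"
      using p_gt_2 by (cases "j = 0") (auto simp: Fnorm_def)
    then show ?thesis using p_gt_2 by auto
  next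
    case False
    have "Fnorm j x ^ (p - 1) = x ^ (p ^ j - 1)"
      unfolding Fnorm_eq power_mult[symmetric] mult.commute[of _ "p - 1"] geometric_nat ..
    then have "Fnorm j x ^ (p - 1) = 1" using Fq_pow_eq_1 x False by simp
    then show ?thesis using p_gt_2 by (metis mult_1_right power_eq_if not_numeral_less_zero)
  qed
  then show ?thesis by (simp add: Fq_def)
qed

lemma Fnorm_eq_0_iff: "j > 0 \<Longrightarrow> Fnorm j x = 0 \<longleftrightarrow> x = 0"
  using p_gt_2 by (auto simp: Fnorm_def)

text \<open>Euler's exponent for \<open>Fq j\<close> is the one for \<open>Fq 1\<close> times the
  exponent of the norm. This turns quadratic characters of norms into quadratic characters over the
  extension field.\<close>

lemma eta_Fnorm:
  assumes "j > 0"
  shows "eta 1 (Fnorm j x) = eta j x"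
proof -
  have "(p ^ j - 1) div 2 = (p - 1) div 2 * (\<Sum>i<j. p ^ i)"
    using geometric_nat[of j] half_Fq_order[of 1] half_Fq_order[of j]
    by (metis (no_types, lifting) mult.assoc mult_left_cancel nonzero_mult_div_cancel_left power_one_right zero_neq_numeral)
  then show ?thesis
    by (simp add: eta_def Fnorm_eq_0_iff[OF assms]) (simp add: Fnorm_eq mult.commute flip: power_mult)
qed

section \<open>Polynomials over finite subfields\<close>

definition PolyF :: "nat \<Rightarrow> nat \<Rightarrow> 'k poly set" where
  "PolyF j D = {h. (\<forall>i. coeff h i \<in> Fq j) \<and> (\<forall>i\<ge>D. coeff h i = 0)}"

lemma PolyF_eq_image:
  "PolyF j D = (\<lambda>c. \<Sum>i<D. monom (c i) i) ` (PiE {..<D} (\<lambda>_. Fq j))"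
proof (intro equalityI subsetI)
  fix h assume h: "h \<in> PolyF j D"
  have "h = (\<Sum>i<D. monom (restrict (coeff h) {..<D} i) i)"
    using h by (intro poly_eqI) (auto simp: coeff_sum PolyF_def)
  then show "h \<in> (\<lambda>c. \<Sum>i<D. monom (c i) i) ` (PiE {..<D} (\<lambda>_. Fq j))"
    using h by (intro image_eqI[where x = "restrict (coeff h) {..<D}"]) (auto simp: PolyF_def)
next
  fix h assume "h \<in> (\<lambda>c. \<Sum>i<D. monom (c i) i) ` (PiE {..<D} (\<lambda>_. Fq j))"
  then obtain c where c: "c \<in> PiE {..<D} (\<lambda>_. Fq j)" and h: "h = (\<Sum>i<D. monom (c i) i)" by auto
  have "coeff h i = (if i < D then c i else 0)" for i
    by (auto simp: h coeff_sum)
  then show "h \<in> PolyF j D"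
    using c by (auto simp: PolyF_def)
qed

lemma card_PolyF:
  assumes "j > 0"
  shows "card (PolyF j D) = (p ^ j) ^ D" "finite (PolyF j D)"
proof -
  have "inj_on (\<lambda>c. \<Sum>i<D. monom (c i) i) (PiE {..<D} (\<lambda>_. Fq j))"
  proof (rule inj_onI)
    fix c d assume cd: "c \<in> PiE {..<D} (\<lambda>_. Fq j)" "d \<in> PiE {..<D} (\<lambda>_. Fq j)"
      and eq: "(\<Sum>i<D. monom (c i) i) = (\<Sum>i<D. monom (d i) i)"
    have "c i = d i" if "i < D" for i
      using arg_cong[OF eq, of "\<lambda>h. coeff h i"] that by (simp add: coeff_sum)
    then show "c = d"
      using cd by (intro PiE_ext[OF cd]) auto
  qed
  then show "card (PolyF j D) = (p ^ j) ^ D"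
    by (simp add: PolyF_eq_image card_image card_PiE card_Fq assms)
  show "finite (PolyF j D)"
    unfolding PolyF_eq_image by (intro finite_imageI finite_PiE) (auto simp: card_Fq assms)
qed

lemma PolyF_add: "g \<in> PolyF j D \<Longrightarrow> h \<in> PolyF j D \<Longrightarrow> g + h \<in> PolyF j D"
  and PolyF_diff: "g \<in> PolyF j D \<Longrightarrow> h \<in> PolyF j D \<Longrightarrow> g - h \<in> PolyF j D"
  and PolyF_0: "0 \<in> PolyF j D"
  by (auto simp: PolyF_def)

definition coeffs_in :: "nat \<Rightarrow> 'k poly \<Rightarrow> bool" where
  "coeffs_in j h \<longleftrightarrow> (\<forall>i. coeff h i \<in> Fq j)"

lemma coeffs_in_0 [simp]: "coeffs_in j 0" and coeffs_in_1 [simp]: "coeffs_in j 1"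
  by (auto simp: coeffs_in_def coeff_1)
lemma coeffs_in_add: "coeffs_in j g \<Longrightarrow> coeffs_in j h \<Longrightarrow> coeffs_in j (g + h)" by (auto simp: coeffs_in_def)
lemma coeffs_in_diff: "coeffs_in j g \<Longrightarrow> coeffs_in j h \<Longrightarrow> coeffs_in j (g - h)" by (auto simp: coeffs_in_def)
lemma coeffs_in_mult: "coeffs_in j g \<Longrightarrow> coeffs_in j h \<Longrightarrow> coeffs_in j (g * h)"
  by (auto simp: coeffs_in_def coeff_mult)
lemma coeffs_in_smult: "c \<in> Fq j \<Longrightarrow> coeffs_in j h \<Longrightarrow> coeffs_in j (smult c h)" by (auto simp: coeffs_in_def)
lemma coeffs_in_pow: "coeffs_in j g \<Longrightarrow> coeffs_in j (g ^ n)" by (induction n) (auto simp: coeffs_in_mult)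
lemma coeffs_in_sum: "(\<And>i. i \<in> A \<Longrightarrow> coeffs_in j (f i)) \<Longrightarrow> coeffs_in j (sum f A)"
  by (auto simp: coeffs_in_def coeff_sum)
lemma coeffs_in_monom: "c \<in> Fq j \<Longrightarrow> coeffs_in j (monom c n)" by (auto simp: coeffs_in_def)
lemma coeffs_in_linear: "x \<in> Fq j \<Longrightarrow> coeffs_in j [:x, 1:]"
  by (auto simp: coeffs_in_def coeff_pCons split: nat.splits)

lemma coeffs_in_frob: "coeffs_in j h \<Longrightarrow> poly h (x ^ (p ^ j)) = poly h x ^ (p ^ j)"
  by (auto simp: coeffs_in_def poly_altdef frob_sum power_mult_distrib Fq_frob power_mult[symmetric] mult.commute)

lemma coeffs_in_poly: "coeffs_in j h \<Longrightarrow> x \<in> Fq j \<Longrightarrow> poly h x \<in> Fq j"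
  using coeffs_in_frob[of j h x] by (simp add: Fq_def)

end

section \<open>Stepanov's method\<close>

lemma poly_at_monom:
  "poly L (monom 1 P) = (\<Sum>k\<le>degree L. monom 1 (P * k) * coeff L k)" for L :: "'a::comm_ring_1 poly poly"
  by (simp add: poly_altdef monom_power mult.commute)

text \<open>Substituting \<open>X ^ P\<close> for the outer variable writes a polynomial in base
  \<open>X ^ P\<close>. Digits of degree below \<open>P\<close> do not overlap, so nothing can
  cancel.\<close>

lemma poly_at_monom_eq_0:
  fixes L :: "'a::comm_ring_1 poly poly"
  assumes deg: "\<And>j. degree (coeff L j) < P" and zero: "poly L (monom 1 P) = 0"
  shows "L = 0"
proof (intro poly_eqI)
  fix j i
  show "coeff (coeff L j) i = coeff (coeff 0 j) i"
  proof (cases "i < P \<and> j \<le> degree L")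
    case True
    have "coeff (monom 1 (P * k) * coeff L k) (P * j + i) = (if k = j then coeff (coeff L j) i else 0)" for k
    proof (cases k j rule: linorder_cases)
      case less
      then have "P * j \<ge> P * k + P"
        by (metis Suc_leI mult_Suc_right mult_le_mono2 add.commute)
      then have "degree (coeff L k) < P * j + i - P * k"
        using deg[of k] by linarith
      then show ?thesis
        using less by (simp add: coeff_monom_mult coeff_eq_0)
    next
      case greater
      then have "P * k \<ge> P * j + P"
        by (metis Suc_leI mult_Suc_right mult_le_mono2 add.commute)
      then have "P * j + i < P * k"
        using True by linarith
      then show ?thesis
        using greater by (simp add: coeff_monom_mult)
    qed (simp add: coeff_monom_mult)
    then have "coeff (poly L (monom 1 P)) (P * j + i) = coeff (coeff L j) i"
      using True by (simp add: poly_at_monom coeff_sum)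
    then show ?thesis
      using zero by simp
  next
    case False
    then show ?thesis
      using deg[of j] by (auto simp: coeff_eq_0 not_less)
  qed
qed

lemma degree_coeff_mult:
  fixes A B :: "'a::comm_ring_1 poly poly"
  assumes "\<And>j. degree (coeff A j) \<le> m" "\<And>j. degree (coeff B j) \<le> n"
  shows "degree (coeff (A * B) j) \<le> m + n"
  unfolding coeff_mult
  by (intro degree_sum_le) (auto intro!: order.trans[OF degree_mult_le] add_mono assms)

lemma order_power: "F \<noteq> 0 \<Longrightarrow> order x (F ^ n) = n * order x F" for F :: "'a::idom poly"
  by (induction n) (auto simp: order_mult)

context char_p_closed
begin

text \<open>In characteristic \<open>p\<close> the power \<open>F ^ P\<close> is a polynomial in
  \<open>X ^ P\<close> with constant coefficients; viewed in two variables it no longer involves the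
  inner one.\<close>

lemma poly_power_frob:
  fixes F :: "'k poly"
  assumes "P = p ^ l"
  shows "F ^ P = poly (map_poly (\<lambda>c. [:c ^ P:]) F) (monom 1 P)"
proof -
  have P: "P > 0" using assms p_gt_2 by simp
  define FZ where "FZ = map_poly (\<lambda>c. [:c ^ P:]) F"
  have coeff: "coeff FZ i = [:coeff F i ^ P:]" for i
    using P by (simp add: FZ_def coeff_map_poly)
  have deg: "degree FZ = degree F"
    unfolding FZ_def using P by (intro degree_map_poly) auto
  have frob: "(\<Sum>i\<in>A. f i) ^ P = (\<Sum>i\<in>A. f i ^ P)" for A :: "nat set" and f :: "nat \<Rightarrow> 'k poly"
  proof (induction A rule: infinite_finite_induct)
    case (insert x A)
    have "(f x + sum f A) ^ P = f x ^ P + sum f A ^ P"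
      by (rule freshmans_dream'[of _ l]) (use prime_p CHAR_K assms in auto)
    then show ?case using insert by simp
  qed (use P in auto)
  have "F ^ P = (\<Sum>i\<le>degree F. monom (coeff F i) i) ^ P"
    by (simp add: poly_as_sum_of_monoms)
  also have "\<dots> = (\<Sum>i\<le>degree F. monom 1 (P * i) * [:coeff F i ^ P:])"
    by (simp add: frob monom_power mult.commute smult_monom)
  also have "\<dots> = poly FZ (monom 1 P)"
    by (simp add: poly_at_monom coeff deg)
  finally show ?thesis by (simp add: FZ_def)
qed

text \<open>Otherwise \<open>F * A0\<^sup>2\<close> and \<open>F ^ P * A1\<^sup>2\<close> would agree, even with \<open>X\<close> and \<open>X ^ P\<close> treated as independent
  variables, because the degrees in \<open>X\<close> are below \<open>P\<close>; the orders at \<open>\<theta>\<close> then have different parity.\<close>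

lemma stepanov_nonvanishing:
  fixes A0 A1 :: "'k poly poly"
  assumes F: "F \<noteq> 0" "odd (order \<theta> F)" and P: "P = p ^ l" "2 * u + 1 = P"
    and deg: "\<And>j. degree (coeff A0 j) \<le> a" "\<And>j. degree (coeff A1 j) \<le> a" "degree F + 2 * a < P"
    and zero: "poly A0 (monom 1 P) + F ^ u * poly A1 (monom 1 P) = 0"
  shows "A0 = 0 \<and> A1 = 0"
proof -
  have P0: "P > 0" using P(2) by linarith
  define Z :: "'k poly" where "Z = monom 1 P"
  define FZ where "FZ = map_poly (\<lambda>c. [:c ^ P:]) F"
  have FP: "F ^ P = poly FZ Z" unfolding FZ_def Z_def by (rule poly_power_frob) fact
  then have FZ0: "FZ \<noteq> 0" using F(1) by auto
  have cFZ: "coeff FZ i = [:coeff F i ^ P:]" for i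
    using P0 by (simp add: FZ_def coeff_map_poly)
  define L where "L = [:F:] * (A0 * A0) - FZ * (A1 * A1)"
  have A0Z: "poly A0 Z = - (F ^ u * poly A1 Z)"
    using zero by (simp add: Z_def add_eq_0_iff2)
  have "F * (F ^ u * F ^ u) = F ^ P"
    unfolding P(2)[symmetric] by (simp add: mult_2 power_add)
  then have "poly L Z = 0"
    by (simp add: L_def A0Z flip: FP)
  moreover have "degree (coeff L j) < P" for j
  proof -
    have "degree (coeff ([:F:] * (A0 * A0)) j) \<le> degree F + (a + a)"
      by (intro degree_coeff_mult deg) (auto simp: coeff_pCons split: nat.splits)
    moreover have "degree (coeff (FZ * (A1 * A1)) j) \<le> degree F + (a + a)"
      by (intro degree_coeff_mult deg) (auto simp: cFZ)
    ultimately have "degree (coeff L j) \<le> degree F + (a + a)"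
      unfolding L_def coeff_diff by (rule degree_diff_le)
    then show ?thesis using deg(3) by simp
  qed
  ultimately have "L = 0"
    unfolding Z_def by (intro poly_at_monom_eq_0) auto
  then have eq: "[:F:] * (A0 * A0) = FZ * (A1 * A1)" by (simp add: L_def)
  have "A0 = 0"
  proof (rule ccontr)
    assume A0: "A0 \<noteq> 0"
    \<comment> \<open>A constant \<open>z\<close> is substituted for \<open>X ^ P\<close>. All but
      finitely many \<open>z\<close> keep \<open>A0\<close> nonzero, and \<open>FZ\<close> becomes a
      constant, so that \<open>F\<close> is the only source of an odd order at
      \<open>\<theta>\<close>.\<close>
    have "finite {w. poly A0 w = 0}"
      using A0 by (simp add: poly_roots_finite)
    then have "finite ((\<lambda>c. [:c:]) -` {w. poly A0 w = 0})"
      by (rule finite_vimageI) (auto intro!: injI)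
    then obtain z where z: "poly A0 [:z:] \<noteq> 0"
      using ex_new_if_finite[OF infinite_K] by blast
    have e: "F * (poly A0 [:z:] * poly A0 [:z:]) = poly FZ [:z:] * (poly A1 [:z:] * poly A1 [:z:])"
      using arg_cong[OF eq, of "\<lambda>L. poly L [:z:]"] by simp
    have "poly FZ [:z:] = [:poly (map_poly (\<lambda>c. c ^ P) F) z:]"
      unfolding FZ_def using P0 by (induction F) (auto simp: map_poly_pCons)
    then obtain w where w: "poly FZ [:z:] = [:w:]" by blast
    have e': "F * (poly A0 [:z:] * poly A0 [:z:]) = smult w (poly A1 [:z:] * poly A1 [:z:])"
      using e w by simp
    have nz: "F * (poly A0 [:z:] * poly A0 [:z:]) \<noteq> 0"
      using z F by simp
    then have nz': "w \<noteq> 0" "poly A1 [:z:] \<noteq> 0" using e' by auto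
    have "order \<theta> (F * (poly A0 [:z:] * poly A0 [:z:])) = order \<theta> F + 2 * order \<theta> (poly A0 [:z:])"
      using nz z by (simp add: order_mult)
    moreover have "order \<theta> (smult w (poly A1 [:z:] * poly A1 [:z:])) = 2 * order \<theta> (poly A1 [:z:])"
      using nz' by (simp add: order_smult order_mult)
    ultimately show False
      using e' F(2) by (metis even_add even_mult_iff even_numeral)
  qed
  then show ?thesis
    using eq FZ0 by simp
qed

text \<open>Since \<open>P\<^sup>2 - 1 = 2 * u * (P + 1)\<close>, the value \<open>y = F(t) ^ u\<close> satisfies \<open>y ^ (P + 1) = s\<close> at the points to be
  counted. Hence a nontrivial relation \<open>F ^ u * E0 + s * E1 = 0\<close> with \<open>E0\<close>, \<open>E1\<close> polynomials in \<open>X ^ P\<close> and \<open>X\<close>,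
  which exists by the pigeonhole principle, makes \<open>H = E0 ^ P + F ^ u * E1 ^ P\<close> vanish there; on \<open>Fq (2 * l)\<close> the
  powers \<open>E0 ^ P\<close>, \<open>E1 ^ P\<close> can be reduced by \<open>t ^ P\<^sup>2 = t\<close> to polynomials of small degree.\<close>

lemma stepanov_count:
  fixes F :: "'k poly"
  assumes l: "l > 0" and P: "P = p ^ l" and F: "coeffs_in (2 * l) F" "F \<noteq> 0" "odd (order \<theta> F)"
    and s: "s = 1 \<or> s = - 1" and d: "d = degree F"
  shows "2 * card {t \<in> Fq (2 * l). poly F t ^ ((P\<^sup>2 - 1) div 2) = s} \<le> P\<^sup>2 + 2 * (2 * d + 1) * P"
proof -
  define S where "S = {t \<in> Fq (2 * l). poly F t ^ ((P\<^sup>2 - 1) div 2) = s}"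
  define u where "u = (P - 1) div 2"
  have Pu: "P = 2 * u + 1"
    using odd_p p_gt_2 P by (simp add: u_def odd_pos)
  have P0: "P > 0" using Pu by simp
  have PQ: "p ^ (2 * l) = P\<^sup>2" by (simp add: P mult.commute flip: power_mult)
  have l2: "2 * l > 0" using l by simp
  have S_le: "card S \<le> P\<^sup>2"
    unfolding PQ[symmetric] card_Fq(1)[OF l2, symmetric] S_def by (intro card_mono card_Fq(2) l2) auto
  have d1: "d \<ge> 1"
    using order_degree[OF F(2), of \<theta>] F(3) d by (metis One_nat_def Suc_leI le_zero_eq neq0_conv odd_pos not_less)
  show ?thesis
  proof (cases "u < 2 * d")
    case True
    \<comment> \<open>For such small \<open>P\<close> the claim is weaker than the trivial bound
      \<open>card S \<le> P\<^sup>2\<close>.\<close>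
    then have "P * P \<le> (2 * (2 * d + 1)) * P"
      by (intro mult_right_mono) (auto simp: Pu)
    then have "2 * card S \<le> P\<^sup>2 + 2 * (2 * d + 1) * P"
      using S_le unfolding power2_eq_square by linarith
    then show ?thesis by (simp only: S_def)
  next
    case False
    \<comment> \<open>Three demands fix \<open>a\<close> and \<open>b\<close>: the
      \<open>2 * (a * b)\<close> free coefficients must outnumber the \<open>D\<close> coefficients
      of \<open>G c\<close>, which holds once \<open>u \<ge> 2 * d\<close>; \<open>a\<close> must be
      small enough for \<open>stepanov_nonvanishing\<close>; and \<open>b\<close> must be close to
      \<open>P / 2\<close>, so that the degree of \<open>H\<close> is about half of
      \<open>P\<^sup>2\<close>.\<close>
    define a where "a = u - d"
    have ad: "a \<ge> d" "u = a + d" using False by (auto simp: a_def)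
    define b where "b = u + 1 + d"
    define I where "I = {..<a} \<times> {..<b}"
    define J where "J = (UNIV :: bool set) \<times> I"
    define E where "E = (\<lambda>e (c :: bool \<times> nat \<times> nat \<Rightarrow> 'k). \<Sum>(i, j)\<in>I. monom (c (e, i, j)) (P * i + j))"
    define G where "G = (\<lambda>c. F ^ u * E False c + smult s (E True c))"
    define D where "D = u * d + P * (a - 1) + b"
    have fin: "finite I" "finite J" by (auto simp: I_def J_def)
    have sF: "s \<in> Fq (2 * l)" using s by auto
    have degE: "degree (E e c) \<le> P * (a - 1) + (b - 1)" for e c
      unfolding E_def
    proof (rule degree_sum_le[OF fin(1)], clarify)
      fix i j assume ij: "(i, j) \<in> I"
      have "P * i + j \<le> P * (a - 1) + (b - 1)"
        using ij by (intro add_mono mult_le_mono2) (auto simp: I_def)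
      then show "degree (monom (c (e, i, j)) (P * i + j)) \<le> P * (a - 1) + (b - 1)"
        by (rule order.trans[OF degree_monom_le])
    qed
    have GP: "G c \<in> PolyF (2 * l) D" if c: "c \<in> PiE J (\<lambda>_. Fq (2 * l))" for c
    proof -
      have E: "coeffs_in (2 * l) (E e c)" for e
        unfolding E_def using c by (intro coeffs_in_sum) (auto intro!: coeffs_in_monom simp: J_def)
      then have "coeffs_in (2 * l) (G c)"
        unfolding G_def by (intro coeffs_in_add coeffs_in_mult coeffs_in_pow coeffs_in_smult F sF) auto
      moreover have "degree (G c) \<le> u * d + (P * (a - 1) + (b - 1))"
        unfolding G_def
      proof (rule degree_add_le)
        show "degree (F ^ u * E False c) \<le> u * d + (P * (a - 1) + (b - 1))"
          using degree_power_le[of F u] degE[of False c] d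
          by (intro order.trans[OF degree_mult_le]) (simp add: mult.commute add_mono)
        show "degree (smult s (E True c)) \<le> u * d + (P * (a - 1) + (b - 1))"
          using degE[of True c] by (intro order.trans[OF degree_smult_le]) simp
      qed
      moreover have "b > 0" by (simp add: b_def)
      ultimately show ?thesis
        by (auto simp: PolyF_def coeffs_in_def D_def intro!: coeff_eq_0)
    qed
    have cards: "D < 2 * (a * b)"
    proof -
      obtain a' where a': "a = Suc a'" using ad d1 by (cases a) auto
      have b_eq: "b = a + 2 * d + 1" using ad by (simp add: b_def)
      have P_eq: "P = 2 * a + 2 * d + 1" using ad Pu by simp
      have "d * d \<le> a * d" using ad by simp
      moreover have "2 * (a * b) + d * d = D + (a * d + 2 * a)"
        unfolding D_def b_eq P_eq ad(2) a' by (simp add: algebra_simps)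
      ultimately show ?thesis using a' by linarith
    qed
    have "card (G ` PiE J (\<lambda>_. Fq (2 * l))) \<le> card (PolyF (2 * l) D)"
      by (intro card_mono card_PolyF l2) (use GP in auto)
    also have "\<dots> = (p ^ (2 * l)) ^ D" by (rule card_PolyF) fact
    also have "\<dots> < (p ^ (2 * l)) ^ (2 * (a * b))"
      using cards p_gt_2 l by (intro power_strict_increasing one_less_power) auto
    also have "2 * (a * b) = card J" by (simp add: J_def I_def)
    also have "(p ^ (2 * l)) ^ card J = card (PiE J (\<lambda>_. Fq (2 * l)))"
      using fin by (simp add: card_PiE card_Fq[OF l2])
    finally have "\<not> inj_on G (PiE J (\<lambda>_. Fq (2 * l)))" by (rule pigeonhole)
    then obtain c1 c2 where c12: "c1 \<in> PiE J (\<lambda>_. Fq (2 * l))" "c2 \<in> PiE J (\<lambda>_. Fq (2 * l))"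
        "G c1 = G c2" "c1 \<noteq> c2" by (auto simp: inj_on_def)
    define c where "c = (\<lambda>k. c1 k - c2 k)"
    have cF: "c k \<in> Fq (2 * l)" if "k \<in> J" for k
      using c12 that by (auto simp: c_def)
    have "\<exists>k\<in>J. c k \<noteq> 0"
      using PiE_ext[OF c12(1,2)] c12(4) by (auto simp: c_def)
    then obtain e0 i0 j0 where c0: "(i0, j0) \<in> I" "c (e0, i0, j0) \<noteq> 0"
      by (auto simp: J_def)
    have "E e c = E e c1 - E e c2" for e
      by (simp add: E_def c_def case_prod_unfold flip: sum_subtractf diff_monom)
    then have "G c = G c1 - G c2"
      by (simp add: G_def right_diff_distrib smult_diff_right)
    then have Gc: "G c = 0"
      using c12(3) by simp
    \<comment> \<open>Raising to the power \<open>P\<close> swaps the two variables: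
      \<open>(t ^ (P * i + j)) ^ P = t ^ i * (t ^ P) ^ j\<close> on \<open>Fq (2 * l)\<close>. The
      degrees in the inner variable are therefore below \<open>a\<close>, as the nonvanishing
      argument needs.\<close>
    define A where "A = (\<lambda>e. \<Sum>(i, j)\<in>I. monom (monom (c (e, i, j) ^ P) i) j)"
    define H where "H = poly (A False) (monom 1 P) + F ^ u * poly (A True) (monom 1 P)"
    have coeffA: "coeff (A e) j = (\<Sum>k\<in>I. if snd k = j then monom (c (e, k) ^ P) (fst k) else 0)" for e j
      unfolding A_def by (simp add: coeff_sum case_prod_unfold)
    have "coeff (coeff (A e0) j0) i0 = (\<Sum>k\<in>I. if k = (i0, j0) then c (e0, k) ^ P else 0)"
      unfolding coeffA coeff_sum by (intro sum.cong) auto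
    then have "coeff (coeff (A e0) j0) i0 = c (e0, i0, j0) ^ P"
      using c0 fin by simp
    then have Ane: "A e0 \<noteq> 0" using c0 by auto
    have H0: "H \<noteq> 0"
    proof
      assume H0: "H = 0"
      have dA: "degree (coeff (A e) j) \<le> a - 1" for e j
        unfolding coeffA using fin(1)
        by (intro degree_sum_le) (auto simp: I_def intro!: order.trans[OF degree_monom_le])
      have "A False = 0 \<and> A True = 0"
        by (rule stepanov_nonvanishing[OF F(2,3) P, of u _ "a - 1"])
           (use dA H0 ad d1 Pu d in \<open>auto simp: H_def\<close>)
      then show False using Ane by (cases e0) auto
    qed
    have root: "poly H t = 0" if t: "t \<in> S" for t
    proof -
      have tF: "t \<in> Fq (2 * l)" and ts: "poly F t ^ ((P\<^sup>2 - 1) div 2) = s"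
        using t by (auto simp: S_def)
      have tQ: "t ^ (P * P) = t" using tF PQ by (simp add: Fq_def power2_eq_square)
      define y where "y = poly F t ^ u"
      define E' where "E' = (\<lambda>e. poly (E e c) t)"
      have "poly (poly (A e) (monom 1 P)) t = E' e ^ P" for e
      proof -
        have "E' e ^ P = (\<Sum>k\<in>I. (c (e, k) * t ^ (P * fst k + snd k)) ^ P)"
          unfolding E'_def E_def poly_sum P by (simp add: frob_sum poly_monom case_prod_unfold)
        also have "\<dots> = (\<Sum>k\<in>I. c (e, k) ^ P * t ^ fst k * (t ^ P) ^ snd k)"
        proof (rule sum.cong[OF refl])
          fix k
          have "(t ^ (P * fst k + snd k)) ^ P = (t ^ (P * P)) ^ fst k * (t ^ P) ^ snd k"
            by (simp add: algebra_simps flip: power_mult power_add)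
          then show "(c (e, k) * t ^ (P * fst k + snd k)) ^ P = c (e, k) ^ P * t ^ fst k * (t ^ P) ^ snd k"
            by (simp add: power_mult_distrib tQ)
        qed
        also have "\<dots> = poly (poly (A e) (monom 1 P)) t"
          by (simp add: A_def poly_sum poly_monom case_prod_unfold)
        finally show ?thesis by simp
      qed
      then have Ht: "poly H t = E' False ^ P + y * E' True ^ P"
        by (simp add: H_def y_def)
      have "poly (G c) t = 0" using Gc by simp
      then have "y * E' False + s * E' True = 0"
        by (simp add: G_def y_def E'_def)
      then have "(y * E' False + s * E' True) ^ (p ^ l) = 0"
        using P0 P by simp
      then have "(y * E' False) ^ P + (s * E' True) ^ P = 0"
        unfolding frob_add P .
      moreover have "s ^ P = s"
        using s Pu by auto
      ultimately have "y * (y ^ P * E' False ^ P + s * E' True ^ P) = 0"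
        by (simp add: power_mult_distrib)
      moreover have "y * y ^ P = s"
      proof -
        have "(P\<^sup>2 - 1) div 2 = u * (P + 1)"
          by (simp add: Pu power2_eq_square algebra_simps)
        then show ?thesis using ts by (simp add: y_def power_mult power_add)
      qed
      ultimately have "s * poly H t = 0"
        by (simp add: Ht algebra_simps flip: mult.assoc[of y "y ^ P"])
      then show ?thesis using s by auto
    qed
    have degH: "degree H \<le> (a - 1) + P * (b - 1) + u * d"
    proof -
      have "poly (A e) (monom 1 P) = (\<Sum>k\<in>I. monom (c (e, k) ^ P) (fst k) * monom 1 (P * snd k))" for e
        by (simp add: A_def poly_sum poly_monom case_prod_unfold monom_power)
      moreover have "degree (\<Sum>k\<in>I. monom (c (e, k) ^ P) (fst k) * monom 1 (P * snd k)) \<le> (a - 1) + P * (b - 1)" for e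
      proof (rule degree_sum_le[OF fin(1)])
        fix k assume "k \<in> I"
        then have "fst k + P * snd k \<le> (a - 1) + P * (b - 1)"
          by (intro add_mono mult_le_mono2) (auto simp: I_def)
        then show "degree (monom (c (e, k) ^ P) (fst k) * monom 1 (P * snd k)) \<le> (a - 1) + P * (b - 1)"
          unfolding mult_monom by (rule order.trans[OF degree_monom_le])
      qed
      ultimately have dA: "degree (poly (A e) (monom 1 P)) \<le> (a - 1) + P * (b - 1)" for e
        by simp
      have "degree (F ^ u * poly (A True) (monom 1 P)) \<le> u * d + ((a - 1) + P * (b - 1))"
        using degree_power_le[of F u] dA[of True] d
        by (intro order.trans[OF degree_mult_le]) (simp add: mult.commute add_mono)
      then show ?thesis
        unfolding H_def using dA[of False] by (intro degree_add_le) auto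
    qed
    have "card S \<le> card {t. poly H t = 0}"
      using root by (intro card_mono poly_roots_finite H0) auto
    also have "\<dots> \<le> degree H" by (rule card_poly_roots_bound) fact
    finally have "card S \<le> (a - 1) + P * (b - 1) + u * d" using degH by linarith
    moreover have "2 * ((a - 1) + P * (b - 1) + u * d) \<le> P\<^sup>2 + 2 * (2 * d + 1) * P"
    proof -
      have "2 * (P * (b - 1)) + P = P\<^sup>2 + 2 * (d * P)"
        by (simp add: b_def Pu power2_eq_square algebra_simps)
      moreover have "2 * (u * d) \<le> d * P" by (simp add: Pu algebra_simps)
      moreover have "2 * (a - 1) \<le> P" using ad Pu by simp
      moreover have "2 * (2 * d + 1) * P = 4 * (d * P) + 2 * P" by (simp add: algebra_simps)
      moreover have "2 * x + P = q + 2 * z \<Longrightarrow> 2 * y \<le> z \<Longrightarrow> 2 * v \<le> P \<Longrightarrow> w = 4 * z + 2 * P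
          \<Longrightarrow> 2 * (v + x + y) \<le> q + w" for v x y z w q :: nat
        unfolding distrib_left by linarith
      ultimately show ?thesis by blast
    qed
    ultimately have "2 * card S \<le> P\<^sup>2 + 2 * (2 * d + 1) * P"
      by (meson mult_le_mono2 order.trans)
    then show ?thesis by (simp only: S_def)
  qed
qed

text \<open>Upper bounds suffice: the two value classes and the zeros of \<open>F\<close> exhaust
  \<open>Fq (2 * l)\<close>, so an upper bound for one class is a lower bound for the other. The
  error \<open>2 * (2 * d + 1) * P\<close> and at most \<open>d\<close> zeros give the factor
  \<open>5 * d + 2\<close>.\<close>

lemma stepanov_sum:
  fixes F :: "'k poly"
  assumes l: "l > 0" and F: "coeffs_in (2 * l) F" "F \<noteq> 0" "odd (order \<theta> F)"
  shows "\<bar>\<Sum>t\<in>Fq (2 * l). eta (2 * l) (poly F t)\<bar> \<le> int ((5 * degree F + 2) * p ^ l)"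
proof -
  define P where "P = p ^ l"
  define d where "d = degree F"
  have l2: "2 * l > 0" using l by simp
  have PQ: "p ^ (2 * l) = P\<^sup>2" by (simp add: P_def mult.commute flip: power_mult)
  have P1: "P \<ge> 1" using p_gt_2 by (simp add: P_def)
  define h where "h = (P\<^sup>2 - 1) div 2"
  have eta: "eta (2 * l) x = (if x = 0 then 0 else if x ^ h = 1 then 1 else - 1)" for x
    by (simp add: eta_def PQ h_def)
  define S where "S = (\<lambda>s. {t \<in> Fq (2 * l). poly F t ^ h = s})"
  define Z where "Z = {t \<in> Fq (2 * l). poly F t = 0}"
  note fin = card_Fq(2)[OF l2]
  have finS: "finite (S s)" "finite Z" for s using fin by (auto simp: S_def Z_def)
  \<comment> \<open>A positive exponent keeps the zeros of \<open>F\<close> out of both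
    \<open>S 1\<close> and \<open>S (- 1)\<close>.\<close>
  have h0: "h > 0"
  proof -
    have "P \<ge> 3" using p_gt_2 l P_def by (metis One_nat_def Suc_leI le_trans numeral_2_eq_2 numeral_3_eq_3 power_increasing power_one_right not_gr_zero order_less_imp_le less_le_trans)
    then have "P\<^sup>2 \<ge> 3 * 3" unfolding power2_eq_square by (intro mult_le_mono)
    then show ?thesis by (simp add: h_def)
  qed
  have un: "Fq (2 * l) = S 1 \<union> S (- 1) \<union> Z"
  proof -
    have "poly F t ^ h = 1 \<or> poly F t ^ h = - 1" if "t \<in> Fq (2 * l)" "poly F t \<noteq> 0" for t
      using Fq_half_pow[OF coeffs_in_poly[OF F(1) that(1)] that(2)] by (simp only: PQ h_def)
    then show ?thesis by (auto simp: S_def Z_def)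
  qed
  have dis: "S 1 \<inter> S (- 1) = {}" "(S 1 \<union> S (- 1)) \<inter> Z = {}"
    using one_neq_minus_one h0 by (auto simp: S_def Z_def zero_power)
  have "(\<Sum>t\<in>Fq (2 * l). eta (2 * l) (poly F t))
      = (\<Sum>t\<in>S 1. 1) + (\<Sum>t\<in>S (- 1). - 1) + (\<Sum>t\<in>Z. 0)"
    unfolding un using dis finS h0 one_neq_minus_one
    by (subst sum.union_disjoint, simp, simp, simp, subst sum.union_disjoint, simp, simp, simp)
       (intro arg_cong2[where f = "(+)"] sum.cong, auto simp: eta S_def Z_def)
  then have sum: "(\<Sum>t\<in>Fq (2 * l). eta (2 * l) (poly F t)) = int (card (S 1)) - int (card (S (- 1)))"
    by simp
  have tot: "card (S 1) + card (S (- 1)) + card Z = P\<^sup>2"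
    unfolding PQ[symmetric] card_Fq(1)[OF l2, symmetric] un
    using dis finS by (simp add: card_Un_disjoint)
  have "card Z \<le> card {t. poly F t = 0}"
    using F by (intro card_mono poly_roots_finite) (auto simp: Z_def)
  also have "\<dots> \<le> d" unfolding d_def by (rule card_poly_roots_bound) fact
  finally have "card Z \<le> d" .
  also have "d * 1 \<le> d * P" using P1 by (intro mult_le_mono2)
  finally have Z: "card Z \<le> d * P" by simp
  have "2 * card (S s) \<le> P\<^sup>2 + 2 * (2 * d + 1) * P" if "s = 1 \<or> s = - 1" for s
    unfolding S_def h_def using stepanov_count[OF l P_def F that d_def] .
  from this[of 1] this[of "- 1"] have "2 * card (S 1) \<le> P\<^sup>2 + 2 * (2 * d + 1) * P"
    "2 * card (S (- 1)) \<le> P\<^sup>2 + 2 * (2 * d + 1) * P" by auto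
  then have "\<bar>int (card (S 1)) - int (card (S (- 1)))\<bar> \<le> int (2 * (2 * d + 1) * P + d * P)"
    using tot Z by linarith
  also have "2 * (2 * d + 1) * P + d * P = (5 * d + 2) * P" by (simp add: algebra_simps)
  finally show ?thesis unfolding sum P_def d_def .
qed

end

section \<open>Sums of a quadratic character along norm fibres\<close>

lemma pcompose_power: "pcompose (f ^ n) g = pcompose f g ^ n" for f :: "'a::idom poly"
  by (induction n) (auto simp: pcompose_mult pcompose_1)

text \<open>Where the derivative of \<open>g\<close> does not vanish, \<open>g - \<theta>\<close>
  has a simple zero, so the substitution is unramified at \<open>t\<close> and preserves
  multiplicities.\<close>

lemma order_pcompose_simple:
  fixes f g :: "'a::idom poly"
  assumes f: "f \<noteq> 0" and t: "poly g t = \<theta>" "poly (pderiv g) t \<noteq> 0"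
  shows "order t (pcompose f g) = order \<theta> f"
proof -
  define m where "m = order \<theta> f"
  obtain h where h: "f = [:- \<theta>, 1:] ^ m * h" "\<not> [:- \<theta>, 1:] dvd h"
    using order_decomp[OF f] unfolding m_def by blast
  then have h0: "poly h \<theta> \<noteq> 0" by (simp add: poly_eq_0_iff_dvd)
  define w where "w = [:- \<theta>:] + g"
  have pc: "pcompose f g = w ^ m * pcompose h g"
    by (subst h) (simp add: pcompose_mult pcompose_power pcompose_pCons w_def)
  have "order t w = 1"
    using t by (intro order_eq_1I) (auto simp: w_def pderiv_add)
  moreover have "w \<noteq> 0"
  proof
    assume "w = 0"
    then have "pderiv w = 0" by simp
    then show False using t by (simp add: w_def pderiv_add)
  qed
  moreover have hg: "poly (pcompose h g) t \<noteq> 0" using t h0 by (simp add: poly_pcompose)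
  moreover from hg have "pcompose h g \<noteq> 0" by auto
  ultimately have "order t (w ^ m * pcompose h g) = m"
    by (subst order_mult) (auto simp: order_power order_0I)
  then show ?thesis by (simp only: pc m_def)
qed

context char_p_closed
begin

lemma Fq_1_subset: "Fq 1 \<subseteq> Fq j"
proof
  fix x assume "x \<in> Fq 1"
  then have "x ^ p = x" by (simp add: Fq_def)
  then have "x ^ (p ^ j) = x"
    by (induction j) (auto simp: power_mult)
  then show "x \<in> Fq j" by (simp add: Fq_def)
qed

lemma coeffs_in_mono: "coeffs_in 1 f \<Longrightarrow> coeffs_in j f"
  using Fq_1_subset[of j] by (auto simp: coeffs_in_def)

lemma Fq_I: "x ^ (p ^ j - 1) = 1 \<Longrightarrow> x \<in> Fq j"
  using p_gt_2 power_minus_mult[of "p ^ j" x] by (simp add: Fq_def)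

lemma Fq_1I: "x ^ (p - 1) = 1 \<Longrightarrow> x \<in> Fq 1"
  using Fq_I[of x 1] by simp

lemma power_p_minus_1_Fnorm: "((x :: 'k) ^ (p - 1)) ^ (\<Sum>i<j. p ^ i) = x ^ (p ^ j - 1)"
proof -
  have "(x ^ (p - 1)) ^ n = x ^ ((p - 1) * n)" for n by (rule power_mult[symmetric])
  then show ?thesis by (simp only: geometric_nat)
qed

lemma sum_norm_fibre:
  fixes h :: "'k \<Rightarrow> int"
  assumes j: "j > 0" and a: "a \<noteq> 0" "a \<in> Fq j"
  shows "(int p - 1) * (\<Sum>x\<in>{x \<in> Fq j. Fnorm j x = Fnorm j a}. h x)
       = (\<Sum>t\<in>Fq j - {0}. h (a * t ^ (p - 1)))"
proof -
  define S where "S = {x \<in> Fq j. Fnorm j x = Fnorm j a}"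
  have fin: "finite S" "finite (Fq j - {0})" using card_Fq(2)[OF j] by (auto simp: S_def)
  have img: "(\<lambda>t. a * t ^ (p - 1)) ` (Fq j - {0}) \<subseteq> S"
  proof (rule image_subsetI)
    fix t assume "t \<in> Fq j - {0}"
    then have t: "t \<in> Fq j" "t \<noteq> 0" by auto
    have "Fnorm j t ^ (p - 1) = 1"
      using Fq_pow_eq_1[OF Fnorm_Fq[OF t(1)]] Fnorm_eq_0_iff[OF j] t(2) by simp
    then show "a * t ^ (p - 1) \<in> S"
      using t a by (auto simp: S_def Fnorm_mult Fnorm_power)
  qed
  have "(\<Sum>t\<in>Fq j - {0}. h (a * t ^ (p - 1)))
      = (\<Sum>x\<in>S. \<Sum>t\<in>{t \<in> Fq j - {0}. a * t ^ (p - 1) = x}. h (a * t ^ (p - 1)))"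
    by (rule sum.group[symmetric, OF fin(2,1) img])
  also have "\<dots> = (\<Sum>x\<in>S. (int p - 1) * h x)"
  proof (rule sum.cong[OF refl])
    fix x assume x: "x \<in> S"
    then have xN: "x \<in> Fq j" "Fnorm j x = Fnorm j a" by (auto simp: S_def)
    then have x0: "x \<noteq> 0" using Fnorm_eq_0_iff[OF j, of x] Fnorm_eq_0_iff[OF j, of a] a by simp
    \<comment> \<open>The root is taken in the algebraic closure. Its \<open>(p ^ j - 1)\<close>-th
      power is the norm of \<open>x / a\<close>, hence \<open>1\<close>, which places it in
      \<open>Fq j\<close>.\<close>
    obtain t0 where t0: "t0 ^ (p - 1) = x / a"
      using nth_root_exists[of "p - 1" "x / a"] p_gt_2 by auto
    then have t00: "t0 \<noteq> 0" using x0 a p_gt_2 by (auto simp: zero_power)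
    have "t0 ^ (p ^ j - 1) = (x / a) ^ (\<Sum>i<j. p ^ i)"
      using power_p_minus_1_Fnorm[of t0 j] unfolding t0 by (rule sym)
    also have "\<dots> = 1"
      using Fnorm_eq_0_iff[OF j, of a] a(1) xN(2) unfolding power_divide Fnorm_eq by simp
    finally have t0F: "t0 \<in> Fq j" by (rule Fq_I)
    have "{t \<in> Fq j - {0}. a * t ^ (p - 1) = x} = (\<lambda>s. t0 * s) ` (Fq 1 - {0})"
    proof (intro equalityI subsetI)
      fix t assume "t \<in> {t \<in> Fq j - {0}. a * t ^ (p - 1) = x}"
      then have t: "t \<noteq> 0" "a * t ^ (p - 1) = x" by auto
      then have "t ^ (p - 1) = x / a" using a by (simp only: t(2)[symmetric] nonzero_mult_div_cancel_left not_False_eq_True)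
      then have "(t / t0) ^ (p - 1) = 1"
        using a x0 t0 by (simp only: power_divide) simp
      then have "t / t0 \<in> Fq 1" by (rule Fq_1I)
      then have "t / t0 \<in> Fq 1 - {0}" using t t00 by auto
      then show "t \<in> (\<lambda>s. t0 * s) ` (Fq 1 - {0})"
        using t00 by (intro image_eqI[of _ _ "t / t0"]) auto
    next
      fix t assume "t \<in> (\<lambda>s. t0 * s) ` (Fq 1 - {0})"
      then obtain s where s: "s \<in> Fq 1" "s \<noteq> 0" "t = t0 * s" by auto
      have "s ^ (p - 1) = 1" using Fq_pow_eq_1[OF s(1,2)] by simp
      then have "t ^ (p - 1) = x / a" by (simp only: s(3) power_mult_distrib t0 mult_1_right)
      moreover have "t \<in> Fq j" using s(1,3) t0F Fq_1_subset[of j] by blast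
      ultimately show "t \<in> {t \<in> Fq j - {0}. a * t ^ (p - 1) = x}"
        using s t00 a by simp
    qed
    moreover have "card ((\<lambda>s. t0 * s) ` (Fq 1 - {0})) = p - 1"
      using t00 card_Fq[of 1] by (subst card_image) (auto intro!: inj_onI)
    ultimately have card: "card {t \<in> Fq j - {0}. a * t ^ (p - 1) = x} = p - 1" by (simp only:)
    have "(\<Sum>t\<in>{t \<in> Fq j - {0}. a * t ^ (p - 1) = x}. h (a * t ^ (p - 1)))
        = (\<Sum>t\<in>{t \<in> Fq j - {0}. a * t ^ (p - 1) = x}. h x)"
      by (rule sum.cong) auto
    also have "\<dots> = int (p - 1) * h x"
      unfolding sum_constant card ..
    also have "int (p - 1) = int p - 1" using p_gt_2 by simp
    finally show "(\<Sum>t\<in>{t \<in> Fq j - {0}. a * t ^ (p - 1) = x}. h (a * t ^ (p - 1))) = (int p - 1) * h x" .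
  qed
  finally show ?thesis
    unfolding S_def sum_distrib_left by (rule sym)
qed

text \<open>Grouping by the norm makes \<open>\<psi>\<close> constant on each group, so only its
  boundedness matters; each group is a sum of \<open>eta\<close> over values of
  \<open>f (a * t ^ (p - 1))\<close>, to which \<open>stepanov_sum\<close> applies. The constant may
  depend on \<open>p\<close> and \<open>f\<close> but not on \<open>l\<close>.\<close>

lemma character_sum_bound:
  fixes f :: "'k poly" and \<psi> :: "'k \<Rightarrow> complex"
  assumes f: "coeffs_in 1 f" "f \<noteq> 0" "odd (order \<theta> f)" "\<theta> \<noteq> 0"
    and \<psi>: "\<And>x. norm (\<psi> x) \<le> 1" "\<psi> 0 = 0"
  shows "\<exists>C::real. \<forall>l>0. norm (\<Sum>x\<in>Fq (2 * l). \<psi> (Fnorm (2 * l) x) * of_int (eta (2 * l) (poly f x))) \<le> C * real p ^ l"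
proof (intro exI[of _ "real p * real (5 * (degree f * (p - 1)) + 3)"] allI impI)
  fix l :: nat assume l: "l > 0"
  define j where "j = 2 * l"
  have j: "j > 0" using l by (simp add: j_def)
  define n where "n = degree f * (p - 1)"
  define B where "B = (5 * n + 2) * p ^ l + 1"
  define h where "h = (\<lambda>x. eta j (poly f x))"
  define S where "S = (\<lambda>c. {x \<in> Fq j. Fnorm j x = c})"
  note fin = card_Fq(2)[OF j]
  have fib: "\<bar>\<Sum>x\<in>S c. h x\<bar> \<le> int B" if c: "c \<in> Fq 1 - {0}" for c
  proof -
    have "(\<Sum>i<j. p ^ i) > 0" using j p_gt_2 by (intro sum_pos) auto
    then obtain a where a: "Fnorm j a = c"
      using nth_root_exists[of "\<Sum>i<j. p ^ i" c] by (auto simp: Fnorm_eq)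
    then have a0: "a \<noteq> 0" using Fnorm_eq_0_iff[OF j] c by auto
    have "a ^ (p ^ j - 1) = c ^ (p - 1)"
      unfolding a[symmetric] Fnorm_eq power_mult[symmetric] geometric_nat[symmetric] by (simp add: mult.commute)
    also have "\<dots> = 1" using Fq_pow_eq_1[of c 1] c by simp
    finally have aF: "a \<in> Fq j" by (rule Fq_I)
    define g where "g = monom a (p - 1)"
    define F where "F = pcompose f g"
    have hF: "h (a * t ^ (p - 1)) = eta j (poly F t)" for t
      by (simp add: h_def F_def g_def poly_pcompose poly_monom)
    have degg: "degree g = p - 1" using a0 by (simp add: g_def degree_monom_eq)
    obtain t where t: "t ^ (p - 1) = \<theta> / a"
      using nth_root_exists[of "p - 1" "\<theta> / a"] p_gt_2 by auto
    have t0: "t \<noteq> 0" using t f(4) a0 p_gt_2 by (auto simp: zero_power)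
    \<comment> \<open>Hence the derivative of \<open>a * X ^ (p - 1)\<close> at \<open>t\<close> is
      \<open>- a * t ^ (p - 2)\<close>, which is nonzero because \<open>\<theta> \<noteq> 0\<close>
      forces \<open>t \<noteq> 0\<close>.\<close>
    have "of_nat (p - 1) = (- 1 :: 'k)"
      using CHAR_K of_nat_CHAR[where 'a = 'k] p_gt_2 by (simp add: of_nat_diff)
    then have "order t F = order \<theta> f"
      unfolding F_def using t t0 a0
      by (intro order_pcompose_simple f(2)) (auto simp: g_def poly_monom pderiv_monom)
    then have odd: "odd (order t F)" using f(3) by simp
    have "coeffs_in (2 * l) F"
    proof -
      have g: "coeffs_in j g" unfolding g_def by (intro coeffs_in_monom aF)
      have "F = (\<Sum>i\<le>degree f. smult (coeff f i) (g ^ i))"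
        unfolding F_def by (simp add: pcompose_altdef poly_altdef coeff_map_poly degree_map_poly)
      moreover have "coeffs_in j \<dots>"
        using coeffs_in_mono[OF f(1), of j] by (intro coeffs_in_sum coeffs_in_smult coeffs_in_pow g) (auto simp: coeffs_in_def)
      ultimately show ?thesis by (simp add: j_def)
    qed
    moreover have "F \<noteq> 0"
      using pcompose_eq_0[of f g] f(2) degg p_gt_2 by (auto simp: F_def)
    ultimately have "\<bar>\<Sum>t\<in>Fq j. eta j (poly F t)\<bar> \<le> int ((5 * degree F + 2) * p ^ l)"
      unfolding j_def using odd by (intro stepanov_sum l)
    also have "degree F = n"
      by (simp add: F_def degree_pcompose degg n_def)
    finally have "\<bar>\<Sum>t\<in>Fq j. eta j (poly F t)\<bar> \<le> int ((5 * n + 2) * p ^ l)" .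
    moreover have "(\<Sum>t\<in>Fq j. eta j (poly F t)) = eta j (poly F 0) + (\<Sum>t\<in>Fq j - {0}. eta j (poly F t))"
      using fin by (simp add: sum.remove[of _ 0])
    ultimately have "\<bar>\<Sum>t\<in>Fq j - {0}. eta j (poly F t)\<bar> \<le> int B"
      using eta_abs[of j "poly F 0"] unfolding B_def of_nat_add by linarith
    moreover have "(\<Sum>t\<in>Fq j - {0}. eta j (poly F t)) = (int p - 1) * (\<Sum>x\<in>S c. h x)"
      using sum_norm_fibre[OF j a0 aF, of h] unfolding hF S_def a by simp
    moreover have "\<bar>int p - 1\<bar> = int p - 1" using p_gt_2 by linarith
    ultimately have "(int p - 1) * \<bar>\<Sum>x\<in>S c. h x\<bar> \<le> int B"
      by (simp only: abs_mult)
    moreover have "1 * \<bar>\<Sum>x\<in>S c. h x\<bar> \<le> (int p - 1) * \<bar>\<Sum>x\<in>S c. h x\<bar>"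
      using p_gt_2 by (intro mult_right_mono) auto
    ultimately show ?thesis by linarith
  qed
  have "(\<Sum>x\<in>Fq j. \<psi> (Fnorm j x) * of_int (h x))
      = (\<Sum>c\<in>Fq 1. \<Sum>x\<in>S c. \<psi> (Fnorm j x) * of_int (h x))"
    unfolding S_def using fin card_Fq(2)[of 1] Fnorm_Fq by (intro sum.group[symmetric]) auto
  also have "\<dots> = (\<Sum>c\<in>Fq 1. \<psi> c * of_int (\<Sum>x\<in>S c. h x))"
    by (intro sum.cong) (auto simp: S_def sum_distrib_left)
  also have "norm \<dots> \<le> (\<Sum>c\<in>Fq 1. real B)"
  proof (intro sum_norm_le)
    fix c assume c: "c \<in> Fq 1"
    show "norm (\<psi> c * of_int (\<Sum>x\<in>S c. h x)) \<le> real B"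
    proof (cases "c = 0")
      case False
      have "norm (\<psi> c * of_int (\<Sum>x\<in>S c. h x)) = norm (\<psi> c) * \<bar>of_int (\<Sum>x\<in>S c. h x)\<bar>"
        by (simp only: norm_mult norm_of_int)
      also have "\<dots> \<le> 1 * \<bar>of_int (\<Sum>x\<in>S c. h x)\<bar>"
        using \<psi> by (intro mult_right_mono) auto
      also have "\<dots> \<le> real B"
        using fib[of c] c False by (metis DiffI empty_iff insert_iff mult_1 of_int_abs of_int_le_iff of_int_of_nat_eq)
      finally show ?thesis .
    qed (auto simp: \<psi>)
  qed
  also have "\<dots> = real p * real B" using card_Fq(1)[of 1] by simp
  also have "\<dots> \<le> real p * real ((5 * n + 3) * p ^ l)"
  proof (intro mult_left_mono of_nat_mono)
    have "1 \<le> p ^ l" using p_gt_2 by simp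
    then show "B \<le> (5 * n + 3) * p ^ l" by (simp add: B_def add_mult_distrib)
  qed simp
  finally have "norm (\<Sum>x\<in>Fq (2 * l). \<psi> (Fnorm (2 * l) x) * of_int (eta (2 * l) (poly f x)))
      \<le> (real p * real (5 * (degree f * (p - 1)) + 3)) * p ^ l"
    unfolding j_def h_def n_def by (simp only: mult.assoc of_nat_mult of_nat_power)
  then show "norm (\<Sum>x\<in>Fq (2 * l). \<psi> (Fnorm (2 * l) x) * of_int (eta (2 * l) (poly f x)))
      \<le> (real p * real (5 * (degree f * (p - 1)) + 3)) * real p ^ l"
    by simp
qed

end

section \<open>Power sums of inverse roots\<close>

lemma inverse_root_factorization:
  fixes L :: "complex poly"
  assumes "coeff L 0 = 1"
  shows "\<exists>W. size W = degree L \<and> L = (\<Prod>w\<in>#W. [:1, - w:])"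
proof -
  have L0: "L \<noteq> 0" using assms by auto
  have fac: "smult (lead_coeff L) (\<Prod>x\<in>#proots L. [:- x, 1:]) = L" by (rule alg_closed_proots)
  have nz: "x \<noteq> 0" if "x \<in># proots L" for x
    using that L0 assms by (auto simp: poly_0_coeff_0)
  have prod: "(\<Prod>x\<in>#A. [:- x, 1:]) = smult (\<Prod>x\<in>#A. - x) (\<Prod>x\<in>#A. [:1, - inverse x:])"
    if "\<And>x. x \<in># A \<Longrightarrow> x \<noteq> 0" for A :: "complex multiset"
    using that
  proof (induction A)
    case (add a A)
    have e: "[:- a, 1:] = smult (- a) [:1, - inverse a:]" using add.prems by simp
    have IH: "(\<Prod>x\<in>#A. [:- x, 1:]) = smult (\<Prod>x\<in>#A. - x) (\<Prod>x\<in>#A. [:1, - inverse x:])"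
      using add by simp
    show ?case
      unfolding image_mset_add_mset prod_mset.add_mset IH e
      by (simp only: mult_smult_left mult_smult_right smult_smult mult.commute)
  qed auto
  have L: "L = smult (lead_coeff L * (\<Prod>x\<in>#proots L. - x)) (\<Prod>x\<in>#proots L. [:1, - inverse x:])"
    using fac prod[OF nz] by simp
  have one: "poly (\<Prod>x\<in>#A. [:1, - inverse x:]) 0 = (1::complex)" for A
    by (induction A) (auto simp del: mult_pCons_left)
  have "1 = lead_coeff L * (\<Prod>x\<in>#proots L. - x)"
    using arg_cong[OF L, of "\<lambda>L. coeff L 0"] assms one[unfolded poly_0_coeff_0] by simp
  then have "L = (\<Prod>x\<in>#proots L. [:1, - inverse x:])"
    using L by simp
  then show ?thesis
    by (intro exI[of _ "image_mset inverse (proots L)"]) (simp add: alg_closed_proots multiset.map_comp comp_def)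
qed

text \<open>Logarithmic derivative cleared of denominators: each factor \<open>1 - w * X\<close>
  contributes \<open>- w * X / (1 - w * X)\<close>, a geometric series.\<close>

lemma newton_fps:
  fixes W :: "complex multiset"
  defines "S \<equiv> \<lambda>W. Abs_fps (\<lambda>k. if k = 0 then 0 else \<Sum>w\<in>#W. w ^ k)"
    and "L \<equiv> \<lambda>W. fps_of_poly (\<Prod>w\<in>#W. [:1, - w:])"
  shows "fps_X * fps_deriv (L W) = - (S W * L W)"
proof (induction W)
  case empty
  then show ?case by (simp add: L_def S_def fps_eq_iff)
next
  case (add w W)
  define g where "g = Abs_fps (\<lambda>k. if k = 0 then 0 else w ^ k)"
  define q where "q = fps_of_poly [:1, - w:]"
  have q: "q = 1 - fps_const w * fps_X" by (simp add: q_def fps_of_poly_pCons)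
  have L: "L (add_mset w W) = q * L W"
    by (simp add: L_def q_def fps_of_poly_mult del: mult_pCons_left)
  have S: "S (add_mset w W) = S W + g"
    by (intro fps_ext) (simp add: S_def g_def)
  have qg: "q * g = fps_const w * fps_X"
  proof (rule fps_ext)
    fix n
    have "(q * g) $ n = g $ n - w * (fps_X * g) $ n"
      by (simp add: q left_diff_distrib mult.assoc)
    then show "(q * g) $ n = (fps_const w * fps_X) $ n"
      by (cases n) (auto simp: g_def fps_X_nth split: if_splits)
  qed
  have dq: "fps_deriv q = fps_const (- w)" by (simp add: q)
  have "fps_X * fps_deriv (L (add_mset w W)) = q * (fps_X * fps_deriv (L W)) - fps_const w * fps_X * L W"
    unfolding L fps_deriv_mult dq by (simp add: algebra_simps flip: fps_const_neg)
  also have "\<dots> = - (q * S W * L W) - q * g * L W"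
    unfolding add.IH qg by (simp add: algebra_simps)
  also have "\<dots> = - (S (add_mset w W) * L (add_mset w W))"
    by (simp add: L S algebra_simps)
  finally show ?case .
qed

text \<open>Since \<open>A 0 = 1\<close>, the recurrence determines \<open>T\<close> from
  \<open>A\<close>, and Newton's identities say that the negative power sums of the inverse roots
  satisfy the same recurrence. The last clause evaluates the polynomial with coefficients
  \<open>A\<close> at \<open>1\<close>.\<close>

lemma newton_recurrence_solution:
  fixes A T :: "nat \<Rightarrow> complex"
  assumes A: "A 0 = 1" "\<And>k. k \<ge> m \<Longrightarrow> A k = 0"
    and rec: "\<And>k. of_nat k * A k = (\<Sum>j=1..k. T j * A (k - j))"
  shows "\<exists>W. size W \<le> m - 1 \<and> (\<forall>k>0. T k = - (\<Sum>w\<in>#W. w ^ k)) \<and> (\<Sum>k<m. A k) = (\<Prod>w\<in>#W. 1 - w)"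
proof -
  define L where "L = (\<Sum>k<m. monom (A k) k)"
  have cL: "coeff L k = A k" for k
    using A(2)[of k] by (auto simp: L_def coeff_sum)
  obtain W where W: "size W = degree L" "L = (\<Prod>w\<in>#W. [:1, - w:])"
    using inverse_root_factorization[of L] A(1) cL by auto
  define s where "s = (\<lambda>k. \<Sum>w\<in>#W. w ^ k)"
  have newton: "of_nat k * A k = (\<Sum>j=1..k. - s j * A (k - j))" for k
  proof -
    have "(fps_X * fps_deriv (fps_of_poly L)) $ k = of_nat k * A k"
      by (cases k) (auto simp: cL)
    moreover have "(fps_X * fps_deriv (fps_of_poly L)) $ k
        = - (\<Sum>i=0..k. (if i = 0 then 0 else s i) * A (k - i))"
      using newton_fps[of W] by (simp add: W(2)[symmetric] fps_mult_nth cL s_def cong: if_cong)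
    moreover have "(\<Sum>i=0..k. (if i = 0 then 0 else s i) * A (k - i)) = (\<Sum>j=1..k. s j * A (k - j))"
      by (subst sum.atLeast_Suc_atMost) auto
    ultimately show ?thesis by (simp add: sum_negf)
  qed
  have "T k = - s k" if "k > 0" for k
    using that
  proof (induction k rule: less_induct)
    case (less k)
    have split: "(\<Sum>j=1..k. u j * A (k - j)) = u k + (\<Sum>j=1..<k. u j * A (k - j))" for u :: "nat \<Rightarrow> complex"
      using less.prems A(1) by (cases k) (auto simp: atLeastLessThanSuc_atLeastAtMost)
    have "(\<Sum>j=1..<k. T j * A (k - j)) = (\<Sum>j=1..<k. - s j * A (k - j))"
      by (intro sum.cong) (auto simp: less.IH)
    then show ?case
      using rec[of k] newton[of k] unfolding split[of T] split[of "\<lambda>j. - s j"] by simp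
  qed
  moreover have "size W \<le> m - 1"
    unfolding W(1) by (intro degree_le) (use A(2) cL in auto)
  moreover have "(\<Sum>k<m. A k) = (\<Prod>w\<in>#W. 1 - w)"
  proof -
    have "(\<Sum>k<m. A k) = poly L 1" by (simp add: L_def poly_sum poly_monom)
    also have "\<dots> = (\<Prod>w\<in>#W. 1 - w)" by (subst W(2)) (simp add: poly_prod_mset)
    finally show ?thesis .
  qed
  ultimately show ?thesis unfolding s_def by blast
qed

text \<open>By simultaneous Dirichlet approximation infinitely many even powers of all \<open>w\<close>
  have argument close to \<open>0\<close>, so that there is no cancellation in the power sum.\<close>

lemma power_sum_radius:
  fixes W :: "complex multiset" and R C :: real
  assumes R: "R > 0" and bound: "\<And>l. l > 0 \<Longrightarrow> norm (\<Sum>w\<in>#W. w ^ (2 * l)) \<le> C * R ^ (2 * l)"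
    and w: "w \<in># W"
  shows "norm w \<le> R"
proof (rule ccontr)
  assume "\<not> norm w \<le> R"
  then have x: "norm w / R > 1" using R by simp
  obtain M' where M': "2 * \<bar>C\<bar> < (norm w / R) ^ M'"
    using real_arch_pow[OF x] by blast
  define M where "M = Suc M'"
  obtain ws where ws: "mset ws = W" using ex_mset by blast
  \<comment> \<open>Dirichlet's theorem only promises \<open>q > 0\<close>. Building the factor
    \<open>2 * M\<close> into the angles makes the exponent \<open>2 * l\<close> a multiple of
    \<open>M\<close> and so large enough; a precision of a sixth of a full turn keeps the cosine at
    least \<open>1 / 2\<close>.\<close>
  define \<theta> where "\<theta> = (\<lambda>i. real (2 * M) * Arg (ws ! i) / (2 * pi))"
  obtain q h where q: "0 < q" and app: "\<And>i. i < length ws \<Longrightarrow> \<bar>of_int q * \<theta> i - of_int (h i)\<bar> < 1 / real 6"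
    using Dirichlet_approx_simult[of 6 "length ws" \<theta>] by (metis zero_less_numeral)
  define l where "l = M * nat q"
  have "M * 1 \<le> l" unfolding l_def using q by (intro mult_le_mono2) simp
  then have l: "l \<ge> M" "l > 0" by (auto simp: M_def)
  have re: "Re (v ^ (2 * l)) \<ge> norm v ^ (2 * l) / 2" if v: "v \<in># W" for v
  proof -
    obtain i where i: "i < length ws" "v = ws ! i"
      using v ws by (metis in_set_conv_nth set_mset_mset)
    have "v ^ (2 * l) = (of_real (norm v) * cis (Arg v)) ^ (2 * l)"
      by (simp add: rcis_cmod_Arg[unfolded rcis_def])
    also have "\<dots> = of_real (norm v ^ (2 * l)) * cis (real (2 * l) * Arg v)"
      by (simp only: power_mult_distrib of_real_power Complex.DeMoivre)
    finally have e: "Re (v ^ (2 * l)) = norm v ^ (2 * l) * cos (real (2 * l) * Arg v)" by simp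
    define d where "d = of_int q * \<theta> i - of_int (h i)"
    have "real (2 * l) * Arg v = 2 * pi * (of_int q * \<theta> i)"
      using q by (simp add: l_def \<theta>_def i(2))
    also have "\<dots> = 2 * pi * d + 2 * pi * of_int (h i)"
      by (simp add: d_def algebra_simps)
    finally have "cos (real (2 * l) * Arg v) = cos (2 * pi * d + 2 * pi * of_int (h i))" by simp
    also have "\<dots> = cos (2 * pi * d)"
      by (simp add: cos_add)
    also have "\<dots> = cos \<bar>2 * pi * d\<bar>" by simp
    also have "\<dots> \<ge> cos (pi / 3)"
    proof (rule cos_monotone_0_pi_le)
      have "\<bar>d\<bar> \<le> 1 / 6" using app[OF i(1)] by (simp add: d_def)
      then have "2 * pi * \<bar>d\<bar> \<le> 2 * pi * (1 / 6)" by (intro mult_left_mono) auto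
      then show "\<bar>2 * pi * d\<bar> \<le> pi / 3" by (simp add: abs_mult)
    qed auto
    finally have "cos (real (2 * l) * Arg v) \<ge> 1 / 2" by (simp add: cos_60)
    then show ?thesis
      unfolding e using mult_left_mono[of "1 / 2" _ "norm v ^ (2 * l)"] by simp
  qed
  have "norm w ^ (2 * l) / 2 \<le> (\<Sum>v\<in>#W. norm v ^ (2 * l) / 2)"
  proof -
    obtain W' where W': "W = add_mset w W'" using w by (metis insert_DiffM)
    have "0 \<le> (\<Sum>v\<in>#V. norm v ^ (2 * l) / 2)" for V :: "complex multiset"
      by (induction V) auto
    then show ?thesis by (simp add: W')
  qed
  also have "\<dots> \<le> (\<Sum>v\<in>#W. Re (v ^ (2 * l)))"
    by (intro sum_mset_mono re)
  also have "\<dots> = Re (\<Sum>v\<in>#W. v ^ (2 * l))"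
  proof -
    have "(\<Sum>v\<in>#V. Re (v ^ (2 * l))) = Re (\<Sum>v\<in>#V. v ^ (2 * l))" for V :: "complex multiset"
      by (induction V) auto
    then show ?thesis .
  qed
  also have "\<dots> \<le> C * R ^ (2 * l)"
    using bound[OF l(2)] complex_Re_le_cmod order_trans by blast
  also have "\<dots> \<le> \<bar>C\<bar> * R ^ (2 * l)" using R by (intro mult_right_mono) auto
  finally have "norm w ^ (2 * l) / R ^ (2 * l) \<le> 2 * \<bar>C\<bar>"
    using R by (simp add: field_simps)
  then have "(norm w / R) ^ (2 * l) \<le> 2 * \<bar>C\<bar>" by (simp add: power_divide)
  moreover have "(norm w / R) ^ M' \<le> (norm w / R) ^ (2 * l)"
    using x l by (intro power_increasing) (auto simp: M_def)
  ultimately show False using M' by linarith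
qed

section \<open>Counting conjugacy polynomials dividing a polynomial\<close>

lemma dvd_iff_proots_subset:
  fixes g h :: "'k::alg_closed_field poly"
  assumes "g \<noteq> 0" "h \<noteq> 0"
  shows "g dvd h \<longleftrightarrow> proots g \<subseteq># proots h"
proof
  assume "g dvd h"
  then show "proots g \<subseteq># proots h"
    using assms by (auto elim!: dvdE simp: proots_mult)
next
  assume sub: "proots g \<subseteq># proots h"
  have "g = smult (lead_coeff g) (\<Prod>x\<in>#proots g. [:- x, 1:])"
    by (rule alg_closed_proots(1)[symmetric])
  also have "\<dots> dvd (\<Prod>x\<in>#proots g. [:- x, 1:])"
    using assms by (intro smult_dvd) auto
  also have "\<dots> dvd (\<Prod>x\<in>#proots h. [:- x, 1:])"
    by (intro prod_mset_subset_imp_dvd image_mset_subseteq_mono sub)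
  also have "\<dots> dvd smult (lead_coeff h) \<dots>"
    by (rule dvd_smult) simp
  also have "\<dots> = h" by (rule alg_closed_proots(1))
  finally show "g dvd h" .
qed

lemma count_image_mset_inj: "inj f \<Longrightarrow> count (image_mset f A) (f x) = count A x"
  by (induction A) (auto dest: injD)

lemma prod_lessThan_add: "(\<Prod>i<a + b. f i) = (\<Prod>i<a. f i) * (\<Prod>i<b. f (a + i))" for f :: "nat \<Rightarrow> 'a::comm_monoid_mult"
  by (induction b) (simp_all add: mult.assoc)

context char_p_closed
begin

section \<open>Frobenius acting on coefficients\<close>

definition frp :: "'k poly \<Rightarrow> 'k poly" where
  "frp h = map_poly (\<lambda>c. c ^ p) h"

lemma p_pos: "p > 0" using p_gt_2 by simp

lemma coeff_frp [simp]: "coeff (frp h) i = coeff h i ^ p"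
  using p_pos by (simp add: frp_def coeff_map_poly)

lemma frob_add1: "(x + y :: 'k) ^ p = x ^ p + y ^ p" using frob_add[of x y 1] by simp
lemma frob_sum1: "(\<Sum>i\<in>A. f i :: 'k) ^ p = (\<Sum>i\<in>A. f i ^ p)" using frob_sum[of f A 1] by simp
lemma frob_inj1: "(x :: 'k) ^ p = y ^ p \<longleftrightarrow> x = y" using frob_inj[of x 1 y] by simp

lemma frp_add: "frp (g + h) = frp g + frp h"
  and frp_mult: "frp (g * h) = frp g * frp h"
  and frp_0 [simp]: "frp 0 = 0"
  and frp_1 [simp]: "frp 1 = 1"
  and frp_linear: "frp [:- x, 1:] = [:- (x ^ p), 1:]"
  using odd_p p_pos
  by (intro poly_eqI; auto simp: frob_add1 coeff_mult frob_sum1 power_mult_distrib coeff_1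
       coeff_pCons split: nat.splits)+

lemma frp_prod: "frp (\<Prod>i\<in>A. f i) = (\<Prod>i\<in>A. frp (f i))"
  by (induction A rule: infinite_finite_induct) (auto simp: frp_mult)

lemma frp_prod_mset: "frp (\<Prod>i\<in>#A. f i) = (\<Prod>i\<in>#A. frp (f i))"
  by (induction A) (auto simp: frp_mult)

lemma coeffs_in_1_iff: "coeffs_in 1 h \<longleftrightarrow> frp h = h" "coeffs_in (Suc 0) h \<longleftrightarrow> frp h = h"
  by (auto simp: coeffs_in_def Fq_def poly_eq_iff)

lemma degree_frp: "degree (frp h) = degree h"
  unfolding frp_def using p_pos by (intro degree_map_poly) auto

lemma proots_frp: "proots (frp h) = image_mset (\<lambda>x. x ^ p) (proots h)"
proof (cases "h = 0")
  case False
  have "frp h = frp ([:lead_coeff h:] * (\<Prod>x\<in>#proots h. [:- x, 1:]))"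
    by (subst alg_closed_proots(1)[of h, symmetric]) simp
  also have "\<dots> = smult (lead_coeff h ^ p) (\<Prod>x\<in>#proots h. [:- (x ^ p), 1:])"
  proof -
    have "frp [:lead_coeff h:] = [:lead_coeff h ^ p:]"
      using p_pos by (intro poly_eqI) (auto simp: coeff_pCons split: nat.splits)
    then show ?thesis unfolding frp_mult frp_prod_mset by (simp add: frp_linear multiset.map_comp comp_def)
  qed
  finally have e: "frp h = smult (lead_coeff h ^ p) (\<Prod>x\<in>#proots h. [:- (x ^ p), 1:])" .
  have "proots (\<Prod>x\<in>#A. [:- (x ^ p), 1:]) = image_mset (\<lambda>x. x ^ p) A" for A :: "'k multiset"
  proof (induction A)
    case (add x A)
    have "(\<Prod>x\<in>#A. [:- (x ^ p), 1:]) \<noteq> 0"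
      by (induction A) (auto simp del: mult_pCons_left)
    then show ?case
      using add by (simp add: proots_mult del: mult_pCons_left)
  qed auto
  then show ?thesis
    unfolding e using False by (subst proots_smult) auto
qed auto

lemma proots_frob_invariant:
  assumes "coeffs_in 1 h"
  shows "image_mset (\<lambda>x. x ^ p) (proots h) = proots h"
  using assms proots_frp[of h] by (simp add: coeffs_in_1_iff)

lemma order_frob:
  assumes "coeffs_in 1 h" "h \<noteq> 0"
  shows "order (x ^ (p ^ i)) h = order x h"
proof (induction i)
  case (Suc i)
  have "count (proots h) ((x ^ (p ^ i)) ^ p) = count (image_mset (\<lambda>x. x ^ p) (proots h)) ((x ^ (p ^ i)) ^ p)"
    by (simp only: proots_frob_invariant[OF assms(1)])
  also have "\<dots> = count (proots h) (x ^ (p ^ i))"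
    by (rule count_image_mset_inj) (auto intro!: injI simp: frob_inj1)
  finally show ?case
    using Suc assms by (simp flip: power_mult add: mult.commute)
qed auto

lemma coeffs_in_cancel:
  assumes "coeffs_in 1 g" "coeffs_in 1 (g * h)" "g \<noteq> 0"
  shows "coeffs_in 1 h"
  using assms unfolding coeffs_in_1_iff frp_mult by simp

text \<open>For \<open>x\<close> in \<open>Fq j\<close> this is the characteristic polynomial of
  \<open>x\<close> over the prime field. Working with these powers of minimal polynomials replaces
  factorization into irreducible polynomials over the prime field by counting roots.\<close>

definition cp :: "nat \<Rightarrow> 'k \<Rightarrow> 'k poly" where
  "cp j x = (\<Prod>i<j. [:- (x ^ (p ^ i)), 1:])"

lemma cp_nz [simp]: "cp j x \<noteq> 0" by (auto simp: cp_def)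

lemma degree_cp [simp]: "degree (cp j x) = j"
  unfolding cp_def by (subst degree_prod_eq_sum_degree) auto

lemma lead_coeff_cp [simp]: "lead_coeff (cp j x) = 1"
  unfolding cp_def lead_coeff_prod by simp

lemma coeff_cp_degree [simp]: "coeff (cp j x) j = 1"
  using lead_coeff_cp[of j x] by simp

lemma coeffs_in_cp:
  assumes "x \<in> Fq j"
  shows "coeffs_in 1 (cp j x)"
proof (cases j)
  case 0
  then show ?thesis by (simp add: cp_def)
next
  case (Suc n)
  have "frp (cp j x) = (\<Prod>i<j. [:- (x ^ (p ^ Suc i)), 1:])"
    by (simp add: cp_def frp_prod frp_linear mult.commute flip: power_mult)
  also have "\<dots> = (\<Prod>i<n. [:- (x ^ (p ^ Suc i)), 1:]) * [:- (x ^ (p ^ 0)), 1:]"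
    using Fq_frob[OF assms] by (simp add: Suc)
  also have "\<dots> = (\<Prod>i<Suc n. [:- (x ^ (p ^ i)), 1:])"
    by (subst prod.lessThan_Suc_shift) (simp only: mult.commute)
  also have "\<dots> = cp j x" by (simp add: cp_def Suc)
  finally show ?thesis by (simp add: coeffs_in_1_iff)
qed

lemma frob_frob: "((x :: 'k) ^ (p ^ i)) ^ (p ^ j) = x ^ (p ^ (i + j))"
  by (simp add: power_add flip: power_mult)

text \<open>If \<open>x\<close> has degree \<open>e\<close> over the prime field, the admissible \<open>j\<close> are the multiples \<open>e * r\<close>, and
  \<open>cp (e * r) x\<close> is the \<open>r\<close>-th power of the minimal polynomial of \<open>x\<close>.\<close>

lemma card_conjugacy_polys_at_root:
  assumes h: "coeffs_in 1 h" "h \<noteq> 0" and root: "poly h x = 0"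
  shows "card {j. j > 0 \<and> x \<in> Fq j \<and> cp j x dvd h} = order x h"
    and "finite {j. j > 0 \<and> x \<in> Fq j \<and> cp j x dvd h}"
proof -
  \<comment> \<open>The conjugates of \<open>x\<close> are roots of \<open>h\<close>, so they
    repeat. Injectivity of Frobenius moves the repetition back to \<open>x\<close> itself and puts
    it into some finite subfield.\<close>
  have "\<exists>a b. a < b \<and> x ^ (p ^ a) = x ^ (p ^ b)"
  proof (rule ccontr)
    assume "\<not> ?thesis"
    then have "inj (\<lambda>i. x ^ (p ^ i))"
      by (intro linorder_injI) auto
    moreover have "range (\<lambda>i. x ^ (p ^ i)) \<subseteq> {y. poly h y = 0}"
      using coeffs_in_frob[OF coeffs_in_mono[OF h(1)]] root p_pos by (auto simp: zero_power)
    ultimately show False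
      using poly_roots_finite[OF h(2)] by (meson finite_imageD finite_subset infinite_UNIV_nat)
  qed
  then obtain a b where ab: "a < b" "x ^ (p ^ a) = x ^ (p ^ b)" by blast
  have "(x ^ (p ^ (b - a))) ^ (p ^ a) = x ^ (p ^ a)"
    unfolding frob_frob using ab by simp
  then have "x \<in> Fq (b - a)" by (simp only: Fq_def mem_Collect_eq frob_inj)
  then have ex: "\<exists>e. e > 0 \<and> x \<in> Fq e" using ab by (intro exI[of _ "b - a"]) auto
  define e where "e = (LEAST e. e > 0 \<and> x \<in> Fq e)"
  have e: "e > 0" "x \<in> Fq e" using LeastI_ex[OF ex] by (auto simp: e_def)
  have least: "e \<le> e'" if "e' > 0" "x \<in> Fq e'" for e'
    using that unfolding e_def by (intro Least_le) auto
  have per: "x ^ (p ^ (e * r + i)) = x ^ (p ^ i)" for r i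
  proof (induction r)
    case (Suc r)
    have "x ^ (p ^ (e * Suc r + i)) = (x ^ (p ^ e)) ^ (p ^ (e * r + i))"
      unfolding frob_frob by (simp add: algebra_simps)
    then show ?case using Suc Fq_frob[OF e(2)] by simp
  qed simp
  have dvd: "e dvd j" if "x \<in> Fq j" for j
  proof -
    have "x ^ (p ^ (j mod e)) = x ^ (p ^ (e * (j div e) + j mod e))" by (rule per[symmetric])
    also have "\<dots> = x" using Fq_frob[OF that] by simp
    finally have "x \<in> Fq (j mod e)" by (simp add: Fq_def)
    then have "\<not> j mod e > 0" using least[of "j mod e"] e(1) by (meson leD mod_less_divisor)
    then show ?thesis by auto
  qed
  have Fqe: "x \<in> Fq (e * r)" for r using per[of r 0] by (simp add: Fq_def)
  have cp_pow: "cp (e * r) x = cp e x ^ r" for r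
  proof (induction r)
    case (Suc r)
    have "cp (e * Suc r) x = (\<Prod>i<e * r + e. [:- (x ^ (p ^ i)), 1:])"
      unfolding cp_def mult_Suc_right add.commute[of e] ..
    also have "\<dots> = cp (e * r) x * cp e x"
      unfolding prod_lessThan_add per cp_def ..
    finally show ?case unfolding Suc power_Suc by (simp only: mult.commute)
  qed (simp add: cp_def)
  have proots_cp: "proots (cp j x) = (\<Sum>i<j. {#x ^ (p ^ i)#})" for j
    unfolding cp_def by (subst proots_prod) auto
  have inj: "inj_on (\<lambda>i. x ^ (p ^ i)) {..<e}"
  proof (rule linorder_inj_onI)
    fix i j assume ij: "i < j" "i \<in> {..<e}" "j \<in> {..<e}"
    show "x ^ (p ^ i) \<noteq> x ^ (p ^ j)"
    proof
      assume "x ^ (p ^ i) = x ^ (p ^ j)"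
      then have "(x ^ (p ^ (j - i))) ^ (p ^ i) = x ^ (p ^ i)"
        unfolding frob_frob using ij by simp
      then have "x \<in> Fq (j - i)" by (simp only: Fq_def mem_Collect_eq frob_inj)
      then show False using least[of "j - i"] ij by auto
    qed
  qed auto
  have count: "count (proots (cp e x)) y = (if y \<in> (\<lambda>i. x ^ (p ^ i)) ` {..<e} then 1 else 0)" for y
  proof -
    have "count (proots (cp e x)) y = (\<Sum>i<e. if x ^ (p ^ i) = y then 1 else 0)"
      unfolding proots_cp count_sum by (intro sum.cong) auto
    also have "\<dots> = (\<Sum>z\<in>(\<lambda>i. x ^ (p ^ i)) ` {..<e}. if z = y then 1 else 0)"
      by (subst sum.reindex[OF inj]) (simp add: comp_def)
    also have "\<dots> = (if y \<in> (\<lambda>i. x ^ (p ^ i)) ` {..<e} then 1 else 0)"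
      by (simp add: sum.delta')
    finally show ?thesis .
  qed
  \<comment> \<open>The first \<open>e\<close> conjugates are distinct and, by
    \<open>order_frob\<close>, roots of \<open>h\<close> of equal multiplicity.\<close>
  have main: "cp (e * r) x dvd h \<longleftrightarrow> r \<le> order x h" for r
  proof -
    have "cp (e * r) x dvd h \<longleftrightarrow> repeat_mset r (proots (cp e x)) \<subseteq># proots h"
      unfolding cp_pow using h(2) by (subst dvd_iff_proots_subset) (auto simp: proots_power)
    also have "\<dots> \<longleftrightarrow> (\<forall>y\<in>(\<lambda>i. x ^ (p ^ i)) ` {..<e}. r \<le> order y h)"
      using h(2) by (auto simp: subseteq_mset_def count)
    also have "\<dots> \<longleftrightarrow> r \<le> order x h"
      using e(1) by (auto simp: order_frob[OF h])
    finally show ?thesis .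
  qed
  have "{j. j > 0 \<and> x \<in> Fq j \<and> cp j x dvd h} = (\<lambda>r. e * r) ` {1..order x h}"
  proof (intro equalityI subsetI)
    fix j assume j: "j \<in> {j. j > 0 \<and> x \<in> Fq j \<and> cp j x dvd h}"
    then obtain r where r: "j = e * r" using dvd by (auto elim!: dvdE)
    then show "j \<in> (\<lambda>r. e * r) ` {1..order x h}"
      using j main[of r] by (intro image_eqI[of _ _ r]) auto
  qed (use e(1) main Fqe in auto)
  moreover have "inj_on (\<lambda>r. e * r) {1..order x h}" using e(1) by (auto intro!: inj_onI)
  ultimately show "card {j. j > 0 \<and> x \<in> Fq j \<and> cp j x dvd h} = order x h"
    and "finite {j. j > 0 \<and> x \<in> Fq j \<and> cp j x dvd h}" by (auto simp: card_image)
qed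

text \<open>Analogue of the identity that the von Mangoldt function summed over the divisors of an
  integer gives its logarithm, with the degree as logarithm: a power of an irreducible polynomial of
  degree \<open>e\<close> is counted once for each of its \<open>e\<close> roots. Counted by roots
  instead, the total is the sum of the multiplicities.\<close>

lemma card_conjugacy_polys:
  assumes h: "coeffs_in 1 h" "h \<noteq> 0"
  shows "(\<Sum>j=1..degree h. card {x \<in> Fq j. cp j x dvd h}) = degree h"
proof -
  define R where "R = {x. poly h x = 0}"
  have R: "finite R" unfolding R_def by (rule poly_roots_finite) fact
  have root: "x \<in> R" if "cp j x dvd h" "j > 0" for j x
  proof -
    have "poly (cp j x) x = 0"
      using that(2) by (auto simp: cp_def poly_prod intro!: bexI[of _ 0])
    then show ?thesis using that(1) by (auto simp: R_def)
  qed
  have "(\<Sum>j=1..degree h. card {x \<in> Fq j. cp j x dvd h})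
      = (\<Sum>j=1..degree h. \<Sum>x\<in>R. if x \<in> Fq j \<and> cp j x dvd h then 1 else 0)"
  proof (intro sum.cong[OF refl])
    fix j assume "j \<in> {1..degree h}"
    then have "{x \<in> Fq j. cp j x dvd h} = {x \<in> R. x \<in> Fq j \<and> cp j x dvd h}"
      using root[of j] by auto
    then show "card {x \<in> Fq j. cp j x dvd h} = (\<Sum>x\<in>R. if x \<in> Fq j \<and> cp j x dvd h then 1 else 0)"
      using R by (simp add: sum.If_cases Int_def)
  qed
  also have "\<dots> = (\<Sum>x\<in>R. \<Sum>j=1..degree h. if x \<in> Fq j \<and> cp j x dvd h then 1 else 0)"
    by (rule sum.swap)
  also have "\<dots> = (\<Sum>x\<in>R. order x h)"
  proof (intro sum.cong[OF refl])
    fix x assume "x \<in> R"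
    have "{j \<in> {1..degree h}. x \<in> Fq j \<and> cp j x dvd h} = {j. j > 0 \<and> x \<in> Fq j \<and> cp j x dvd h}"
      using dvd_imp_degree_le[OF _ h(2)] by fastforce
    then have "card {j \<in> {1..degree h}. x \<in> Fq j \<and> cp j x dvd h} = order x h"
      using card_conjugacy_polys_at_root(1)[OF h] \<open>x \<in> R\<close> by (simp add: R_def)
    then show "(\<Sum>j=1..degree h. if x \<in> Fq j \<and> cp j x dvd h then 1 else 0) = order x h"
      by (simp add: sum.If_cases Int_def)
  qed
  also have "\<dots> = size (proots h)"
    using h(2) by (simp add: size_multiset_overloaded_eq R_def)
  also have "\<dots> = degree h" by (rule alg_closed_proots)
  finally show ?thesis .
qed

section \<open>Monic polynomials and Newton's identity for multiplicative functions\<close>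

definition Mon :: "nat \<Rightarrow> 'k poly set" where
  "Mon k = {h. coeffs_in 1 h \<and> degree h = k \<and> lead_coeff h = 1}"

lemma finite_Mon: "finite (Mon k)"
proof (rule finite_subset)
  show "Mon k \<subseteq> PolyF 1 (Suc k)"
    by (auto simp: Mon_def PolyF_def coeffs_in_def coeff_eq_0)
qed (rule card_PolyF, simp)

lemma Mon_0: "Mon 0 = {1}"
  by (auto simp: Mon_def elim!: degree_eq_zeroE)

lemma Mon_multiples:
  assumes "x \<in> Fq j" "j \<le> k"
  shows "bij_betw (\<lambda>g. cp j x * g) (Mon (k - j)) {h \<in> Mon k. cp j x dvd h}"
  unfolding bij_betw_def
proof (intro conjI equalityI subsetI)
  show "inj_on (\<lambda>g. cp j x * g) (Mon (k - j))" by (rule inj_onI) simp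
next
  fix h assume "h \<in> (\<lambda>g. cp j x * g) ` Mon (k - j)"
  then obtain g where g: "g \<in> Mon (k - j)" "h = cp j x * g" by blast
  then have "g \<noteq> 0" by (auto simp: Mon_def)
  have "lead_coeff h = 1" unfolding g(2) lead_coeff_mult using g(1) by (auto simp: Mon_def)
  then show "h \<in> {h \<in> Mon k. cp j x dvd h}"
    using g \<open>g \<noteq> 0\<close> assms coeffs_in_cp[OF assms(1)]
    by (simp add: Mon_def degree_mult_eq coeffs_in_mult)
next
  fix h assume "h \<in> {h \<in> Mon k. cp j x dvd h}"
  then obtain g where h: "h \<in> Mon k" and g: "h = cp j x * g" by (auto elim!: dvdE)
  have "g \<noteq> 0" using h g by (auto simp: Mon_def)
  moreover have "coeffs_in 1 g"
    using h g coeffs_in_cp[OF assms(1)] by (intro coeffs_in_cancel[of "cp j x" g]) (auto simp: Mon_def)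
  moreover have "lead_coeff g = 1"
  proof -
    have "lead_coeff h = lead_coeff g" unfolding g lead_coeff_mult by simp
    then show ?thesis using h by (simp add: Mon_def)
  qed
  moreover have "degree g = k - j"
    using h g \<open>g \<noteq> 0\<close> by (auto simp: Mon_def degree_mult_eq)
  ultimately show "h \<in> (\<lambda>g. cp j x * g) ` Mon (k - j)"
    using g by (intro image_eqI[of _ _ g]) (auto simp: Mon_def)
qed

text \<open>This is \<open>card_conjugacy_polys\<close> weighted by \<open>Lam h\<close> and summed
  over \<open>Mon k\<close>, where divisibility by \<open>cp j x\<close> becomes multiplication. It
  is the coefficient form of the logarithmic derivative of the Euler product.\<close>

lemma newton_identity:
  fixes Lam :: "'k poly \<Rightarrow> complex"
  assumes mult: "\<And>g h. coeffs_in 1 g \<Longrightarrow> coeffs_in 1 h \<Longrightarrow> Lam (g * h) = Lam g * Lam h"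
  shows "of_nat k * (\<Sum>h\<in>Mon k. Lam h)
       = (\<Sum>j=1..k. (\<Sum>x\<in>Fq j. Lam (cp j x)) * (\<Sum>h\<in>Mon (k - j). Lam h))"
proof -
  have "of_nat k * (\<Sum>h\<in>Mon k. Lam h)
      = (\<Sum>h\<in>Mon k. \<Sum>j=1..k. \<Sum>x\<in>Fq j. if cp j x dvd h then Lam h else 0)"
    unfolding sum_distrib_left
  proof (intro sum.cong[OF refl])
    fix h assume h: "h \<in> Mon k"
    then have h': "coeffs_in 1 h" "h \<noteq> 0" "degree h = k" by (auto simp: Mon_def)
    have "(\<Sum>j=1..k. \<Sum>x\<in>Fq j. if cp j x dvd h then Lam h else 0)
        = (\<Sum>j=1..k. of_nat (card {x \<in> Fq j. cp j x dvd h}) * Lam h)"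
      by (intro sum.cong) (auto simp: sum.If_cases Int_def card_Fq)
    also have "\<dots> = of_nat (\<Sum>j=1..k. card {x \<in> Fq j. cp j x dvd h}) * Lam h"
      by (simp add: sum_distrib_right)
    also have "(\<Sum>j=1..k. card {x \<in> Fq j. cp j x dvd h}) = k"
      using card_conjugacy_polys[OF h'(1,2)] h'(3) by simp
    finally show "of_nat k * Lam h = (\<Sum>j=1..k. \<Sum>x\<in>Fq j. if cp j x dvd h then Lam h else 0)" by simp
  qed
  also have "\<dots> = (\<Sum>j=1..k. \<Sum>x\<in>Fq j. \<Sum>h\<in>Mon k. if cp j x dvd h then Lam h else 0)"
    by (subst sum.swap, rule sum.cong[OF refl], rule sum.swap)
  also have "\<dots> = (\<Sum>j=1..k. \<Sum>x\<in>Fq j. Lam (cp j x) * (\<Sum>h\<in>Mon (k - j). Lam h))"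
  proof (intro sum.cong[OF refl])
    fix j x assume jx: "j \<in> {1..k}" "x \<in> Fq j"
    have "(\<Sum>h\<in>Mon k. if cp j x dvd h then Lam h else 0) = (\<Sum>h\<in>{h \<in> Mon k. cp j x dvd h}. Lam h)"
      using finite_Mon by (simp add: sum.If_cases Int_def)
    also have "\<dots> = (\<Sum>g\<in>Mon (k - j). Lam (cp j x * g))"
      using jx by (intro sum.reindex_bij_betw[symmetric] Mon_multiples) auto
    also have "\<dots> = (\<Sum>g\<in>Mon (k - j). Lam (cp j x) * Lam g)"
      using jx by (intro sum.cong mult coeffs_in_cp) (auto simp: Mon_def)
    finally show "(\<Sum>h\<in>Mon k. if cp j x dvd h then Lam h else 0) = Lam (cp j x) * (\<Sum>h\<in>Mon (k - j). Lam h)"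
      by (simp add: sum_distrib_left)
  qed
  finally show ?thesis by (simp add: sum_distrib_right)
qed

end

section \<open>The L-function of a character modulo a polynomial\<close>

context char_p_closed
begin

text \<open>Division takes place over the algebraically closed field. Uniqueness of the remainder
  makes it commute with Frobenius, so it does not leave the prime field.\<close>

lemma frp_mod:
  assumes M: "coeffs_in 1 M" and g: "coeffs_in 1 g"
  shows "coeffs_in 1 (g mod M)"
proof (cases "M = 0")
  case False
  define q r where "q = g div M" and "r = g mod M"
  have g_eq: "g = M * q + r" by (simp add: q_def r_def)
  have "frp g = frp M * frp q + frp r" by (subst g_eq) (simp only: frp_add frp_mult)
  then have "M * q + r = M * frp q + frp r"
    using g M g_eq by (simp only: coeffs_in_1_iff)
  then have "frp r - r = M * (q - frp q)" by (simp add: algebra_simps)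
  then have dvd: "M dvd frp r - r" by simp
  have "frp r - r = 0"
  proof (cases "degree M = 0")
    case True
    then have "r = 0" using degree_mod_less[OF False, of g] by (auto simp: r_def)
    then show ?thesis by simp
  next
    case deg: False
    have "degree r < degree M"
      using degree_mod_less'[of M g] False deg unfolding r_def by fastforce
    then have "degree (frp r - r) < degree M"
      using degree_diff_less[of "frp r" "degree M" r] by (simp add: degree_frp)
    then show ?thesis
      using dvd dvd_imp_degree_le[of M "frp r - r"] by (meson leD)
  qed
  then show ?thesis by (simp add: coeffs_in_1_iff r_def)
qed (use g in simp)

section \<open>Residues and translates\<close>

lemma coeffs_in_PolyF: "h \<in> PolyF j D \<Longrightarrow> coeffs_in j h"
  by (simp add: PolyF_def coeffs_in_def)

lemma PolyF_I: "coeffs_in j h \<Longrightarrow> h = 0 \<or> degree h < D \<Longrightarrow> h \<in> PolyF j D"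
  by (auto simp: PolyF_def coeffs_in_def intro: coeff_eq_0)

lemma PolyF_degree: "h \<in> PolyF j D \<Longrightarrow> h = 0 \<or> degree h < D"
  by (auto simp: PolyF_def) (metis leading_coeff_0_iff not_le)

lemma PolyF_translate: "s \<in> PolyF j D \<Longrightarrow> bij_betw (\<lambda>g. g + s) (PolyF j D) (PolyF j D)"
  by (rule bij_betw_byWitness[where f' = "\<lambda>g. g - s"]) (auto intro: PolyF_add PolyF_diff)

lemma Mon_translate: "bij_betw (\<lambda>g. monom 1 k + g) (PolyF 1 k) (Mon k)"
proof (rule bij_betw_byWitness[where f' = "\<lambda>h. h - monom 1 k"])
  show "(\<lambda>g. monom 1 k + g) ` PolyF 1 k \<subseteq> Mon k"
  proof (rule image_subsetI)
    fix g assume g: "g \<in> PolyF 1 k"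
    show "monom 1 k + g \<in> Mon k"
    proof (cases "g = 0")
      case True
      then show ?thesis by (auto simp: Mon_def degree_monom_eq intro!: coeffs_in_monom)
    next
      case False
      then have "degree g < k" using PolyF_degree[OF g] by simp
      then have d: "degree (monom 1 k + g) = k"
        by (subst degree_add_eq_left) (auto simp: degree_monom_eq)
      have "coeff g k = 0" using g by (simp add: PolyF_def)
      then show ?thesis
        using d coeffs_in_PolyF[OF g] unfolding Mon_def by (auto intro!: coeffs_in_add coeffs_in_monom)
    qed
  qed
  show "(\<lambda>h. h - monom 1 k) ` Mon k \<subseteq> PolyF 1 k"
  proof (rule image_subsetI)
    fix h assume h: "h \<in> Mon k"
    have "coeff (h - monom 1 k) i = 0" if "i \<ge> k" for i
      using h that by (cases "i = k") (auto simp: Mon_def coeff_eq_0)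
    moreover have "coeffs_in 1 (h - monom 1 k)"
      using h by (auto simp: Mon_def intro!: coeffs_in_diff coeffs_in_monom)
    ultimately show "h - monom 1 k \<in> PolyF 1 k"
      by (simp add: PolyF_def coeffs_in_def)
  qed
qed auto

end

text \<open>A Dirichlet character modulo \<open>M\<close> over the prime field, with coprimality
  expressed by common roots. Nontriviality is not assumed but deduced from \<open>bound\<close>,
  which later also limits the inverse roots.\<close>

locale poly_character = char_p_closed p K for p :: nat and K :: "'k::alg_closed_field itself" +
  fixes Lam :: "'k poly \<Rightarrow> complex" and M :: "'k poly" and m :: nat
  assumes M: "coeffs_in 1 M" "degree M = m" "m > 0"
    and one: "Lam 1 = 1"
    and mult: "\<And>g h. coeffs_in 1 g \<Longrightarrow> coeffs_in 1 h \<Longrightarrow> Lam (g * h) = Lam g * Lam h"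
    and per: "\<And>g h. coeffs_in 1 g \<Longrightarrow> coeffs_in 1 h \<Longrightarrow> Lam (g + M * h) = Lam g"
    and cop: "\<And>g. coeffs_in 1 g \<Longrightarrow> Lam g \<noteq> 0 \<longleftrightarrow> (\<forall>x. poly M x = 0 \<longrightarrow> poly g x \<noteq> 0)"
    and bound: "\<exists>C::real. \<forall>l>0. norm (\<Sum>x\<in>Fq (2 * l). Lam (cp (2 * l) x)) \<le> C * real p ^ l"
begin

lemma M_nonzero: "M \<noteq> 0" using M by auto

text \<open>A trivial character would make the sum over \<open>Fq (2 * l)\<close> nearly \<open>p ^ (2 * l)\<close>.\<close>

lemma nontrivial: "\<exists>h. coeffs_in 1 h \<and> Lam h \<noteq> 0 \<and> Lam h \<noteq> 1"
proof (rule ccontr)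
  assume "\<not> ?thesis"
  then have triv: "Lam h = 0 \<or> Lam h = 1" if "coeffs_in 1 h" for h using that by blast
  obtain C :: real where C: "\<And>l. l > 0 \<Longrightarrow> norm (\<Sum>x\<in>Fq (2 * l). Lam (cp (2 * l) x)) \<le> C * real p ^ l"
    using bound by blast
  have "real p > 1" using p_gt_2 by simp
  then obtain l0 where l0: "\<bar>C\<bar> + real m + 1 < real p ^ l0" using real_arch_pow by blast
  define l where "l = Suc l0"
  have "real p ^ l0 \<le> real p ^ l" unfolding l_def using p_gt_2 by (intro power_increasing) auto
  then have l: "l > 0" "\<bar>C\<bar> + real m + 1 < real p ^ l" using l0 by (auto simp: l_def)
  have l2: "2 * l > 0" using l by simp
  define Z where "Z = {x \<in> Fq (2 * l). poly M x = 0}"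
  have finZ: "finite Z" using card_Fq(2)[OF l2] by (simp add: Z_def)
  have "card Z \<le> card {x. poly M x = 0}"
    unfolding Z_def by (intro card_mono poly_roots_finite M_nonzero) auto
  also have "\<dots> \<le> m" using card_poly_roots_bound[OF M_nonzero] M by simp
  finally have Z: "card Z \<le> m" .
  have val: "Re (Lam (cp (2 * l) x)) \<ge> (if x \<in> Z then 0 else 1)" if x: "x \<in> Fq (2 * l)" for x
  proof (cases "x \<in> Z")
    case True
    then show ?thesis using triv[OF coeffs_in_cp[OF x]] by auto
  next
    case False
    have "poly (cp (2 * l) x) y \<noteq> 0" if y: "poly M y = 0" for y
    proof
      assume "poly (cp (2 * l) x) y = 0"
      then obtain i where "y = x ^ (p ^ i)" by (auto simp: cp_def poly_prod)
      then have "poly M x ^ (p ^ i) = 0"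
        using y coeffs_in_frob[OF coeffs_in_mono[OF M(1)], of x i] by simp
      then show False using False x by (simp add: Z_def)
    qed
    then have "Lam (cp (2 * l) x) \<noteq> 0" using cop[OF coeffs_in_cp[OF x]] by blast
    then show ?thesis using triv[OF coeffs_in_cp[OF x]] by auto
  qed
  have "(\<Sum>x\<in>Fq (2 * l). if x \<in> Z then 0 else 1 :: real) = real (card (Fq (2 * l) - Z))"
    using card_Fq(2)[OF l2] by (simp add: sum.If_cases Diff_eq Compl_eq)
  also have "card (Fq (2 * l) - Z) = p ^ (2 * l) - card Z"
    using finZ card_Fq(1)[OF l2] by (subst card_Diff_subset) (auto simp: Z_def)
  finally have e: "(\<Sum>x\<in>Fq (2 * l). if x \<in> Z then 0 else 1 :: real) = real (p ^ (2 * l) - card Z)" .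
  have "real a - real b \<le> real (a - c)" if "c \<le> b" for a b c :: nat
    using that by (cases "c \<le> a") (auto simp: of_nat_diff)
  then have "real (p ^ (2 * l)) - real m \<le> (\<Sum>x\<in>Fq (2 * l). if x \<in> Z then 0 else 1 :: real)"
    unfolding e using Z by blast
  also have "\<dots> \<le> (\<Sum>x\<in>Fq (2 * l). Re (Lam (cp (2 * l) x)))" by (intro sum_mono val)
  also have "\<dots> \<le> norm (\<Sum>x\<in>Fq (2 * l). Lam (cp (2 * l) x))"
    unfolding Re_sum[symmetric] by (rule complex_Re_le_cmod)
  also have "\<dots> \<le> C * real p ^ l" by (rule C) fact
  also have "\<dots> \<le> \<bar>C\<bar> * real p ^ l" using p_gt_2 by (intro mult_right_mono) auto
  finally have le: "real p ^ l * real p ^ l - real m \<le> \<bar>C\<bar> * real p ^ l"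
    by (simp add: mult_2 power_add)
  have p1: "1 \<le> real p ^ l" using p_gt_2 by (intro one_le_power) auto
  have "(\<bar>C\<bar> + real m + 1) * real p ^ l \<le> real p ^ l * real p ^ l"
    using l(2) p1 by (intro mult_right_mono) auto
  moreover have "real m * 1 \<le> real m * real p ^ l" using p1 by (intro mult_left_mono) auto
  ultimately show False using le p1 by (simp add: algebra_simps)
qed

text \<open>Orthogonality: multiplication by a unit \<open>u\<close> with
  \<open>Lam u \<noteq> 1\<close> permutes the residues and multiplies the sum by
  \<open>Lam u\<close>.\<close>

lemma residue_sum_eq_0: "(\<Sum>r\<in>PolyF 1 m. Lam r) = 0"
proof -
  obtain u where u: "coeffs_in 1 u" "Lam u \<noteq> 0" "Lam u \<noteq> 1" using nontrivial by blast
  have unit: "\<And>x. poly M x = 0 \<Longrightarrow> poly u x \<noteq> 0" using cop[OF u(1)] u(2) by blast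
  have fin: "finite (PolyF 1 m)" by (rule card_PolyF) simp
  define \<phi> where "\<phi> = (\<lambda>r. (u * r) mod M)"
  have \<phi>: "\<phi> r \<in> PolyF 1 m \<and> Lam (\<phi> r) = Lam u * Lam r" if r: "r \<in> PolyF 1 m" for r
  proof
    have ur: "coeffs_in 1 (u * r)" by (rule coeffs_in_mult[OF u(1) coeffs_in_PolyF[OF r]])
    have c: "coeffs_in 1 (\<phi> r)" unfolding \<phi>_def by (rule frp_mod[OF M(1) ur])
    show "\<phi> r \<in> PolyF 1 m"
      using degree_mod_less[OF M_nonzero, of "u * r"] M c unfolding \<phi>_def by (intro PolyF_I) auto
    have e: "u * r = \<phi> r + M * ((u * r) div M)" by (simp add: \<phi>_def)
    have "coeffs_in 1 (M * ((u * r) div M))"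
    proof -
      have "M * ((u * r) div M) = u * r - \<phi> r" using e by (simp add: algebra_simps)
      then show ?thesis using ur c by (simp only: coeffs_in_diff)
    qed
    then have "coeffs_in 1 ((u * r) div M)" by (rule coeffs_in_cancel[OF M(1) _ M_nonzero])
    then have "Lam (u * r) = Lam (\<phi> r)" using per[OF c] e by metis
    then show "Lam (\<phi> r) = Lam u * Lam r" using mult[OF u(1) coeffs_in_PolyF[OF r]] by simp
  qed
  have inj: "inj_on \<phi> (PolyF 1 m)"
  proof (rule inj_onI)
    fix r s assume rs: "r \<in> PolyF 1 m" "s \<in> PolyF 1 m" "\<phi> r = \<phi> s"
    \<comment> \<open>As \<open>u\<close> shares no root with \<open>M\<close>, all of
      \<open>proots M\<close> must lie in \<open>proots (r - s)\<close>, and the degree bound then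
      leaves only \<open>r = s\<close>.\<close>
    have "M dvd u * (r - s)"
      using rs(3) by (simp add: \<phi>_def mod_eq_dvd_iff right_diff_distrib)
    moreover have "order x u = 0" if "x \<in># proots M" for x
      using that unit M_nonzero by (intro order_0I) auto
    moreover have "M dvd r - s" if "r \<noteq> s"
    proof -
      have nz: "r - s \<noteq> 0" "u \<noteq> 0" using that u(2) unit by (auto simp: cop)
        (metis M(2) M(3) alg_closed_imp_poly_has_root poly_0)
      have "proots M \<subseteq># proots u + proots (r - s)"
        using calculation(1) nz M_nonzero by (simp add: dvd_iff_proots_subset flip: proots_mult)
      then have "proots M \<subseteq># proots (r - s)"
        using calculation(2) nz(2) unfolding subseteq_mset_def
        by (metis add_0 count_proots count_union not_in_iff zero_le)
      then show ?thesis using nz M_nonzero by (simp add: dvd_iff_proots_subset)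
    qed
    ultimately show "r = s"
      using PolyF_degree[OF PolyF_diff[OF rs(1,2)]] M(2) dvd_imp_degree_le[of M "r - s"] by fastforce
  qed
  have "\<phi> ` PolyF 1 m = PolyF 1 m"
    using \<phi> inj fin by (intro endo_inj_surj) auto
  then have "(\<Sum>r\<in>PolyF 1 m. Lam r) = (\<Sum>r\<in>PolyF 1 m. Lam (\<phi> r))"
    using sum.reindex[OF inj, of Lam] by simp
  also have "\<dots> = Lam u * (\<Sum>r\<in>PolyF 1 m. Lam r)"
    using \<phi> by (simp add: sum_distrib_left)
  finally show ?thesis using u(3) by simp
qed

text \<open>For \<open>k \<ge> m\<close>, translation by a residue permutes the monic polynomials of
  degree \<open>k\<close>, so their sum is an average of sums over full residue systems. Hence the
  L-function is a polynomial of degree below \<open>m\<close>.\<close>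

lemma monic_sum_eq_0:
  assumes k: "k \<ge> m"
  shows "(\<Sum>h\<in>Mon k. Lam h) = 0"
proof -
  define S where "S = (\<Sum>g\<in>PolyF 1 k. Lam (monom 1 k + g))"
  have sub: "PolyF 1 m \<subseteq> PolyF 1 k" using k by (auto simp: PolyF_def)
  have inner: "(\<Sum>r\<in>PolyF 1 m. Lam (h + r)) = 0" if h: "coeffs_in 1 h" for h
  proof -
    define s where "s = h mod M"
    have cs: "coeffs_in 1 s" unfolding s_def by (rule frp_mod[OF M(1) h])
    have s: "s \<in> PolyF 1 m"
      using degree_mod_less[OF M_nonzero, of h] M cs unfolding s_def by (intro PolyF_I) auto
    have e: "h = s + M * (h div M)" by (simp add: s_def)
    have "M * (h div M) = h - s" using e by (simp add: algebra_simps)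
    then have "coeffs_in 1 (M * (h div M))" using h cs by (simp only: coeffs_in_diff)
    then have cq: "coeffs_in 1 (h div M)" by (rule coeffs_in_cancel[OF M(1) _ M_nonzero])
    have "Lam (h + r) = Lam (r + s)" if "r \<in> PolyF 1 m" for r
    proof -
      have "h + r = (r + s) + M * (h div M)" by (subst e) (simp only: add_ac)
      then show ?thesis using per[OF coeffs_in_add[OF coeffs_in_PolyF[OF that] cs] cq] by metis
    qed
    then have "(\<Sum>r\<in>PolyF 1 m. Lam (h + r)) = (\<Sum>r\<in>PolyF 1 m. Lam (r + s))" by simp
    also have "\<dots> = (\<Sum>r\<in>PolyF 1 m. Lam r)" by (rule sum.reindex_bij_betw[OF PolyF_translate[OF s]])
    finally show ?thesis by (simp only: residue_sum_eq_0)
  qed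
  have "of_nat (card (PolyF 1 m)) * S = (\<Sum>r\<in>PolyF 1 m. \<Sum>g\<in>PolyF 1 k. Lam (monom 1 k + (g + r)))"
    using sum.reindex_bij_betw[OF PolyF_translate, of _ 1 k "\<lambda>g. Lam (monom 1 k + g)"] sub
    by (simp add: S_def subset_iff)
  also have "\<dots> = (\<Sum>g\<in>PolyF 1 k. \<Sum>r\<in>PolyF 1 m. Lam ((monom 1 k + g) + r))"
    by (subst sum.swap) (simp add: add.assoc)
  also have "\<dots> = 0"
    by (intro sum.neutral ballI inner coeffs_in_add coeffs_in_monom coeffs_in_PolyF) auto
  finally have "S = 0" using card_PolyF(1)[of 1 m] p_pos by simp
  moreover have "S = (\<Sum>h\<in>Mon k. Lam h)"
    unfolding S_def by (rule sum.reindex_bij_betw[OF Mon_translate])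
  ultimately show ?thesis by simp
qed

text \<open>The sums over \<open>Fq j\<close> are the negative power sums of \<open>W\<close>, and
  \<open>bound\<close> on those of even index limits the radius. The last clause is the value of the
  L-function at \<open>1\<close>, kept in order to detect an inverse root \<open>1\<close>.\<close>

theorem L_function_roots:
  "\<exists>W. size W \<le> m - 1 \<and> (\<forall>w\<in>#W. norm w \<le> sqrt p)
     \<and> (\<Sum>x\<in>Fq 1. Lam (cp 1 x)) = - (\<Sum>w\<in>#W. w) \<and> (\<Sum>k<m. \<Sum>h\<in>Mon k. Lam h) = (\<Prod>w\<in>#W. 1 - w)"
proof -
  define A where "A = (\<lambda>k. \<Sum>h\<in>Mon k. Lam h)"
  define T where "T = (\<lambda>j. \<Sum>x\<in>Fq j. Lam (cp j x))"
  have "\<exists>W. size W \<le> m - 1 \<and> (\<forall>k>0. T k = - (\<Sum>w\<in>#W. w ^ k)) \<and> (\<Sum>k<m. A k) = (\<Prod>w\<in>#W. 1 - w)"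
  proof (rule newton_recurrence_solution)
    show "A 0 = 1" by (simp add: A_def Mon_0 one)
    show "A k = 0" if "k \<ge> m" for k using monic_sum_eq_0[OF that] by (simp add: A_def)
    show "of_nat k * A k = (\<Sum>j=1..k. T j * A (k - j))" for k
      unfolding A_def T_def by (rule newton_identity[OF mult])
  qed
  then obtain W where W: "size W \<le> m - 1" "\<And>k. k > 0 \<Longrightarrow> T k = - (\<Sum>w\<in>#W. w ^ k)"
    "(\<Sum>k<m. A k) = (\<Prod>w\<in>#W. 1 - w)" by blast
  obtain C :: real where C: "\<And>l. l > 0 \<Longrightarrow> norm (T (2 * l)) \<le> C * real p ^ l"
    using bound unfolding T_def by blast
  have "norm w \<le> sqrt p" if "w \<in># W" for w
  proof (rule power_sum_radius[OF _ _ that])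
    show "sqrt p > 0" using p_gt_2 by simp
    fix l :: nat assume l: "l > 0"
    have "norm (\<Sum>w\<in>#W. w ^ (2 * l)) = norm (T (2 * l))" using W(2)[of "2 * l"] l by simp
    also have "\<dots> \<le> C * real p ^ l" by (rule C) fact
    finally show "norm (\<Sum>w\<in>#W. w ^ (2 * l)) \<le> C * sqrt p ^ (2 * l)" by (simp add: power_mult)
  qed
  then show ?thesis using W(1,3) W(2)[of 1] unfolding A_def T_def by (intro exI[of _ W]) auto
qed

end

section \<open>Weil bounds for the two families of character sums\<close>

context char_p_closed
begin

text \<open>Up to a power of the leading coefficient of \<open>f\<close>, this is the resultant of \<open>f\<close> and \<open>h\<close>.\<close>

definition res :: "'k poly \<Rightarrow> 'k poly \<Rightarrow> 'k" where
  "res f h = (\<Prod>t\<in>#proots f. poly h t)"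

lemma res_1 [simp]: "res f 1 = 1" by (simp add: res_def)

lemma res_mult: "res f (g * h) = res f g * res f h"
  by (simp add: res_def prod_mset.distrib)

lemma res_prod: "res f (\<Prod>i\<in>A. g i) = (\<Prod>i\<in>A. res f (g i))"
  by (induction A rule: infinite_finite_induct) (auto simp: res_mult)

lemma prod_mset_power: "(\<Prod>t\<in>#A. u t) ^ n = (\<Prod>t\<in>#A. u t ^ n)" for u :: "'a \<Rightarrow> 'b::comm_monoid_mult"
  by (induction A) (auto simp: power_mult_distrib)

lemma res_in_Fq:
  assumes "coeffs_in 1 f" "coeffs_in 1 h"
  shows "res f h \<in> Fq 1"
proof -
  have "res f h ^ p = (\<Prod>t\<in>#proots f. poly h (t ^ p))"
    using coeffs_in_frob[OF assms(2)] by (simp add: res_def prod_mset_power)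
  also have "\<dots> = (\<Prod>t\<in>#image_mset (\<lambda>x. x ^ p) (proots f). poly h t)"
    by (simp add: multiset.map_comp comp_def)
  also have "\<dots> = res f h"
    by (simp only: proots_frob_invariant[OF assms(1)] res_def)
  finally show ?thesis by (simp add: Fq_def)
qed

lemma res_add_multiple: "res f (g + f * h) = res f g"
proof (cases "f = 0")
  case False
  then show ?thesis
    unfolding res_def by (intro arg_cong[where f = prod_mset] image_mset_cong) auto
qed (simp add: res_def)

lemma res_eq_0_iff: "f \<noteq> 0 \<Longrightarrow> res f h = 0 \<longleftrightarrow> (\<exists>x. poly f x = 0 \<and> poly h x = 0)"
  by (auto simp: res_def prod_mset_zero_iff)

text \<open>Reciprocity of the resultant: evaluating \<open>cp j x\<close> at the roots of
  \<open>f\<close> is, up to sign, evaluating \<open>f\<close> at the conjugates of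
  \<open>x\<close>. The even degree removes the sign, and the values at conjugates multiply to a
  norm.\<close>

lemma res_cp:
  assumes f: "coeffs_in 1 f" "even (degree f)"
  shows "lead_coeff f ^ j * res f (cp j x) = Fnorm j (poly f x)"
proof -
  have ev: "lead_coeff f * (\<Prod>t\<in>#proots f. t - y) = poly f y" for y
  proof -
    have "poly f y = poly (smult (lead_coeff f) (\<Prod>x\<in>#proots f. [:- x, 1:])) y"
      by (simp only: alg_closed_proots)
    also have "\<dots> = lead_coeff f * (\<Prod>t\<in>#proots f. y - t)" by (simp add: poly_prod_mset)
    also have "(\<Prod>t\<in>#A. y - t) = (- 1) ^ size A * (\<Prod>t\<in>#A. t - y)" for A
      by (induction A) (auto simp: algebra_simps)
    finally show ?thesis using f(2) by (simp add: alg_closed_proots)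
  qed
  have "res f (cp j x) = (\<Prod>i<j. \<Prod>t\<in>#proots f. t - x ^ (p ^ i))"
    unfolding cp_def res_prod by (simp add: res_def)
  then have "lead_coeff f ^ j * res f (cp j x) = (\<Prod>i<j. lead_coeff f * (\<Prod>t\<in>#proots f. t - x ^ (p ^ i)))"
    by (simp add: prod.distrib)
  also have "\<dots> = (\<Prod>i<j. poly f x ^ (p ^ i))"
    unfolding ev using coeffs_in_frob[OF coeffs_in_mono[OF f(1)]] by simp
  finally show ?thesis by (simp add: Fnorm_def)
qed

text \<open>With \<open>eta_Fnorm\<close> this identifies the power sums of the L-function with
  character sums of \<open>f\<close> over \<open>Fq j\<close>. The sign of the leading coefficient
  disappears for even \<open>j\<close> and is one global sign for \<open>j = 1\<close>.\<close>

lemma eta_res_cp: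
  assumes f: "coeffs_in 1 f" "even (degree f)" "f \<noteq> 0" and x: "x \<in> Fq j" and j: "j > 0"
  shows "eta 1 (lead_coeff f) ^ j * eta 1 (res f (cp j x)) = eta j (poly f x)"
proof -
  have lc: "lead_coeff f \<in> Fq 1" using f(1) by (simp add: coeffs_in_def)
  have pw: "eta 1 (lead_coeff f ^ j) = eta 1 (lead_coeff f) ^ j" for j
    by (induction j) (use lc in \<open>auto simp: eta_mult Fq_power\<close>)
  have "eta j (poly f x) = eta 1 (lead_coeff f ^ j * res f (cp j x))"
    using eta_Fnorm[OF j] res_cp[OF f(1,2)] by metis
  also have "\<dots> = eta 1 (lead_coeff f ^ j) * eta 1 (res f (cp j x))"
    by (intro eta_mult Fq_power lc res_in_Fq f coeffs_in_cp x)
  finally show ?thesis by (simp only: pw)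
qed

lemma eta_res_cp_even:
  assumes f: "coeffs_in 1 f" "even (degree f)" "f \<noteq> 0" and x: "x \<in> Fq (2 * l)" and l: "l > 0"
  shows "eta 1 (res f (cp (2 * l) x)) = eta (2 * l) (poly f x)"
proof -
  have "eta 1 (lead_coeff f) ^ (2 * l) = 1"
    using f(3) eta_square[of "lead_coeff f" 1] by (simp add: power_mult power2_eq_square)
  then show ?thesis using eta_res_cp[OF f x] l by simp
qed

lemma poly_cp_0: "poly (cp j x) 0 = (- 1) ^ j * Fnorm j x"
  unfolding cp_def Fnorm_def by (induction j) (auto simp: poly_prod)

lemma eta_res_cp_1:
  assumes f: "coeffs_in 1 f" "even (degree f)" "f \<noteq> 0" and x: "x \<in> Fq 1"
  shows "eta 1 (res f (cp 1 x)) = eta 1 (lead_coeff f) * eta 1 (poly f x)"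
proof -
  have "eta 1 (lead_coeff f) * eta 1 (lead_coeff f) = 1"
    by (rule eta_square) (use f(3) in simp)
  moreover have "eta 1 (lead_coeff f) * eta 1 (res f (cp 1 x)) = eta 1 (poly f x)"
    using eta_res_cp[OF f x] by (simp only: power_one_right zero_less_one)
  ultimately show ?thesis by (metis mult.assoc mult_1_left)
qed

lemma norm_sum_mset_le: "(\<And>w. w \<in># W \<Longrightarrow> norm w \<le> R) \<Longrightarrow> norm (\<Sum>w\<in>#W. w) \<le> real (size W) * R"
  for W :: "complex multiset"
proof (induction W)
  case (add w W)
  have "norm (w + (\<Sum>w\<in>#W. w)) \<le> norm w + norm (\<Sum>w\<in>#W. w)" by (rule norm_triangle_ineq)
  also have "\<dots> \<le> R + real (size W) * R" using add by (intro add_mono) auto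
  finally show ?case by (simp add: algebra_simps)
qed auto

text \<open>The character depends on the constant coefficient, a residue modulo \<open>X\<close>,
  and on a resultant, determined modulo \<open>f\<close>. Its modulus \<open>X * f\<close> has
  degree \<open>degree f + 1\<close>, which allows at most \<open>degree f\<close> inverse
  roots.\<close>

theorem mixed_character_sum:
  fixes \<psi> :: "'k \<Rightarrow> complex"
  assumes f: "coeffs_in 1 f" "even (degree f)" "coeff f 0 \<noteq> 0" "odd (order \<theta> f)"
    and \<psi>: "\<And>x. norm (\<psi> x) \<le> 1" "\<psi> 0 = 0" "\<psi> 1 = 1" "\<And>x. x \<in> Fq 1 \<Longrightarrow> x \<noteq> 0 \<Longrightarrow> \<psi> x \<noteq> 0"
      "\<And>x y. x \<in> Fq 1 \<Longrightarrow> y \<in> Fq 1 \<Longrightarrow> \<psi> (x * y) = \<psi> x * \<psi> y"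
  shows "norm (\<Sum>x\<in>Fq 1. \<psi> x * of_int (eta 1 (poly f x))) \<le> real (degree f) * sqrt p"
proof -
  have f0: "f \<noteq> 0" using f(3) by auto
  have \<theta>: "\<theta> \<noteq> 0"
  proof
    assume "\<theta> = 0"
    moreover have "order 0 f = 0" using f(3) by (intro order_0I) (simp add: poly_0_coeff_0)
    ultimately show False using f(4) by simp
  qed
  define Lam where "Lam = (\<lambda>h. \<psi> (coeff h 0) * of_int (eta 1 (res f h)))"
  have coeffF: "coeff h 0 \<in> Fq 1" if "coeffs_in 1 h" for h using that by (simp add: coeffs_in_def)
  interpret poly_character p K Lam "[:0, 1:] * f" "degree f + 1"
  proof unfold_locales
    show "coeffs_in 1 ([:0, 1:] * f)"
      by (rule coeffs_in_mult[OF coeffs_in_linear f(1)]) simp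
    show "degree ([:0, 1:] * f) = degree f + 1" using f0 by simp
    show "Lam 1 = 1" by (simp add: Lam_def \<psi>)
    show "Lam (g * h) = Lam g * Lam h" if "coeffs_in 1 g" "coeffs_in 1 h" for g h
      using that by (simp only: Lam_def coeff_mult_0 \<psi>(5) coeffF res_mult eta_mult res_in_Fq f(1) of_int_mult mult_ac)
    show "Lam (g + [:0, 1:] * f * h) = Lam g" for g h
    proof -
      have "g + [:0, 1:] * f * h = g + f * ([:0, 1:] * h)" by (simp only: mult_ac)
      moreover have "coeff (g + [:0, 1:] * f * h) 0 = coeff g 0" by (simp add: coeff_mult_0)
      ultimately show ?thesis unfolding Lam_def using res_add_multiple[of f g "[:0, 1:] * h"] by metis
    qed
    show "(Lam g \<noteq> 0) = (\<forall>x. poly ([:0, 1:] * f) x = 0 \<longrightarrow> poly g x \<noteq> 0)" if g: "coeffs_in 1 g" for g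
    proof -
      have "\<psi> (coeff g 0) = 0 \<longleftrightarrow> poly g 0 = 0"
        using \<psi>(2) \<psi>(4)[OF coeffF[OF g]] by (auto simp: poly_0_coeff_0)
      then show ?thesis
        using res_eq_0_iff[OF f0, of g] by (auto simp: Lam_def eta_nonzero)
    qed
    obtain C :: real where C: "\<And>l. l > 0 \<Longrightarrow> norm (\<Sum>x\<in>Fq (2 * l). \<psi> (Fnorm (2 * l) x) * of_int (eta (2 * l) (poly f x))) \<le> C * real p ^ l"
      using character_sum_bound[of f \<theta> \<psi>, OF f(1) f0 f(4) \<theta> \<psi>(1,2)] by blast
    have "Lam (cp (2 * l) x) = \<psi> (Fnorm (2 * l) x) * of_int (eta (2 * l) (poly f x))"
      if "l > 0" "x \<in> Fq (2 * l)" for l x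
      using eta_res_cp_even[OF f(1,2) f0 that(2,1)] poly_cp_0[of "2 * l" x]
      by (simp add: Lam_def poly_0_coeff_0)
    then show "\<exists>C::real. \<forall>l>0. norm (\<Sum>x\<in>Fq (2 * l). Lam (cp (2 * l) x)) \<le> C * real p ^ l"
      using C by (intro exI[of _ C]) simp
  qed simp
  obtain W where W: "size W \<le> degree f" "\<And>w. w \<in># W \<Longrightarrow> norm w \<le> sqrt p"
    "(\<Sum>x\<in>Fq 1. Lam (cp 1 x)) = - (\<Sum>w\<in>#W. w)"
    using L_function_roots by auto
  have "norm (\<Sum>x\<in>Fq 1. Lam (cp 1 x)) \<le> real (size W) * sqrt p"
    unfolding W(3) norm_minus_cancel by (rule norm_sum_mset_le) (rule W(2))
  also have "\<dots> \<le> real (degree f) * sqrt p" using W(1) by (intro mult_right_mono) auto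
  finally have le: "norm (\<Sum>x\<in>Fq 1. Lam (cp 1 x)) \<le> real (degree f) * sqrt p" .
  \<comment> \<open>\<open>cp 1 x\<close> is \<open>X - x\<close>: its constant term contributes
    \<open>\<psi> (- 1)\<close> and the resultant the sign of the leading coefficient, together a
    factor of absolute value \<open>1\<close>.\<close>
  define e where "e = \<psi> (- 1) * of_int (eta 1 (lead_coeff f))"
  have m1: "- 1 \<in> Fq 1" by (intro Fq_minus Fq_1)
  have "Lam (cp 1 x) = e * (\<psi> x * of_int (eta 1 (poly f x)))" if x: "x \<in> Fq 1" for x
  proof -
    have "coeff (cp 1 x) 0 = - 1 * x" by (simp add: cp_def)
    then have "\<psi> (coeff (cp 1 x) 0) = \<psi> (- 1) * \<psi> x" using \<psi>(5)[OF m1 x] by metis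
    then show ?thesis
      unfolding Lam_def eta_res_cp_1[OF f(1,2) f0 x] e_def by simp
  qed
  then have "(\<Sum>x\<in>Fq 1. Lam (cp 1 x)) = e * (\<Sum>x\<in>Fq 1. \<psi> x * of_int (eta 1 (poly f x)))"
    by (simp add: sum_distrib_left)
  moreover have "norm e = 1"
  proof -
    have "\<psi> (- 1) * \<psi> (- 1) = 1" using \<psi>(5)[OF m1 m1] \<psi>(3) by simp
    then have "norm (\<psi> (- 1)) * norm (\<psi> (- 1)) = 1" by (metis norm_mult norm_one)
    then have "(norm (\<psi> (- 1)))\<^sup>2 = 1" by (simp only: power2_eq_square)
    then have "norm (\<psi> (- 1)) = 1 \<or> norm (\<psi> (- 1)) = - 1" by (simp only: power2_eq_1_iff)
    then have "norm (\<psi> (- 1)) = 1" using norm_ge_zero[of "\<psi> (- 1)"] by linarith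
    moreover have "\<bar>eta 1 (lead_coeff f)\<bar> = 1" using f0 by (simp add: eta_def)
    ultimately show ?thesis by (simp add: e_def norm_mult)
  qed
  ultimately show ?thesis using le by (simp add: norm_mult)
qed

text \<open>The modulus \<open>f\<close> leaves at most \<open>degree f - 1\<close> inverse roots.
  As the degree is even, the character ignores nonzero scalars of \<open>Fq 1\<close>, which forces
  the L-function to vanish at \<open>1\<close>. The inverse root \<open>1\<close> accounts for the
  summand \<open>1\<close>, the remaining ones for the multiple of \<open>sqrt p\<close>.\<close>

theorem quadratic_character_sum:
  assumes f: "coeffs_in 1 f" "even (degree f)" "degree f > 0" "odd (order \<theta> f)"
  shows "\<bar>of_int (\<Sum>x\<in>Fq 1. eta 1 (poly f x))\<bar> \<le> real (degree f - 2) * sqrt p + 1"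
proof -
  have f0: "f \<noteq> 0" using f(3) by auto
  define Lam :: "'k poly \<Rightarrow> complex" where "Lam = (\<lambda>h. of_int (eta 1 (res f h)))"
  interpret poly_character p K Lam f "degree f"
  proof unfold_locales
    show "Lam (g * h) = Lam g * Lam h" if "coeffs_in 1 g" "coeffs_in 1 h" for g h
      using that by (simp only: Lam_def res_mult eta_mult res_in_Fq f(1) of_int_mult)
    show "(Lam g \<noteq> 0) = (\<forall>x. poly f x = 0 \<longrightarrow> poly g x \<noteq> 0)" for g
      using res_eq_0_iff[OF f0, of g] by (auto simp: Lam_def eta_nonzero)
    show "\<exists>C::real. \<forall>l>0. norm (\<Sum>x\<in>Fq (2 * l). Lam (cp (2 * l) x)) \<le> C * real p ^ l"
    proof (intro exI[of _ "real (5 * degree f + 2)"] allI impI)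
      fix l :: nat assume l: "l > 0"
      have "(\<Sum>x\<in>Fq (2 * l). Lam (cp (2 * l) x)) = of_int (\<Sum>x\<in>Fq (2 * l). eta (2 * l) (poly f x))"
        unfolding of_int_sum Lam_def using eta_res_cp_even[OF f(1,2) f0 _ l] by (intro sum.cong) auto
      moreover have "\<bar>real_of_int (\<Sum>x\<in>Fq (2 * l). eta (2 * l) (poly f x))\<bar> \<le> real ((5 * degree f + 2) * p ^ l)"
        using stepanov_sum[OF l coeffs_in_mono[OF f(1)] f0 f(4)]
        by (metis of_int_abs of_int_le_iff of_int_of_nat_eq)
      ultimately show "norm (\<Sum>x\<in>Fq (2 * l). Lam (cp (2 * l) x)) \<le> real (5 * degree f + 2) * real p ^ l"
        by (simp only: norm_of_int of_nat_mult of_nat_power)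
    qed
  qed (use f in \<open>simp_all add: Lam_def res_add_multiple\<close>)
  \<comment> \<open>The resultant with a constant \<open>c\<close> is \<open>c ^ degree f\<close>, a
    square.\<close>
  have scale: "Lam (smult c h) = Lam h" if "c \<in> Fq 1" "c \<noteq> 0" "coeffs_in 1 h" for c h
  proof -
    obtain n where n: "degree f = 2 * n" using f(2) by (elim evenE)
    have "res f [:c:] = c ^ degree f" by (simp add: res_def alg_closed_proots)
    then have "res f [:c:] = (c ^ n) ^ 2" by (simp add: n mult.commute flip: power_mult)
    then have "eta 1 (res f [:c:]) = 1" using eta_power2[of "c ^ n" 1] that(1,2) by (simp only: Fq_power) simp
    moreover have "coeffs_in 1 [:c:]" using that by (auto simp: coeffs_in_def coeff_pCons split: nat.splits)
    moreover have "smult c h = [:c:] * h" by simp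
    ultimately show ?thesis using mult[of "[:c:]" h] that by (simp only: Lam_def of_int_1 mult_1)
  qed
  \<comment> \<open>Every nonzero residue is uniquely a scalar times a monic polynomial, so by
    \<open>scale\<close> the vanishing sum over all residues is \<open>p - 1\<close> times the value
    of the L-function at \<open>1\<close>.\<close>
  have zero: "(\<Sum>k<degree f. \<Sum>h\<in>Mon k. Lam h) = 0"
  proof -
    define U where "U = (SIGMA k:{..<degree f}. Mon k)"
    have finU: "finite U" unfolding U_def using finite_Mon by auto
    have fin: "finite (PolyF 1 (degree f))" by (rule card_PolyF) simp
    have bij: "bij_betw (\<lambda>(c, kh). smult c (snd kh)) ((Fq 1 - {0}) \<times> U) (PolyF 1 (degree f) - {0})"
    proof (rule bij_betw_byWitness[where f' = "\<lambda>r. (lead_coeff r, degree r, smult (inverse (lead_coeff r)) r)"])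
      show "(\<lambda>(c, kh). smult c (snd kh)) ` ((Fq 1 - {0}) \<times> U) \<subseteq> PolyF 1 (degree f) - {0}"
        by (auto simp: U_def Mon_def intro!: PolyF_I coeffs_in_smult)
      show "(\<lambda>r. (lead_coeff r, degree r, smult (inverse (lead_coeff r)) r)) ` (PolyF 1 (degree f) - {0})
          \<subseteq> (Fq 1 - {0}) \<times> U"
      proof (rule image_subsetI)
        fix r assume r: "r \<in> PolyF 1 (degree f) - {0}"
        then have "degree r < degree f" "coeffs_in 1 r" using PolyF_degree coeffs_in_PolyF by auto
        moreover from this have "lead_coeff r \<in> Fq 1" by (simp add: coeffs_in_def)
        ultimately show "(lead_coeff r, degree r, smult (inverse (lead_coeff r)) r) \<in> (Fq 1 - {0}) \<times> U"
          using r by (auto simp: U_def Mon_def intro!: coeffs_in_smult Fq_inverse)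
      qed
    qed (auto simp: U_def Mon_def)
    have "Lam 0 = 0" using cop[of 0] alg_closed_imp_poly_has_root[OF f(3)] by auto
    then have "0 = (\<Sum>r\<in>PolyF 1 (degree f) - {0}. Lam r)"
      using residue_sum_eq_0 fin by (simp add: sum.remove[of _ 0] PolyF_0)
    also have "\<dots> = (\<Sum>(c, kh)\<in>(Fq 1 - {0}) \<times> U. Lam (smult c (snd kh)))"
      by (subst sum.reindex_bij_betw[OF bij, symmetric]) (simp add: case_prod_unfold)
    also have "\<dots> = (\<Sum>(c, kh)\<in>(Fq 1 - {0}) \<times> U. Lam (snd kh))"
      by (intro sum.cong) (auto simp: U_def Mon_def intro!: scale)
    also have "\<dots> = (\<Sum>c\<in>Fq 1 - {0}. \<Sum>kh\<in>U. Lam (snd kh))"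
      by (rule sum.cartesian_product[symmetric])
    also have "\<dots> = of_nat (p - 1) * (\<Sum>kh\<in>U. Lam (snd kh))"
      using card_Fq[of 1] by simp
    finally have "(\<Sum>kh\<in>U. Lam (snd kh)) = 0" using p_gt_2 by simp
    then show ?thesis
      unfolding U_def using finite_Mon by (simp add: sum.Sigma case_prod_unfold)
  qed
  obtain W where W: "size W \<le> degree f - 1" "\<And>w. w \<in># W \<Longrightarrow> norm w \<le> sqrt p"
    "(\<Sum>x\<in>Fq 1. Lam (cp 1 x)) = - (\<Sum>w\<in>#W. w)" "(\<Prod>w\<in>#W. 1 - w) = 0"
    using L_function_roots unfolding zero by metis
  then obtain W' where W': "W = add_mset 1 W'"
    by (auto simp: prod_mset_zero_iff dest: multi_member_split)
  define s where "s = eta 1 (lead_coeff f)"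
  have s: "s = 1 \<or> s = - 1" using f0 by (simp add: s_def eta_def)
  define T where "T = (\<Sum>x\<in>Fq 1. eta 1 (poly f x))"
  have "(\<Sum>x\<in>Fq 1. Lam (cp 1 x)) = of_int (s * T)"
    unfolding T_def sum_distrib_left of_int_sum Lam_def s_def
    using eta_res_cp_1[OF f(1,2) f0] by (intro sum.cong) auto
  then have "of_int (s * T + 1) = - (\<Sum>w\<in>#W'. w)" using W(3) by (simp add: W')
  then have "norm (of_int (s * T + 1) :: complex) = norm (\<Sum>w\<in>#W'. w)" by (metis norm_minus_cancel)
  also have "\<dots> \<le> real (size W') * sqrt p" by (rule norm_sum_mset_le) (simp add: W(2) W')
  also have "\<dots> \<le> real (degree f - 2) * sqrt p" using W(1) W' by (intro mult_right_mono) auto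
  finally have "\<bar>real_of_int (s * T + 1)\<bar> \<le> real (degree f - 2) * sqrt p" by (simp only: norm_of_int)
  then show ?thesis unfolding T_def[symmetric] using s by (elim disjE) auto
qed

end

section \<open>Sieving for exponents coprime to \<open>n\<close>\<close>

definition unity_root :: "nat \<Rightarrow> nat \<Rightarrow> complex" where
  "unity_root n k = exp (2 * of_real pi * \<i> * of_nat k / of_nat n)"

lemma unity_root_add: "unity_root n (j + k) = unity_root n j * unity_root n k"
  by (simp add: unity_root_def algebra_simps add_divide_distrib exp_add)

lemma unity_root_mult: "unity_root n (k * m) = unity_root n k ^ m"
  by (simp add: unity_root_def exp_of_nat_mult[symmetric] algebra_simps)

lemma unity_root_0 [simp]: "unity_root n 0 = 1"
  by (simp add: unity_root_def)

lemma unity_root_eq_1_iff: "n > 0 \<Longrightarrow> unity_root n k = 1 \<longleftrightarrow> n dvd k"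
  unfolding unity_root_def by (rule complex_root_unity_eq_1) simp

lemma norm_unity_root: "norm (unity_root n k) = 1"
  by (simp add: unity_root_def norm_exp_eq_Re)

lemma sum_unity_root:
  assumes n: "n > 0"
  shows "(\<Sum>i<n. unity_root n (j * i)) = (if n dvd j then of_nat n else 0)"
proof (cases "n dvd j")
  case True
  then have "unity_root n (j * i) = 1" for i using n by (simp add: unity_root_eq_1_iff)
  then show ?thesis using True by simp
next
  case False
  have "unity_root n j \<noteq> 1" "unity_root n j ^ n = 1"
    using False n by (simp_all add: unity_root_eq_1_iff flip: unity_root_mult)
  then show ?thesis using False by (simp add: unity_root_mult geometric_sum)
qed

text \<open>The indicator of \<open>\<not> q dvd i\<close>, expanded into the characters of order
  dividing \<open>q\<close> and scaled to have constant term \<open>1\<close>.\<close>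

definition local_sieve :: "nat \<Rightarrow> nat \<Rightarrow> nat \<Rightarrow> complex" where
  "local_sieve n q i = 1 - (\<Sum>c=1..<q. unity_root n (c * (n div q) * i)) / of_nat (q - 1)"

lemma local_sieve_eq:
  assumes q: "q \<ge> 2" "q dvd n" "n > 0"
  shows "local_sieve n q i = (if q dvd i then 0 else of_nat q / of_nat (q - 1))"
proof -
  have n: "n = q * (n div q)" using q by simp
  have nq: "n div q > 0" using q by (metis n mult_0_right neq0_conv)
  have on: "(of_nat n :: complex) = of_nat q * of_nat (n div q)" by (metis n of_nat_mult)
  have root: "unity_root n (c * (n div q) * i) = unity_root q (i * c)" for c
  proof -
    have "(of_nat (c * (n div q) * i) :: complex) / of_nat n = of_nat (i * c) / of_nat q"
      unfolding on of_nat_mult using nq q by (simp add: field_simps)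
    then show ?thesis unfolding unity_root_def by (metis times_divide_eq_right)
  qed
  have "{..<q} = insert 0 {1..<q}" using q by auto
  then have "(\<Sum>c=1..<q. unity_root n (c * (n div q) * i)) = (\<Sum>c<q. unity_root q (i * c)) - 1"
    unfolding root by simp
  also have "(\<Sum>c<q. unity_root q (i * c)) = (if q dvd i then of_nat q else 0)"
    using q by (intro sum_unity_root) simp
  finally have s: "(\<Sum>c=1..<q. unity_root n (c * (n div q) * i)) = (if q dvd i then of_nat (q - 1) else - 1)"
    using q by (simp add: of_nat_diff)
  have "of_nat q = (of_nat (q - 1) :: complex) + 1" using q by (simp add: of_nat_diff)
  moreover have "(of_nat (q - 1) :: complex) \<noteq> 0" using q by simp
  ultimately show ?thesis unfolding local_sieve_def s by (simp add: field_simps del: of_nat_diff)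
qed

text \<open>The hypothesis \<open>\<not> n dvd j * \<Prod>e\<close> says that the character with index \<open>j\<close> stays nontrivial
  when it is multiplied by characters of the orders in \<open>e\<close>.\<close>

lemma sieve_character_bound:
  fixes W :: "nat \<Rightarrow> complex"
  assumes n: "n > 0" and B0: "B \<ge> 0"
    and B: "\<And>j. \<not> n dvd j \<Longrightarrow> norm (\<Sum>i<n. unity_root n (j * i) * W i) \<le> B"
    and e: "finite e" "\<And>q. q \<in> e \<Longrightarrow> prime q" "\<And>q. q \<in> e \<Longrightarrow> q dvd n"
  shows "\<not> n dvd j * \<Prod>e \<Longrightarrow>
           norm (\<Sum>i<n. unity_root n (j * i) * W i * (\<Prod>q\<in>e. local_sieve n q i)) \<le> 2 ^ card e * B"
    and "norm ((\<Sum>i<n. W i * (\<Prod>q\<in>e. local_sieve n q i)) - (\<Sum>i<n. W i)) \<le> (2 ^ card e - 1) * B"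
proof -
  define S where "S = (\<lambda>e j. \<Sum>i<n. unity_root n (j * i) * W i * (\<Prod>q\<in>e. local_sieve n q i))"
  have step: "S (insert q e) j = S e j - (\<Sum>c=1..<q. S e (j + c * (n div q))) / of_nat (q - 1)"
    if "finite e" "q \<notin> e" for q e j
  proof -
    have "S (insert q e) j = (\<Sum>i<n. unity_root n (j * i) * W i * (\<Prod>q\<in>e. local_sieve n q i) -
        (\<Sum>c=1..<q. unity_root n ((j + c * (n div q)) * i) * W i * (\<Prod>q\<in>e. local_sieve n q i)) / of_nat (q - 1))"
      unfolding S_def
    proof (intro sum.cong[OF refl])
      fix i
      define R where "R = (\<Prod>q\<in>e. local_sieve n q i)"
      define u where "u = unity_root n (j * i) * W i * R"
      define Y where "Y = (\<Sum>c=1..<q. unity_root n (c * (n div q) * i))"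
      have "(\<Sum>c=1..<q. unity_root n ((j + c * (n div q)) * i) * W i * R) = u * Y"
        unfolding Y_def u_def sum_distrib_left
        unfolding add_mult_distrib unity_root_add by (intro sum.cong[OF refl]) (simp only: mult_ac)
      moreover have "unity_root n (j * i) * W i * (\<Prod>q\<in>insert q e. local_sieve n q i) = u * (1 - Y / of_nat (q - 1))"
        using that by (simp add: u_def R_def Y_def local_sieve_def)
      ultimately show "unity_root n (j * i) * W i * (\<Prod>q\<in>insert q e. local_sieve n q i)
          = unity_root n (j * i) * W i * (\<Prod>q\<in>e. local_sieve n q i) -
            (\<Sum>c=1..<q. unity_root n ((j + c * (n div q)) * i) * W i * (\<Prod>q\<in>e. local_sieve n q i)) / of_nat (q - 1)"
        unfolding R_def[symmetric] u_def[symmetric] by (simp only: right_diff_distrib mult_1_right times_divide_eq_right)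
    qed
    also have "\<dots> = S e j - (\<Sum>c=1..<q. S e (j + c * (n div q))) / of_nat (q - 1)"
      unfolding S_def sum_subtractf by (subst sum.swap) (simp add: sum_divide_distrib)
    finally show ?thesis .
  qed
  \<comment> \<open>The \<open>q - 1\<close> new character sums are averaged, so sieving by one more
    prime only doubles the bound, however large the prime.\<close>
  have avg: "norm ((\<Sum>c=1..<q. u c) / of_nat (q - 1)) \<le> C"
    if "q \<ge> 2" "\<And>c. c \<in> {1..<q} \<Longrightarrow> norm (u c) \<le> C" for q :: nat and u :: "nat \<Rightarrow> complex" and C
  proof -
    have "norm (\<Sum>c=1..<q. u c) \<le> (\<Sum>c=1..<q. C)" using that(2) by (rule sum_norm_le)
    also have "\<dots> = real (q - 1) * C" by simp
    finally have "norm (\<Sum>c=1..<q. u c) \<le> real (q - 1) * C" .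
    moreover have "real (q - 1) > 0" using that by simp
    ultimately show ?thesis by (simp add: norm_divide pos_divide_le_eq mult.commute del: of_nat_diff)
  qed
  have claim1: "\<not> n dvd j * \<Prod>e \<Longrightarrow> norm (S e j) \<le> 2 ^ card e * B"
    if "finite e" "\<And>q. q \<in> e \<Longrightarrow> prime q" "\<And>q. q \<in> e \<Longrightarrow> q dvd n" for e j
    using that
  proof (induction e arbitrary: j)
    case empty
    then show ?case using B[of j] by (simp add: S_def)
  next
    case (insert q e)
    have q: "q \<ge> 2" "q dvd n" using insert.prems prime_ge_2_nat by auto
    have IH: "norm (S e j') \<le> 2 ^ card e * B" if "\<not> n dvd j' * \<Prod>e" for j'
      using insert.IH[OF that] insert.prems by auto
    have prod: "\<Prod>(insert q e) = q * \<Prod>e" using insert by simp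
    have "\<not> n dvd j * \<Prod>e" using insert.prems(1) unfolding prod by (metis dvd_mult mult.left_commute)
    then have 1: "norm (S e j) \<le> 2 ^ card e * B" by (rule IH)
    have 2: "norm (S e (j + c * (n div q))) \<le> 2 ^ card e * B" for c
    proof (rule IH)
      \<comment> \<open>Multiplying by \<open>q\<close> turns the shift \<open>c * (n div q)\<close>
        into a multiple of \<open>n\<close>, which reduces the claim to the hypothesis on
        \<open>j\<close>.\<close>
      show "\<not> n dvd (j + c * (n div q)) * \<Prod>e"
      proof
        assume "n dvd (j + c * (n div q)) * \<Prod>e"
        then have "n dvd q * ((j + c * (n div q)) * \<Prod>e)" by (rule dvd_mult)
        also have "q * ((j + c * (n div q)) * \<Prod>e) = j * \<Prod>(insert q e) + n * (c * \<Prod>e)"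
        proof -
          have "q * (n div q) = n" using q by simp
          moreover have "q * ((j + c * d) * P) = j * (q * P) + (q * d) * (c * P)" for d P :: nat
            by (simp add: algebra_simps)
          ultimately show ?thesis unfolding prod by metis
        qed
        finally have "n dvd j * \<Prod>(insert q e)" by (simp only: dvd_add_left_iff dvd_triv_left)
        then show False using insert.prems(1) by blast
      qed
    qed
    have "norm (S (insert q e) j) \<le> norm (S e j) + norm ((\<Sum>c=1..<q. S e (j + c * (n div q))) / of_nat (q - 1))"
      unfolding step[OF insert.hyps] by (rule norm_triangle_ineq4)
    also have "\<dots> \<le> 2 ^ card e * B + 2 ^ card e * B" by (intro add_mono 1 avg q 2)
    finally show ?case using insert.hyps by (simp add: mult_ac)
  qed
  have claim2: "norm (S e 0 - (\<Sum>i<n. W i)) \<le> (2 ^ card e - 1) * B"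
    if "finite e" "\<And>q. q \<in> e \<Longrightarrow> prime q" "\<And>q. q \<in> e \<Longrightarrow> q dvd n" for e
    using that
  proof (induction e)
    case empty
    then show ?case by (simp add: S_def)
  next
    case (insert q e)
    have q: "prime q" "q \<ge> 2" "q dvd n" using insert.prems prime_ge_2_nat by auto
    have cop: "coprime q (\<Prod>e)"
      using insert.prems insert.hyps(2) q(1) by (intro prod_coprime_right) (metis insertCI primes_coprime)
    have 2: "norm (S e (0 + c * (n div q))) \<le> 2 ^ card e * B" if c: "c \<in> {1..<q}" for c
    proof (rule claim1)
      show "\<not> n dvd (0 + c * (n div q)) * \<Prod>e"
      proof
        assume "n dvd (0 + c * (n div q)) * \<Prod>e"
        then have "q * (n div q) dvd (c * \<Prod>e) * (n div q)" using q by (simp add: mult_ac)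
        moreover have "n div q \<noteq> 0" using q n by (metis dvd_div_eq_0_iff neq0_conv)
        ultimately have "q dvd c * \<Prod>e" by (metis dvd_times_right_cancel_iff)
        then have "q dvd c" using cop by (simp only: coprime_dvd_mult_left_iff)
        then show False using c by (auto dest: dvd_imp_le)
      qed
    qed (use insert in auto)
    have "norm (S (insert q e) 0 - (\<Sum>i<n. W i))
        = norm ((S e 0 - (\<Sum>i<n. W i)) - (\<Sum>c=1..<q. S e (0 + c * (n div q))) / of_nat (q - 1))"
      unfolding step[OF insert.hyps] by (simp add: algebra_simps)
    also have "\<dots> \<le> norm (S e 0 - (\<Sum>i<n. W i)) + norm ((\<Sum>c=1..<q. S e (0 + c * (n div q))) / of_nat (q - 1))"
      by (rule norm_triangle_ineq4)
    also have "\<dots> \<le> (2 ^ card e - 1) * B + 2 ^ card e * B"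
      by (intro add_mono insert.IH avg q 2) (use insert in auto)
    also have "\<dots> = (2 ^ card (insert q e) - 1) * B"
      using insert.hyps by (simp add: algebra_simps)
    finally show ?case .
  qed
  show "norm (\<Sum>i<n. unity_root n (j * i) * W i * (\<Prod>q\<in>e. local_sieve n q i)) \<le> 2 ^ card e * B"
    if "\<not> n dvd j * \<Prod>e"
    using claim1[OF e that] by (simp add: S_def)
  show "norm ((\<Sum>i<n. W i * (\<Prod>q\<in>e. local_sieve n q i)) - (\<Sum>i<n. W i)) \<le> (2 ^ card e - 1) * B"
    using claim2[OF e] by (simp add: S_def)
qed

text \<open>The extra divisor \<open>r\<close> makes the induction work: a new prime
  \<open>q\<close> removes from the sieved multiples of \<open>r\<close> those of
  \<open>r * q\<close>.\<close>

lemma card_sieved_multiples: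
  fixes n r :: nat
  assumes "finite e" "\<And>q. q \<in> e \<Longrightarrow> prime q" "r > 0" "r * \<Prod>e dvd n" "n > 0"
    and "\<And>q. q \<in> e \<Longrightarrow> coprime q r"
  shows "real (card {i \<in> {..<n}. r dvd i \<and> (\<forall>q\<in>e. \<not> q dvd i)}) * (\<Prod>q\<in>e. real q / real (q - 1)) = real n / real r"
  using assms
proof (induction e arbitrary: r)
  case empty
  then obtain k where k: "n = r * k" by auto
  have "{i \<in> {..<n}. r dvd i} = (\<lambda>i. r * i) ` {..<k}"
    using empty k by (auto elim!: dvdE)
  then have "card {i \<in> {..<n}. r dvd i} = k"
    using empty by (simp add: card_image inj_on_def)
  then show ?case using k empty by simp
next
  case (insert q e)
  have q: "prime q" "q \<ge> 2" using insert.prems prime_ge_2_nat by auto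
  have prod: "\<Prod>(insert q e) = q * \<Prod>e" using insert by simp
  define N where "N = (\<lambda>e r. {i \<in> {..<n}. r dvd i \<and> (\<forall>q\<in>e. \<not> q dvd i)})"
  define \<Phi> where "\<Phi> = (\<Prod>q\<in>e. real q / real (q - 1))"
  have 1: "real (card (N e r)) * \<Phi> = real n / real r"
    unfolding N_def \<Phi>_def
  proof (rule insert.IH)
    show "r * \<Prod>e dvd n" using insert.prems(3) unfolding prod by (metis dvd_mult_right mult.left_commute)
  qed (use insert.prems in auto)
  have 2: "real (card (N e (r * q))) * \<Phi> = real n / real (r * q)"
    unfolding N_def \<Phi>_def
  proof (rule insert.IH)
    show "r * q * \<Prod>e dvd n" using insert.prems(3) unfolding prod by (simp add: mult.assoc)
    show "coprime q' (r * q)" if "q' \<in> e" for q'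
      using insert.prems insert.hyps that q(1) by (metis coprime_mult_right_iff insertCI primes_coprime)
  qed (use insert.prems q in auto)
  have "coprime q r" using insert.prems by simp
  then have "r * q dvd i \<longleftrightarrow> r dvd i \<and> q dvd i" for i
    by (metis coprime_commute divides_mult dvd_mult_left dvd_mult_right)
  then have "N (insert q e) r = N e r - N e (r * q)" "N e (r * q) \<subseteq> N e r"
    by (auto simp: N_def)
  moreover have fin: "finite (N e r)" for e r by (simp add: N_def)
  ultimately have "card (N (insert q e) r) = card (N e r) - card (N e (r * q))"
    "card (N e (r * q)) \<le> card (N e r)"
    by (auto simp: card_Diff_subset intro: card_mono finite_subset)
  then have "real (card (N (insert q e) r)) = real (card (N e r)) - real (card (N e (r * q)))"
    by (simp add: of_nat_diff)
  then have "real (card (N (insert q e) r)) * \<Phi> = real n / real r - real n / real (r * q)"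
    using 1 2 by (simp add: left_diff_distrib)
  also have "\<dots> * (real q / real (q - 1)) = real n / real r"
    using q insert.prems by (simp add: field_simps of_nat_diff)
  finally show ?case
    using insert.hyps unfolding N_def \<Phi>_def by (simp add: mult_ac)
qed

lemma prod_primes_dvd:
  fixes n :: nat
  assumes "finite e" "\<And>q. q \<in> e \<Longrightarrow> prime q" "\<And>q. q \<in> e \<Longrightarrow> q dvd n"
  shows "\<Prod>e dvd n"
  using assms
proof (induction e)
  case (insert q e)
  have "coprime q (\<Prod>e)"
    using insert.prems insert.hyps(2) by (intro prod_coprime_right) (metis insertCI primes_coprime)
  then show ?case using insert by (simp add: divides_mult)
qed auto

text \<open>The primes in \<open>e\<close> are sieved with characters; those in \<open>s\<close> only by bounding the number
  of their multiples.\<close>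

theorem sieve_criterion:
  fixes W :: "nat \<Rightarrow> real"
  assumes n: "n > 0" and B0: "B \<ge> 0" and W: "\<And>i. 0 \<le> W i" "\<And>i. W i \<le> 2"
    and B: "\<And>j. \<not> n dvd j \<Longrightarrow> norm (\<Sum>i<n. unity_root n (j * i) * of_real (W i)) \<le> B"
    and es: "finite e" "finite s" "e \<inter> s = {}" "\<And>q. q \<in> e \<union> s \<Longrightarrow> prime q" "\<And>q. q \<in> e \<union> s \<Longrightarrow> q dvd n"
    and large: "(\<Sum>i<n. W i) > (2 ^ card e - 1) * B + (\<Sum>q\<in>s. 2 * real n / real q)"
  shows "\<exists>i<n. W i > 0 \<and> (\<forall>q\<in>e \<union> s. \<not> q dvd i)"
proof (rule ccontr)
  assume "\<not> ?thesis"
  then have zero: "W i = 0" if "i < n" "\<forall>q\<in>e \<union> s. \<not> q dvd i" for i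
    using that W(1)[of i] by (meson antisym_conv not_less)
  define \<Phi> where "\<Phi> = (\<Prod>q\<in>e. real q / real (q - 1))"
  have q2: "q \<ge> 2" if "q \<in> e \<union> s" for q using es(4)[OF that] prime_ge_2_nat by blast
  have \<Phi>0: "\<Phi> \<ge> 0" unfolding \<Phi>_def by (intro prod_nonneg) auto
  define N where "N = {i \<in> {..<n}. \<forall>q\<in>e. \<not> q dvd i}"
  \<comment> \<open>The product of the local factors is \<open>\<Phi>\<close> times the indicator of
    \<open>N\<close>. Its constant Fourier coefficient is \<open>1\<close>, so the main term stays
    the plain sum of \<open>W\<close>.\<close>
  have loc: "(\<Prod>q\<in>e. local_sieve n q i) = (if \<forall>q\<in>e. \<not> q dvd i then of_real \<Phi> else 0)" for i
  proof (cases "\<forall>q\<in>e. \<not> q dvd i")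
    case True
    then show ?thesis
      using es q2 n by (simp add: local_sieve_eq \<Phi>_def)
  next
    case False
    then obtain q where "q \<in> e" "q dvd i" by blast
    then have "\<exists>q\<in>e. local_sieve n q i = 0"
      using es q2 n by (intro bexI[of _ q]) (auto simp: local_sieve_eq)
    then have "(\<Prod>q\<in>e. local_sieve n q i) = 0" by (rule prod_zero[OF es(1)])
    then show ?thesis using False by (simp only: if_False)
  qed
  have "(\<Sum>i<n. of_real (W i) * (\<Prod>q\<in>e. local_sieve n q i)) = of_real (\<Phi> * (\<Sum>i\<in>N. W i))"
  proof -
    have "(\<Sum>i<n. of_real (W i) * (\<Prod>q\<in>e. local_sieve n q i)) = (\<Sum>i<n. if \<forall>q\<in>e. \<not> q dvd i then of_real (\<Phi> * W i) else (0 :: complex))"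
      by (intro sum.cong) (auto simp: loc)
    also have "\<dots> = (\<Sum>i\<in>N. of_real (\<Phi> * W i))"
      unfolding N_def by (rule sum.inter_filter[symmetric]) simp
    finally show ?thesis by (simp add: sum_distrib_left)
  qed
  then have "norm (of_real (\<Phi> * (\<Sum>i\<in>N. W i)) - (\<Sum>i<n. of_real (W i)) :: complex) \<le> (2 ^ card e - 1) * B"
    using sieve_character_bound(2)[OF n B0 B es(1)] es by auto
  then have "norm (of_real (\<Phi> * (\<Sum>i\<in>N. W i) - (\<Sum>i<n. W i)) :: complex) \<le> (2 ^ card e - 1) * B"
    by simp
  then have low: "\<Phi> * (\<Sum>i\<in>N. W i) \<ge> (\<Sum>i<n. W i) - (2 ^ card e - 1) * B"
    unfolding norm_of_real by linarith
  \<comment> \<open>By the contradiction hypothesis, \<open>W\<close> vanishes on \<open>N\<close>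
    except at multiples of primes in \<open>s\<close>, where it is at most \<open>2\<close>.\<close>
  have "(\<Sum>i\<in>N. W i) \<le> (\<Sum>i\<in>N. \<Sum>q\<in>s. if q dvd i then 2 else 0)"
  proof (rule sum_mono)
    fix i assume i: "i \<in> N"
    show "W i \<le> (\<Sum>q\<in>s. if q dvd i then 2 else 0)"
    proof (cases "\<exists>q\<in>s. q dvd i")
      case True
      then obtain q where "q \<in> s" "q dvd i" by blast
      then have "(2::real) \<le> (\<Sum>q\<in>s. if q dvd i then 2 else 0)"
        using member_le_sum[of q s "\<lambda>q. if q dvd i then 2 else (0::real)"] es(2) by simp
      then show ?thesis using W(2)[of i] by linarith
    next
      case False
      then have "W i = 0" using i zero[of i] by (auto simp: N_def)
      then show ?thesis by (simp add: sum_nonneg)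
    qed
  qed
  also have "\<dots> = (\<Sum>q\<in>s. 2 * real (card {i \<in> {..<n}. q dvd i \<and> (\<forall>q\<in>e. \<not> q dvd i)}))"
  proof (subst sum.swap, intro sum.cong[OF refl])
    fix q
    have "(\<Sum>i\<in>N. if q dvd i then 2 else 0) = (\<Sum>i\<in>{i \<in> N. q dvd i}. 2 :: real)"
      by (rule sum.inter_filter[symmetric]) (simp add: N_def)
    also have "{i \<in> N. q dvd i} = {i \<in> {..<n}. q dvd i \<and> (\<forall>q\<in>e. \<not> q dvd i)}"
      by (auto simp: N_def)
    finally show "(\<Sum>i\<in>N. if q dvd i then 2 else 0) = 2 * real (card {i \<in> {..<n}. q dvd i \<and> (\<forall>q\<in>e. \<not> q dvd i)})"
      by simp
  qed
  finally have "\<Phi> * (\<Sum>i\<in>N. W i) \<le> \<Phi> * (\<Sum>q\<in>s. 2 * real (card {i \<in> {..<n}. q dvd i \<and> (\<forall>q\<in>e. \<not> q dvd i)}))"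
    using \<Phi>0 by (intro mult_left_mono)
  \<comment> \<open>\<open>\<Phi>\<close> is the inverse of the density of \<open>N\<close>, also
    among the multiples of \<open>q\<close>, so the loss for \<open>q\<close> is
    \<open>2 * n / q\<close> whatever \<open>e\<close> is.\<close>
  also have "\<dots> = (\<Sum>q\<in>s. 2 * real n / real q)"
    unfolding sum_distrib_left
  proof (intro sum.cong[OF refl])
    fix q assume q: "q \<in> s"
    have "\<Prod>(insert q e) dvd n" by (rule prod_primes_dvd) (use es q in auto)
    moreover have "q \<notin> e" using es(3) q by auto
    ultimately have "q * \<Prod>e dvd n" using es(1) by simp
    moreover have "coprime q' q" if "q' \<in> e" for q'
      using that \<open>q \<notin> e\<close> es(4) q by (metis UnCI primes_coprime)
    ultimately have c: "real (card {i \<in> {..<n}. q dvd i \<and> (\<forall>q\<in>e. \<not> q dvd i)}) * \<Phi> = real n / real q"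
      unfolding \<Phi>_def using es q n q2 prime_gt_0_nat by (intro card_sieved_multiples) auto
    have "\<Phi> * (2 * x) = 2 * real n / real q" if "x * \<Phi> = real n / real q" for x
      using arg_cong[OF that, of "\<lambda>y. 2 * y"] by (simp add: mult_ac)
    then show "\<Phi> * (2 * real (card {i \<in> {..<n}. q dvd i \<and> (\<forall>q\<in>e. \<not> q dvd i)})) = 2 * real n / real q"
      using c by blast
  qed
  finally show False using low large by linarith
qed

section \<open>Primitive roots with square values\<close>

lemma finite_field_power_card:
  fixes x :: "'a::{field,finite}"
  assumes "x \<noteq> 0"
  shows "x ^ (CARD('a) - 1) = 1"
proof -
  have "(\<Prod>y\<in>UNIV - {0}. x * y) = x ^ (CARD('a) - 1) * \<Prod>(UNIV - {0})"
    by (simp add: prod.distrib)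
  moreover have "(\<Prod>y\<in>UNIV - {0}. x * y) = (\<Prod>y\<in>UNIV - {0}. y)"
    by (rule prod.reindex_bij_witness[of _ "\<lambda>y. y / x" "\<lambda>y. x * y"]) (use assms in auto)
  moreover have "(\<Prod>y\<in>UNIV - {0 :: 'a}. y) \<noteq> 0" by simp
  ultimately show ?thesis by simp
qed

lemma finite_field_generator: "\<exists>\<gamma>::'a::{field,finite}. range (\<lambda>i::nat. \<gamma> ^ i) = UNIV - {0}"
proof -
  define R where "R = (ring_of_type_algebra :: 'a ring)"
  have R: "carrier R = UNIV" "\<zero>\<^bsub>R\<^esub> = 0" "\<one>\<^bsub>R\<^esub> = 1" "x \<otimes>\<^bsub>R\<^esub> y = x * y" for x y
    by (simp_all add: R_def ring_of_type_algebra_def)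
  have pow: "x [^]\<^bsub>R\<^esub> (i::nat) = x ^ i" for x i
    by (induction i) (simp_all add: R mult.commute)
  have "field R" unfolding R_def by (rule field_from_type_algebra)
  then have "\<exists>a\<in>carrier (Multiplicative_Group.mult_of R). carrier (Multiplicative_Group.mult_of R) = {a [^]\<^bsub>R\<^esub> i | i::nat. i \<in> UNIV}"
    by (rule field.finite_field_mult_group_has_gen) (simp add: R)
  then obtain a where "carrier (Multiplicative_Group.mult_of R) = {a [^]\<^bsub>R\<^esub> i | i::nat. i \<in> UNIV}"
    by blast
  then have "UNIV - {0} = {a ^ i | i::nat. i \<in> UNIV}" by (simp add: R pow)
  then have "range (\<lambda>i. a ^ i) = UNIV - {0}" by auto
  then show ?thesis by blast
qed

lemma map_poly_to_ac_mult: "map_poly to_ac (g * h) = map_poly to_ac g * map_poly to_ac h"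
  by (intro poly_eqI) (simp add: coeff_map_poly coeff_mult to_ac_sum)

lemma poly_map_poly_to_ac: "poly (map_poly to_ac h) (to_ac x) = to_ac (poly h x)"
  by (induction h) (auto simp: map_poly_pCons)

context char_p_closed
begin

text \<open>Over the algebraic closure \<open>F\<close> is a constant times the square of a monic
  \<open>G\<close>. Frobenius fixes \<open>G\<^sup>2\<close>, hence maps \<open>G\<close> to
  \<open>G\<close> or \<open>- G\<close>, and being monic excludes the sign; thus \<open>G\<close>
  descends to the prime field.\<close>

lemma even_orders_imp_smult_square:
  assumes F: "coeffs_in 1 F" and even: "\<And>x. even (order x F)"
  shows "\<exists>G. coeffs_in 1 G \<and> F = smult (lead_coeff F) (G\<^sup>2)"
proof (cases "F = 0")
  case False
  define G where "G = (\<Prod>x\<in>set_mset (proots F). [:- x, 1:] ^ (order x F div 2))"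
  have lcG: "lead_coeff G = 1"
    unfolding G_def by (simp add: lead_coeff_prod lead_coeff_power)
  have "F = smult (lead_coeff F) (\<Prod>x\<in>#proots F. [:- x, 1:])"
    by (rule alg_closed_proots(1)[symmetric])
  also have "(\<Prod>x\<in>#proots F. [:- x, 1:]) = (\<Prod>x\<in>set_mset (proots F). ([:- x, 1:] ^ (order x F div 2))\<^sup>2)"
    unfolding image_prod_mset_multiplicity
  proof (rule prod.cong[OF refl])
    fix x
    define d where "d = order x F div 2"
    have "count (proots F) x = d * 2" using even[of x] False by (simp add: d_def)
    then show "[:- x, 1:] ^ count (proots F) x = ([:- x, 1:] ^ (order x F div 2))\<^sup>2"
      by (simp only: d_def[symmetric] power_mult)
  qed
  also have "\<dots> = G\<^sup>2" by (simp only: G_def prod_power_distrib)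
  finally have FG: "F = smult (lead_coeff F) (G\<^sup>2)" .
  have lF: "lead_coeff F \<noteq> 0" "lead_coeff F ^ p = lead_coeff F"
    using F False by (auto simp: coeffs_in_def Fq_def)
  have c: "frp [:lead_coeff F:] = [:lead_coeff F:]"
    using lF(2) p_pos by (intro poly_eqI) (auto simp: coeff_pCons split: nat.splits)
  have FG': "F = [:lead_coeff F:] * G\<^sup>2" using FG by simp
  have "F = frp F" using F by (simp add: coeffs_in_1_iff)
  also have "\<dots> = frp ([:lead_coeff F:] * G\<^sup>2)" using FG' by (rule arg_cong)
  also have "\<dots> = [:lead_coeff F:] * (frp G)\<^sup>2"
    unfolding power2_eq_square frp_mult c ..
  finally have "[:lead_coeff F:] * G\<^sup>2 = [:lead_coeff F:] * (frp G)\<^sup>2"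
    by (rule trans[OF FG'[symmetric]])
  moreover have "[:lead_coeff F:] \<noteq> 0" using lF(1) by simp
  ultimately have "G\<^sup>2 = (frp G)\<^sup>2" by (metis mult_cancel_left)
  then have "frp G = G \<or> frp G = - G" by (metis power2_eq_iff)
  moreover have "frp G \<noteq> - G"
  proof
    assume "frp G = - G"
    then have "coeff (frp G) (degree G) = - coeff G (degree G)" by simp
    then show False using lcG one_neq_minus_one by simp
  qed
  ultimately show ?thesis using FG by (auto simp: coeffs_in_1_iff)
qed (auto intro!: exI[of _ 0])

end

text \<open>In \<open>large\<close>, \<open>p - 3\<close> is the number \<open>p - 1\<close> of
  nonzero elements, less \<open>1\<close> for the term at \<open>0\<close> and \<open>1\<close> from
  the bound \<open>2 * sqrt p + 1\<close>. The part \<open>2 * sqrt p\<close> of that bound and the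
  sieve error \<open>(2 ^ card e - 1) * (4 * sqrt p)\<close> combine to the coefficient
  \<open>4 * 2 ^ card e - 2\<close>.\<close>

theorem primitive_root_square_criterion:
  fixes p :: nat and f :: "'a::{field,finite} poly" and e s :: "nat set"
  assumes p: "prime p" "odd p" "CARD('a) = p"
    and f: "degree f = 4" "coeff f 0 \<noteq> 0" "\<not> (\<exists>(\<alpha>::'a) (g::'a poly). f = smult \<alpha> (g\<^sup>2))"
    and es: "e \<inter> s = {}" "e \<union> s = {q. prime q \<and> q dvd p - 1}"
    and large: "real p - 3 > (4 * 2 ^ card e - 2) * sqrt p + (\<Sum>q\<in>s. 2 * real (p - 1) / real q)"
  shows "\<exists>\<beta>::'a. primitive_root \<beta> \<and> is_square (poly f \<beta>)"
proof -
  define n where "n = p - 1"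
  have "CHAR('a) dvd p" using CHAR_dvd_CARD[where 'a = 'a] p(3) by simp
  moreover have "CHAR('a) \<noteq> 1" by simp
  ultimately have char: "CHAR('a) = p" using p(1) by (metis prime_nat_iff)
  interpret char_p_closed p "TYPE('a alg_closure)"
    by unfold_locales (use p char in auto)
  have n: "n > 1" "p = Suc n" using p_gt_2 by (auto simp: n_def)
  have fin_es: "finite e" "finite s"
  proof -
    have "finite {q. q dvd p - 1}" using n by (intro finite_divisors_nat) auto
    then have "finite (e \<union> s)" unfolding es(2) by (rule finite_subset[rotated]) auto
    then show "finite e" "finite s" by auto
  qed
  obtain \<gamma> :: 'a where \<gamma>: "range (\<lambda>i::nat. \<gamma> ^ i) = UNIV - {0}" using finite_field_generator by blast
  have \<gamma>0: "\<gamma> \<noteq> 0" using \<gamma> by (metis DiffE UNIV_I insertCI power_one_right rangeI)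
  have \<gamma>n: "\<gamma> ^ n = 1" using finite_field_power_card[OF \<gamma>0] p by (simp add: n_def)
  have \<gamma>mod: "\<gamma> ^ (i mod n) = \<gamma> ^ i" for i
  proof -
    have "\<gamma> ^ i = (\<gamma> ^ n) ^ (i div n) * \<gamma> ^ (i mod n)"
      unfolding power_mult[symmetric] power_add[symmetric] by simp
    then show ?thesis by (simp add: \<gamma>n)
  qed
  have img: "(\<lambda>i. \<gamma> ^ i) ` {..<n} = UNIV - {0}"
    unfolding \<gamma>[symmetric] using n
    by (auto intro!: image_eqI[where x = "i mod n" for i] simp: \<gamma>mod) 
  have inj: "inj_on (\<lambda>i. \<gamma> ^ i) {..<n}"
    by (rule eq_card_imp_inj_on) (use img p in \<open>simp_all add: n_def\<close>)
  have \<gamma>eq: "\<gamma> ^ i = \<gamma> ^ j \<Longrightarrow> i mod n = j mod n" for i j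
    using inj_onD[OF inj, of "i mod n" "j mod n"] n by (simp add: \<gamma>mod)
  define G where "G = to_ac \<gamma>"
  define F where "F = map_poly to_ac f"
  have cF: "coeff F i = to_ac (coeff f i)" for i by (simp add: F_def coeff_map_poly)
  have x_p: "x ^ p = x" for x :: 'a
    using finite_field_power_card[of x] power_minus_mult[of p x] p n(2)
    by (cases "x = 0") (auto simp: zero_power)
  have range: "range (to_ac :: 'a \<Rightarrow> _) = Fq 1"
  proof (rule card_subset_eq)
    show "finite (Fq 1)" by (rule card_Fq) simp
    show "range (to_ac :: 'a \<Rightarrow> _) \<subseteq> Fq 1"
      using x_p by (auto simp: Fq_def simp flip: to_ac_power)
    show "card (range (to_ac :: 'a \<Rightarrow> _)) = card (Fq 1)"
      using p card_Fq(1)[of 1] by (simp add: card_image inj_to_ac)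
  qed
  have F: "coeffs_in 1 F" using range by (auto simp: coeffs_in_def cF)
  have degF: "degree F = 4" unfolding F_def f(1)[symmetric] by (rule degree_map_poly) simp
  have F0: "coeff F 0 \<noteq> 0" using f(2) by (simp add: cF)
  have "\<exists>\<theta>. odd (order \<theta> F)"
  proof (rule ccontr)
    assume "\<not> ?thesis"
    then obtain H where H: "coeffs_in 1 H" "F = smult (lead_coeff F) (H\<^sup>2)"
      using even_orders_imp_smult_square[OF F] by blast
    define h where "h = map_poly of_ac H"
    have Hh: "H = map_poly to_ac h"
      using H(1) range by (intro poly_eqI) (auto simp: h_def coeff_map_poly coeffs_in_def to_ac_of_ac)
    have "F = map_poly to_ac (smult (lead_coeff f) (h\<^sup>2))"
    proof -
      have "lead_coeff F = to_ac (lead_coeff f)" by (simp add: cF degF f(1))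
      then have "F = smult (to_ac (lead_coeff f)) (map_poly to_ac (h\<^sup>2))"
        using H(2) by (simp only: Hh power2_eq_square map_poly_to_ac_mult)
      then show ?thesis by (simp add: map_poly_smult)
    qed
    then have "coeff f i = coeff (smult (lead_coeff f) (h\<^sup>2)) i" for i
      by (metis cF coeff_map_poly to_ac_0 to_ac_eq_iff)
    then have "f = smult (lead_coeff f) (h\<^sup>2)" by (intro poly_eqI)
    then show False using f(3) by blast
  qed
  then obtain \<theta> where \<theta>: "odd (order \<theta> F)" by blast
  have even: "even (degree F)" by (simp add: degF)
  have bij: "bij_betw (\<lambda>i. G ^ i) {..<n} (Fq 1 - {0})"
  proof -
    have "Fq 1 - {0} = to_ac ` (UNIV - {0 :: 'a})"
      unfolding range[symmetric] by (simp add: image_set_diff[OF inj_to_ac])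
    also have "\<dots> = (\<lambda>i. G ^ i) ` {..<n}" unfolding img[symmetric] image_image by (simp add: G_def)
    finally have "Fq 1 - {0} = (\<lambda>i. G ^ i) ` {..<n}" .
    moreover have "inj_on (\<lambda>i. G ^ i) {..<n}"
      using inj by (auto simp: inj_on_def G_def simp flip: to_ac_power)
    ultimately show ?thesis by (simp add: bij_betw_def)
  qed
  have Geq: "i mod n = j mod n" if "G ^ i = G ^ j" for i j
    using that unfolding G_def to_ac_power[symmetric] to_ac_eq_iff by (rule \<gamma>eq)
  define \<eta> where "\<eta> = (\<lambda>i. eta 1 (poly F (G ^ i)))"
  define W where "W = (\<lambda>i. 1 + real_of_int (\<eta> i))"
  have \<eta>: "\<bar>\<eta> i\<bar> \<le> 1" for i by (simp add: \<eta>_def eta_abs)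
  have W: "0 \<le> W i" "W i \<le> 2" for i using \<eta>[of i] unfolding W_def by linarith+
  have fin1: "finite (Fq 1)" by (rule card_Fq) simp
  have charsum: "norm (\<Sum>i<n. unity_root n (j * i) * of_real (W i)) \<le> 4 * sqrt p" if j: "\<not> n dvd j" for j
  proof -
    \<comment> \<open>Any choice of discrete logarithm will do, since
      \<open>unity_root n (j * k)\<close> depends only on \<open>k mod n\<close>.\<close>
    define dlog where "dlog = (\<lambda>x. SOME i. G ^ i = x)"
    define \<psi> where "\<psi> = (\<lambda>x. if x \<in> Fq 1 - {0} then unity_root n (j * dlog x) else 0)"
    have \<psi>G: "\<psi> (G ^ i) = unity_root n (j * i)" for i
    proof -
      have "G ^ dlog (G ^ i) = G ^ i" unfolding dlog_def by (rule someI) simp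
      then have m: "dlog (G ^ i) mod n = i mod n" by (rule Geq)
      have u: "unity_root n (j * k) = unity_root n (j * (k mod n))" for k
      proof -
        have "j * k = (j * (k div n)) * n + j * (k mod n)"
          by (metis add_mult_distrib2 div_mult_mod_eq mult.assoc)
        then have "unity_root n (j * k) = unity_root n (j * (k div n) * n) * unity_root n (j * (k mod n))"
          by (metis unity_root_add)
        moreover have "unity_root n (j * (k div n) * n) = 1" using n by (simp add: unity_root_eq_1_iff)
        ultimately show ?thesis by simp
      qed
      have "G ^ i \<in> Fq 1" unfolding range[symmetric] G_def to_ac_power[symmetric] by (rule rangeI)
      moreover have "G ^ i \<noteq> 0" using \<gamma>0 by (simp add: G_def)
      ultimately show ?thesis using u[of i] u[of "dlog (G ^ i)"] m by (simp add: \<psi>_def)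
    qed
    have ex: "\<exists>i. x = G ^ i" if "x \<in> Fq 1" "x \<noteq> 0" for x
      using bij that unfolding bij_betw_def by blast
    have "norm (\<Sum>x\<in>Fq 1. \<psi> x * of_int (eta 1 (poly F x))) \<le> real (degree F) * sqrt p"
    proof (rule mixed_character_sum[OF F even F0 \<theta>])
      show "norm (\<psi> x) \<le> 1" for x by (simp add: \<psi>_def norm_unity_root)
      show "\<psi> 1 = 1" using \<psi>G[of 0] by simp
      show "\<psi> x \<noteq> 0" if "x \<in> Fq 1" "x \<noteq> 0" for x
        using that norm_unity_root[of n "j * dlog x"] by (auto simp: \<psi>_def)
      show "\<psi> (x * y) = \<psi> x * \<psi> y" if xy: "x \<in> Fq 1" "y \<in> Fq 1" for x y
      proof (cases "x = 0 \<or> y = 0")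
        case False
        obtain i where "x = G ^ i" using ex[OF xy(1)] False by blast
        moreover obtain k where "y = G ^ k" using ex[OF xy(2)] False by blast
        ultimately show ?thesis
          using \<psi>G[of "i + k"] by (simp add: \<psi>G power_add distrib_left unity_root_add)
      qed (auto simp: \<psi>_def)
    qed (simp add: \<psi>_def)
    also have "(\<Sum>x\<in>Fq 1. \<psi> x * of_int (eta 1 (poly F x)))
        = (\<Sum>x\<in>Fq 1 - {0}. \<psi> x * of_int (eta 1 (poly F x)))"
      by (intro sum.mono_neutral_right fin1) (auto simp: \<psi>_def)
    also have "\<dots> = (\<Sum>i<n. \<psi> (G ^ i) * of_int (\<eta> i))"
      unfolding \<eta>_def by (rule sum.reindex_bij_betw[OF bij, symmetric])
    also have "\<dots> = (\<Sum>i<n. unity_root n (j * i) * of_real (W i)) - (\<Sum>i<n. unity_root n (j * i))"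
      unfolding \<psi>G W_def by (simp add: algebra_simps flip: sum_subtractf)
    also have "(\<Sum>i<n. unity_root n (j * i)) = 0" using sum_unity_root[of n j] n j by simp
    finally show ?thesis by (simp add: degF)
  qed
  have "(\<Sum>i<n. W i) = real n + real_of_int (\<Sum>i<n. \<eta> i)" by (simp add: W_def sum.distrib)
  also have "(\<Sum>i<n. \<eta> i) = (\<Sum>x\<in>Fq 1 - {0}. eta 1 (poly F x))"
    unfolding \<eta>_def by (rule sum.reindex_bij_betw[OF bij])
  also have "\<dots> = (\<Sum>x\<in>Fq 1. eta 1 (poly F x)) - eta 1 (poly F 0)"
    using fin1 by (simp add: sum_diff1)
  finally have sumW: "(\<Sum>i<n. W i) = real n + real_of_int (\<Sum>x\<in>Fq 1. eta 1 (poly F x)) - real_of_int (eta 1 (poly F 0))"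
    by simp
  have "\<bar>real_of_int (\<Sum>x\<in>Fq 1. eta 1 (poly F x))\<bar> \<le> 2 * sqrt p + 1"
    using quadratic_character_sum[OF F even _ \<theta>] degF by simp
  moreover have "real_of_int (eta 1 (poly F 0)) \<le> 1" using eta_abs[of 1 "poly F 0"] by linarith
  moreover have "real n = real p - 1" using n by simp
  ultimately have sumW': "(\<Sum>i<n. W i) \<ge> real p - 3 - 2 * sqrt p"
    unfolding sumW abs_le_iff by linarith
  have "\<exists>i<n. W i > 0 \<and> (\<forall>q\<in>e \<union> s. \<not> q dvd i)"
  proof (rule sieve_criterion[of n "4 * sqrt p"])
    have "(2 ^ card e - 1) * (4 * sqrt p) + (\<Sum>q\<in>s. 2 * real n / real q) < real p - 3 - 2 * sqrt p"
      using large by (simp add: n_def algebra_simps)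
    then show "(\<Sum>i<n. W i) > (2 ^ card e - 1) * (4 * sqrt p) + (\<Sum>q\<in>s. 2 * real n / real q)"
      using sumW' by linarith
    show "prime q" "q dvd n" if "q \<in> e \<union> s" for q
      using that unfolding es(2) n_def by auto
  qed (use n W charsum fin_es es(1) in auto)
  then obtain i where i: "i < n" "W i > 0" "\<And>q. prime q \<Longrightarrow> q dvd n \<Longrightarrow> \<not> q dvd i"
    unfolding es(2) n_def by auto
  have cop: "coprime i n"
  proof (rule ccontr)
    assume "\<not> coprime i n"
    then obtain q where "prime q" "q dvd gcd i n"
      by (metis coprime_iff_gcd_eq_1 prime_factor_nat)
    then show False using i(3)[of q] by simp
  qed
  define \<beta> where "\<beta> = \<gamma> ^ i"
  have \<beta>0: "\<beta> \<noteq> 0" using \<gamma>0 by (simp add: \<beta>_def)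
  have "primitive_root \<beta>"
    unfolding primitive_root_def
  proof (intro conjI equalityI subsetI)
    obtain k where k: "[i * k = 1] (mod n)" using cong_solve_coprime_nat[OF cop] by (metis One_nat_def)
    have "(i * k) mod n = 1 mod n" using k by (simp only: Cong.unique_euclidean_semiring_class.cong_def)
    then have "\<beta> ^ k = \<gamma>"
      unfolding \<beta>_def power_mult[symmetric] by (metis \<gamma>mod power_one_right)
    moreover fix x :: 'a assume "x \<in> UNIV - {0}"
    then obtain m where "x = \<gamma> ^ m" using \<gamma> by blast
    ultimately have "x = \<beta> powi int (k * m)" by (simp only: power_int_of_nat power_mult)
    then show "x \<in> range (\<lambda>k::int. \<beta> powi k)" by blast
  qed (use \<beta>0 in auto)
  moreover have "is_square (poly f \<beta>)"
  \<comment> \<open>\<open>W i > 0\<close> only excludes \<open>\<eta> i = - 1\<close>, so the value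
    \<open>0\<close> has to be recognised as a square separately.\<close>
  proof (cases "poly f \<beta> = 0")
    case True
    then show ?thesis by (auto simp: is_nth_power_def intro!: exI[of _ 0])
  next
    case False
    have "poly F (G ^ i) = to_ac (poly f \<beta>)"
      by (simp add: F_def G_def \<beta>_def poly_map_poly_to_ac flip: to_ac_power)
    moreover have "\<eta> i \<noteq> - 1" using i(2) by (auto simp: W_def)
    ultimately have "to_ac (poly f \<beta>) ^ ((p ^ 1 - 1) div 2) = 1"
      using False by (auto simp: \<eta>_def eta_def split: if_splits)
    then have half: "poly f \<beta> ^ (n div 2) = 1"
      by (simp add: n_def flip: to_ac_power to_ac_1)
    obtain m where m: "poly f \<beta> = \<gamma> ^ m" using \<gamma> False by blast
    \<comment> \<open>Converse of Euler's criterion: \<open>\<gamma>\<close> has order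
      \<open>n\<close>, so the exponent \<open>m\<close> must be even.\<close>
    have "\<gamma> ^ (m * (n div 2)) = \<gamma> ^ 0" using half by (simp add: m power_mult)
    then have "n dvd m * (n div 2)" using \<gamma>eq[of "m * (n div 2)" 0] by (simp add: mod_eq_0_iff_dvd)
    moreover have "n = 2 * (n div 2)" using p(2) n by simp
    ultimately have "2 * (n div 2) dvd m * (n div 2)" by simp
    moreover have "n div 2 \<noteq> 0" using n by simp
    ultimately have "even m" by (metis dvd_times_right_cancel_iff)
    then have "poly f \<beta> = (\<gamma> ^ (m div 2)) ^ 2" unfolding m by (simp flip: power_mult)
    then show ?thesis by (auto simp: is_nth_power_def)
  qed
  ultimately show ?thesis by blast
qed

section \<open>Small primes\<close>

text \<open>The test below factors \<open>p - 1\<close> for \<open>p \<le> 3190 < 59\<^sup>2\<close>; it is formulated over the integers because they have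
  a binary representation under \<open>code_simp\<close>. It also accepts every multiple of a trial prime.\<close>

definition trial_primes :: "int list" where
  "trial_primes = [2, 3, 5, 7, 11, 13, 17, 19, 23, 29, 31, 37, 41, 43, 47, 53]"

function strip_factor :: "int \<Rightarrow> int \<Rightarrow> int" where
  "strip_factor q m = (if q \<le> 1 \<or> m \<le> 0 \<or> m mod q \<noteq> 0 then m else strip_factor q (m div q))"
  by auto
termination
proof (relation "Wellfounded.measure (\<lambda>(q, m). nat m)")
  fix q m :: int assume "\<not> (q \<le> 1 \<or> m \<le> 0 \<or> m mod q \<noteq> 0)"
  then have "0 \<le> m div q" "m div q < m" by (auto simp: int_div_less_self pos_imp_zdiv_nonneg_iff)
  then show "((q, m div q), (q, m)) \<in> Wellfounded.measure (\<lambda>(q, m). nat m)" by auto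
qed auto

declare strip_factor.simps [simp del]

fun prime_divisors :: "int list \<Rightarrow> int \<Rightarrow> int list" where
  "prime_divisors [] m = (if m = 1 then [] else [m])"
| "prime_divisors (q # qs) m =
     (if m mod q = 0 then q # prime_divisors qs (strip_factor q m) else prime_divisors qs m)"

text \<open>The inequality of the criterion with its square root removed by squaring, hence the
  demand \<open>0 < L\<close>. The integer divisions are exact when \<open>ss\<close> consists of
  divisors of \<open>p - 1\<close>.\<close>

definition split_ok :: "int \<Rightarrow> int list \<Rightarrow> int list \<Rightarrow> bool" where
  "split_ok p es ss = (let L = p - 3 - sum_list (map (\<lambda>q. 2 * ((p - 1) div q)) ss)
     in 0 < L \<and> (4 * 2 ^ length es - 2)\<^sup>2 * p < L\<^sup>2)"

text \<open>\<open>prime_divisors\<close> lists small primes first. These would cost most under the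
  trivial bound \<open>2 * (p - 1) / q\<close>, so they are the ones sieved with characters.\<close>

definition sieve_works :: "int \<Rightarrow> bool" where
  "sieve_works p = (list_ex (\<lambda>q. p mod q = 0) trial_primes \<or>
     (let qs = prime_divisors trial_primes (p - 1)
      in list_ex (\<lambda>k. split_ok p (take k qs) (drop k qs)) [1, 2, 3]))"

lemma strip_factor:
  assumes "q > 1" "m > 0"
  shows "\<exists>j. m = strip_factor q m * q ^ j" "strip_factor q m > 0" "\<not> q dvd strip_factor q m"
proof -
  have "(\<exists>j. m = strip_factor q m * q ^ j) \<and> strip_factor q m > 0 \<and> \<not> q dvd strip_factor q m"
    using assms
  proof (induction q m rule: strip_factor.induct)
    case (1 q m)
    show ?case
    proof (cases "m mod q = 0")
      case False
      then have s: "strip_factor q m = m" by (subst strip_factor.simps) simp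
      show ?thesis
        unfolding s using False 1 by (auto simp: mod_eq_0_iff_dvd intro!: exI[of _ 0])
    next
      case True
      then have s: "strip_factor q m = strip_factor q (m div q)"
        using 1 by (subst strip_factor.simps) simp
      have m: "m = q * (m div q)" using True by auto
      have "q \<le> m" using True 1 by (intro zdvd_imp_le) auto
      then have "m div q > 0" using 1 by (simp add: pos_imp_zdiv_pos_iff)
      then have IH: "\<exists>j. m div q = strip_factor q m * q ^ j" "strip_factor q m > 0" "\<not> q dvd strip_factor q m"
        using 1 True unfolding s by auto
      then obtain j where "m div q = strip_factor q m * q ^ j" by blast
      then have "m = strip_factor q m * q ^ Suc j" using m by (metis mult.left_commute power_Suc)
      then show ?thesis using IH by blast
    qed
  qed
  then show "\<exists>j. m = strip_factor q m * q ^ j" "strip_factor q m > 0" "\<not> q dvd strip_factor q m" by auto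
qed

lemma prime_dvd_strip_factor:
  assumes "prime q" "m > 0" "prime r"
  shows "r dvd strip_factor q m \<longleftrightarrow> r dvd m \<and> r \<noteq> q"
proof -
  have "q > 1" using assms prime_gt_1_int by blast
  note s = strip_factor[OF this assms(2)]
  obtain j where j: "m = strip_factor q m * q ^ j" using s(1) by blast
  show ?thesis
  proof
    assume "r dvd strip_factor q m"
    then show "r dvd m \<and> r \<noteq> q" using s(3) by (subst j) auto
  next
    assume r: "r dvd m \<and> r \<noteq> q"
    then have "r dvd strip_factor q m * q ^ j" using j by simp
    then have "r dvd strip_factor q m \<or> r dvd q"
      using assms(3) by (meson prime_dvd_mult_iff prime_dvd_power)
    then show "r dvd strip_factor q m" using r assms primes_dvd_imp_eq by blast
  qed
qed

text \<open>The cofactor left at the end is below \<open>59 * 59\<close> and has no prime factor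
  below \<open>59\<close>, so it is \<open>1\<close> or a prime.\<close>

lemma prime_divisors:
  assumes "distinct qs" "\<And>q. q \<in> set qs \<Longrightarrow> prime q" "m > 0" "m < 59 * 59"
    and "\<And>r. prime r \<Longrightarrow> r dvd m \<Longrightarrow> r \<in> set qs \<or> r \<ge> 59"
  shows "distinct (prime_divisors qs m) \<and> set (prime_divisors qs m) = {r. prime r \<and> r dvd m}"
  using assms
proof (induction qs arbitrary: m)
  case Nil
  show ?case
  proof (cases "m = 1")
    case False
    then obtain r where r: "prime r" "r dvd m" using Nil prime_divisor_exists[of m] by auto
    then obtain k where k: "m = r * k" by auto
    have r59: "r \<ge> 59" using r Nil by auto
    then have k0: "k > 0" using k Nil by (simp add: zero_less_mult_iff)
    have "k = 1"
    proof (rule ccontr)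
      assume "k \<noteq> 1"
      then obtain t where t: "prime t" "t dvd k" using k0 prime_divisor_exists[of k] by auto
      then have "t \<ge> 59" using Nil k by auto
      moreover have "t \<le> k" using t k0 by (intro zdvd_imp_le)
      ultimately have "59 * 59 \<le> r * k" using r59 by (intro mult_mono) auto
      then show False using Nil k by simp
    qed
    then have "prime m" using r k by simp
    then have "{r. prime r \<and> r dvd m} = {m}" by (auto intro: primes_dvd_imp_eq)
    then show ?thesis using False by simp
  qed (auto dest: not_prime_unit)
next
  case (Cons q qs)
  have q: "prime q" using Cons.prems by simp
  show ?case
  proof (cases "m mod q = 0")
    case False
    then have "\<not> q dvd m" by auto
    then show ?thesis using False Cons by auto
  next
    case True
    then have qm: "q dvd m" by auto
    have q1: "q > 1" using q prime_gt_1_int by blast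
    note s = strip_factor[OF q1 Cons.prems(3)]
    have le: "strip_factor q m \<le> m"
    proof -
      obtain j where j: "m = strip_factor q m * q ^ j" using s(1) by blast
      have "1 \<le> q ^ j" using q1 by (intro one_le_power) auto
      then have "strip_factor q m * 1 \<le> strip_factor q m * q ^ j" using s(2) by (intro mult_left_mono) auto
      then show ?thesis using j by simp
    qed
    have IH: "distinct (prime_divisors qs (strip_factor q m)) \<and>
        set (prime_divisors qs (strip_factor q m)) = {r. prime r \<and> r dvd strip_factor q m}"
      using Cons.prems s le by (intro Cons.IH) (auto simp: prime_dvd_strip_factor[OF q Cons.prems(3)])
    have "{r. prime r \<and> r dvd m} = insert q {r. prime r \<and> r dvd strip_factor q m}"
      using prime_dvd_strip_factor[OF q Cons.prems(3)] q qm by auto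
    then show ?thesis using IH True s(3) by auto
  qed
qed

lemma trial_primes:
  "distinct trial_primes" "q \<in> set trial_primes \<Longrightarrow> prime q"
  "prime r \<Longrightarrow> r \<in> set trial_primes \<or> r \<ge> 59"
proof -
  have eq: "prime r \<and> r < 59 \<longleftrightarrow> r \<in> set trial_primes" for r :: int
  proof -
    have "filter prime [2..58 :: int] = trial_primes"
      unfolding trial_primes_def by code_simp
    then have "set trial_primes = {r. r \<in> set [2..58] \<and> prime r}" by (metis set_filter)
    then have "r \<in> set trial_primes \<longleftrightarrow> 2 \<le> r \<and> r \<le> 58 \<and> prime r"
      unfolding set_upto by simp
    then show ?thesis using prime_ge_2_int[of r] by auto
  qed
  show "distinct trial_primes" by (simp add: trial_primes_def)
  show "q \<in> set trial_primes \<Longrightarrow> prime q" using eq by blast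
  show "prime r \<Longrightarrow> r \<in> set trial_primes \<or> r \<ge> 59" using eq[of r] by auto
qed

text \<open>What matters is that every number listed here belongs to
  \<open>exceptional_primes\<close>; the converse fails, for instance at \<open>277\<close>.\<close>

lemma sieve_failures:
  "filter (\<lambda>p. \<not> sieve_works p) [3..402] =
     [61, 67, 71, 73, 79, 97, 101, 103, 109, 127, 131, 139, 151, 157, 163, 181, 193, 199, 211, 223, 229, 241, 271, 281, 331, 337, 379]"
  "filter (\<lambda>p. \<not> sieve_works p) [403..802] =
     [421, 463, 541, 547, 571, 631, 661, 691]"
  "filter (\<lambda>p. \<not> sieve_works p) [803..1202] =
     [991, 1051]"
  "filter (\<lambda>p. \<not> sieve_works p) [1203..1602] =
     [1471]"
  "filter (\<lambda>p. \<not> sieve_works p) [1603..2002] =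
     []"
  "filter (\<lambda>p. \<not> sieve_works p) [2003..2402] =
     [2311]"
  "filter (\<lambda>p. \<not> sieve_works p) [2403..2802] =
     [2731]"
  "filter (\<lambda>p. \<not> sieve_works p) [2803..3190] =
     []"
  by code_simp+

definition sieve_split :: "nat \<Rightarrow> nat set \<Rightarrow> nat set \<Rightarrow> bool" where
  "sieve_split p e s \<longleftrightarrow> e \<inter> s = {} \<and> e \<union> s = {q. prime q \<and> q dvd p - 1} \<and>
     real p - 3 > (4 * 2 ^ card e - 2) * sqrt p + (\<Sum>q\<in>s. 2 * real (p - 1) / real q)"

lemma sieve_works_or_exceptional:
  assumes "3 \<le> p" "p \<le> 3190"
  shows "sieve_works p \<or> nat p \<in> exceptional_primes"
proof (rule ccontr)
  assume neg: "\<not> ?thesis"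
  have bad: "p \<in> set xs" if "filter (\<lambda>p. \<not> sieve_works p) [a..b] = xs" "a \<le> p" "p \<le> b" for a b xs
    using neg that by auto
  have "p \<le> 402 \<or> 403 \<le> p \<and> p \<le> 802 \<or> 803 \<le> p \<and> p \<le> 1202 \<or> 1203 \<le> p \<and> p \<le> 1602 \<or>
      1603 \<le> p \<and> p \<le> 2002 \<or> 2003 \<le> p \<and> p \<le> 2402 \<or> 2403 \<le> p \<and> p \<le> 2802 \<or> 2803 \<le> p"
    by linarith
  then have "nat p \<in> exceptional_primes"
    using assms sieve_failures[THEN bad] unfolding exceptional_primes_def
    by (elim disjE conjE) (simp_all, auto)
  then show False using neg by blast
qed

lemma split_ok_imp_sieve_split:
  assumes p: "p \<ge> 3" and d: "distinct (es @ ss)"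
    and set: "set (es @ ss) = {r. prime r \<and> r dvd int p - 1}"
    and ok: "split_ok (int p) es ss"
  shows "sieve_split p (nat ` set es) (nat ` set ss)"
proof -
  have n: "int p - 1 = int (p - 1)" using p by simp
  have pos: "r > 0" if "r \<in> set (es @ ss)" for r
    using that unfolding set by (auto dest: prime_gt_0_int)
  have inj: "inj_on nat (set (es @ ss))"
    using pos by (intro inj_onI) (metis int_nat_eq less_imp_le)
  have "nat ` set es \<inter> nat ` set ss = nat ` (set es \<inter> set ss)"
    by (rule inj_on_image_Int[OF inj, symmetric]) auto
  also have "set es \<inter> set ss = {}" using d by simp
  finally have 1: "nat ` set es \<inter> nat ` set ss = {}" by simp
  have "nat ` set es \<union> nat ` set ss = nat ` {r. prime r \<and> r dvd int p - 1}"
    unfolding set[symmetric] by auto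
  also have "\<dots> = {q. prime q \<and> q dvd p - 1}"
  proof (intro equalityI subsetI)
    fix q assume "q \<in> {q. prime q \<and> q dvd p - 1}"
    then show "q \<in> nat ` {r. prime r \<and> r dvd int p - 1}"
      unfolding n by (intro image_eqI[of _ _ "int q"]) auto
  next
    fix q assume "q \<in> nat ` {r. prime r \<and> r dvd int p - 1}"
    then obtain r where r: "q = nat r" "prime r" "r dvd int (p - 1)" unfolding n by auto
    then have rq: "r = int q" using prime_gt_0_int[of r] by simp
    have "prime (int q)" "int q dvd int (p - 1)" using r(2,3) unfolding rq by auto
    then show "q \<in> {q. prime q \<and> q dvd p - 1}" by simp
  qed
  finally have 2: "nat ` set es \<union> nat ` set ss = {q. prime q \<and> q dvd p - 1}" .
  have card: "card (nat ` set es) = length es"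
    using d by (subst card_image) (auto intro: inj_on_subset[OF inj] simp: distinct_card)
  define T where "T = sum_list (map (\<lambda>q. 2 * ((int p - 1) div q)) ss)"
  have "(\<Sum>q\<in>nat ` set ss. 2 * real (p - 1) / real q) = (\<Sum>r\<in>set ss. 2 * real (p - 1) / real (nat r))"
    using inj_on_subset[OF inj, of "set ss"] by (subst sum.reindex) (auto simp: comp_def)
  also have "\<dots> = (\<Sum>r\<in>set ss. real_of_int (2 * ((int p - 1) div r)))"
  proof (intro sum.cong[OF refl])
    fix r assume r: "r \<in> set ss"
    then have "r > 0" "r dvd int p - 1" using pos[of r] set by auto
    then have "real_of_int ((int p - 1) div r) = real_of_int (int p - 1) / real_of_int r"
      by (simp add: real_of_int_div)
    then show "2 * real (p - 1) / real (nat r) = real_of_int (2 * ((int p - 1) div r))"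
      using \<open>r > 0\<close> p by (simp add: of_nat_diff)
  qed
  also have "\<dots> = real_of_int T"
    using d by (simp add: T_def sum_list_distinct_conv_sum_set)
  finally have sum: "(\<Sum>q\<in>nat ` set ss. 2 * real (p - 1) / real q) = real_of_int T" .
  define c :: real where "c = 4 * 2 ^ length es - 2"
  have "int p - 3 - T > 0" "(4 * 2 ^ length es - 2)\<^sup>2 * int p < (int p - 3 - T)\<^sup>2"
    using ok unfolding split_ok_def T_def[symmetric] Let_def by auto
  then have "real_of_int (int p - 3 - T) > 0"
    "real_of_int ((4 * 2 ^ length es - 2)\<^sup>2 * int p) < real_of_int ((int p - 3 - T)\<^sup>2)"
    by (simp_all only: of_int_less_iff of_int_0_less_iff)
  then have L: "real p - 3 - real_of_int T > 0" "c\<^sup>2 * real p < (real p - 3 - real_of_int T)\<^sup>2"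
    by (simp_all add: c_def)
  have "(1 :: real) \<le> 2 ^ length es" by simp
  then have "c \<ge> 0" unfolding c_def by linarith
  then have "c * sqrt p = sqrt (c\<^sup>2 * real p)" by (simp add: real_sqrt_mult)
  also have "\<dots> < sqrt ((real p - 3 - real_of_int T)\<^sup>2)" using L(2) by (rule real_sqrt_less_mono)
  also have "\<dots> = real p - 3 - real_of_int T" using L(1) by simp
  finally show ?thesis
    unfolding sieve_split_def sum card using 1 2 by (simp add: c_def)
qed

lemma sieve_split_small:
  assumes "prime p" "odd p" "p \<notin> exceptional_primes" "p \<le> 3190"
  shows "\<exists>e s. sieve_split p e s"
proof -
  have p: "p \<ge> 3" using prime_ge_2_nat[OF assms(1)] assms(2) by (cases "p = 2") auto
  have "sieve_works (int p)"
    using sieve_works_or_exceptional[of "int p"] p assms by auto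
  \<comment> \<open>A prime accepted as a multiple of a trial prime would itself be a trial prime,
    hence even or exceptional.\<close>
  moreover have "\<not> list_ex (\<lambda>q. int p mod q = 0) trial_primes"
  proof
    assume "list_ex (\<lambda>q. int p mod q = 0) trial_primes"
    then obtain q where q: "q \<in> set trial_primes" "q dvd int p" by (auto simp: list_ex_iff)
    then have "q = int p" using trial_primes(2)[OF q(1)] assms(1) by (intro primes_dvd_imp_eq) auto
    then have "int p \<in> set trial_primes" using q by simp
    then show False using assms(2,3) unfolding trial_primes_def exceptional_primes_def by auto
  qed
  ultimately obtain k where k: "split_ok (int p) (take k (prime_divisors trial_primes (int p - 1)))
      (drop k (prime_divisors trial_primes (int p - 1)))"
    unfolding sieve_works_def Let_def list_ex_iff by blast
  have "distinct (prime_divisors trial_primes (int p - 1)) \<and>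
      set (prime_divisors trial_primes (int p - 1)) = {r. prime r \<and> r dvd int p - 1}"
    using trial_primes p assms(4) by (intro prime_divisors) auto
  then show ?thesis
    using split_ok_imp_sieve_split[OF p _ _ k] by auto
qed

section \<open>Large primes\<close>

lemma card_primes_less:
  "card {q::nat. prime q \<and> q < 2} \<le> 0" "card {q::nat. prime q \<and> q < 3} \<le> 1"
  "card {q::nat. prime q \<and> q < 5} \<le> 2" "card {q::nat. prime q \<and> q < 7} \<le> 3"
  "card {q::nat. prime q \<and> q < 11} \<le> 4" "card {q::nat. prime q \<and> q < 13} \<le> 5"
  "card {q::nat. prime q \<and> q < 17} \<le> 6"
proof -
  have "card {q::nat. prime q \<and> q < m} \<le> length (filter (\<lambda>q. q < int m) trial_primes)" if "m \<le> 59" for m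
  proof -
    have "int ` {q. prime q \<and> q < m} \<subseteq> set (filter (\<lambda>q. q < int m) trial_primes)"
    proof (rule image_subsetI)
      fix q assume "q \<in> {q. prime q \<and> q < m}"
      then show "int q \<in> set (filter (\<lambda>q. q < int m) trial_primes)"
        using trial_primes(3)[of "int q"] that by auto
    qed
    then have "card (int ` {q. prime q \<and> q < m}) \<le> card (set (filter (\<lambda>q. q < int m) trial_primes))"
      by (intro card_mono) auto
    also have "\<dots> \<le> length (filter (\<lambda>q. q < int m) trial_primes)" by (rule card_length)
    finally show ?thesis by (simp add: card_image)
  qed
  from this[of 2] this[of 3] this[of 5] this[of 7] this[of 11] this[of 13] this[of 17]
  show "card {q::nat. prime q \<and> q < 2} \<le> 0" "card {q::nat. prime q \<and> q < 3} \<le> 1"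
    "card {q::nat. prime q \<and> q < 5} \<le> 2" "card {q::nat. prime q \<and> q < 7} \<le> 3"
    "card {q::nat. prime q \<and> q < 11} \<le> 4" "card {q::nat. prime q \<and> q < 13} \<le> 5"
    "card {q::nat. prime q \<and> q < 17} \<le> 6"
    by (simp_all add: trial_primes_def)
qed

lemma large_prime_in_set:
  assumes "card {q::nat. prime q \<and> q < m} \<le> k" "finite S" "\<And>q. q \<in> S \<Longrightarrow> prime q" "card S > k"
  shows "\<exists>q\<in>S. q \<ge> m"
proof (rule ccontr)
  assume "\<not> ?thesis"
  then have "S \<subseteq> {q. prime q \<and> q < m}" using assms(3) by auto
  then have "card S \<le> card {q. prime q \<and> q < m}" by (intro card_mono) auto
  then show False using assms(1,4) by linarith
qed

lemma prod_primes_step: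
  assumes IH: "\<And>S::nat set. finite S \<Longrightarrow> (\<And>q. q \<in> S \<Longrightarrow> prime q) \<Longrightarrow> card S = k \<Longrightarrow> c \<le> \<Prod>S"
    and m: "card {q::nat. prime q \<and> q < m} \<le> k" and T: "finite T" "\<And>q. q \<in> T \<Longrightarrow> prime q" "card T = Suc k"
  shows "m * c \<le> \<Prod>T"
proof -
  obtain q where q: "q \<in> T" "q \<ge> m" using large_prime_in_set[OF m T(1,2)] T(3) by auto
  have "c \<le> \<Prod>(T - {q})" using T q by (intro IH) auto
  then have "m * c \<le> q * \<Prod>(T - {q})" using q by (intro mult_le_mono)
  also have "\<dots> = \<Prod>T" using T q by (simp add: prod.remove[of T q])
  finally show ?thesis .
qed

text \<open>Splitting off a prime that is not among the \<open>k\<close> smallest ones yields the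
  primorials. The number \<open>16 * 4 ^ card S\<close> is the square of
  \<open>4 * 2 ^ card S\<close>, the coefficient that arises when all primes are sieved with
  characters; \<open>17 * 30030\<close> exceeds it for seven primes, and each further prime
  contributes at least \<open>17\<close>.\<close>

lemma prod_primes_ge:
  fixes S :: "nat set"
  assumes "finite S" "\<And>q. q \<in> S \<Longrightarrow> prime q"
  shows "card S = 6 \<Longrightarrow> 30030 \<le> \<Prod>S" and "card S \<ge> 7 \<Longrightarrow> 16 * 4 ^ card S \<le> \<Prod>S"
proof -
  have 0: "1 \<le> \<Prod>S" if "finite S" "\<And>q. q \<in> S \<Longrightarrow> prime q" "card S = 0" for S :: "nat set"
    using that by auto
  have 1: "2 \<le> \<Prod>S" if S: "finite S" "\<And>q. q \<in> S \<Longrightarrow> prime q" "card S = 1" for S :: "nat set"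
  proof -
    have "2 * 1 \<le> \<Prod>S"
      by (rule prod_primes_step[OF 0 card_primes_less(1) S(1,2)]) (simp_all add: S(3))
    then show ?thesis by simp
  qed
  have 2: "6 \<le> \<Prod>S" if S: "finite S" "\<And>q. q \<in> S \<Longrightarrow> prime q" "card S = 2" for S :: "nat set"
  proof -
    have "3 * 2 \<le> \<Prod>S"
      by (rule prod_primes_step[OF 1 card_primes_less(2) S(1,2)]) (simp_all add: S(3))
    then show ?thesis by simp
  qed
  have 3: "30 \<le> \<Prod>S" if S: "finite S" "\<And>q. q \<in> S \<Longrightarrow> prime q" "card S = 3" for S :: "nat set"
  proof -
    have "5 * 6 \<le> \<Prod>S"
      by (rule prod_primes_step[OF 2 card_primes_less(3) S(1,2)]) (simp_all add: S(3))
    then show ?thesis by simp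
  qed
  have 4: "210 \<le> \<Prod>S" if S: "finite S" "\<And>q. q \<in> S \<Longrightarrow> prime q" "card S = 4" for S :: "nat set"
  proof -
    have "7 * 30 \<le> \<Prod>S"
      by (rule prod_primes_step[OF 3 card_primes_less(4) S(1,2)]) (simp_all add: S(3))
    then show ?thesis by simp
  qed
  have 5: "2310 \<le> \<Prod>S" if S: "finite S" "\<And>q. q \<in> S \<Longrightarrow> prime q" "card S = 5" for S :: "nat set"
  proof -
    have "11 * 210 \<le> \<Prod>S"
      by (rule prod_primes_step[OF 4 card_primes_less(5) S(1,2)]) (simp_all add: S(3))
    then show ?thesis by simp
  qed
  have 6: "30030 \<le> \<Prod>S" if S: "finite S" "\<And>q. q \<in> S \<Longrightarrow> prime q" "card S = 6" for S :: "nat set"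
  proof -
    have "13 * 2310 \<le> \<Prod>S"
      by (rule prod_primes_step[OF 5 card_primes_less(6) S(1,2)]) (simp_all add: S(3))
    then show ?thesis by simp
  qed
  have 7: "16 * 4 ^ (k + 7) \<le> \<Prod>S" if "finite S" "\<And>q. q \<in> S \<Longrightarrow> prime q" "card S = k + 7" for S :: "nat set" and k
    using that
  proof (induction k arbitrary: S)
    case 0
    have "17 * 30030 \<le> \<Prod>S"
      by (rule prod_primes_step[OF 6 card_primes_less(7) 0(1,2)]) (simp_all add: 0(3))
    then show ?case by simp
  next
    case (Suc k)
    have c: "card {q::nat. prime q \<and> q < 17} \<le> k + 7" using card_primes_less(7) by linarith
    then have "17 * (16 * 4 ^ (k + 7)) \<le> \<Prod>S"
      using Suc.prems by (intro prod_primes_step[OF Suc.IH]) auto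
    moreover have "16 * 4 ^ (Suc k + 7) \<le> 17 * (16 * 4 ^ (k + 7 :: nat) :: nat)"
      unfolding add_Suc power_Suc by linarith
    ultimately show ?case by (rule order.trans[rotated])
  qed
  show "card S = 6 \<Longrightarrow> 30030 \<le> \<Prod>S" using 6 assms by blast
  show "16 * 4 ^ card S \<le> \<Prod>S" if "card S \<ge> 7" using 7[OF assms, of "card S - 7"] that by simp
qed

text \<open>Three primes are left to the characters, and \<open>30 = 4 * 2 ^ 3 - 2\<close>.\<close>

lemma sieve_splitI_inverse_sum:
  assumes s: "finite S" "S = {q. prime q \<and> q dvd p - 1}" "s \<subseteq> S" "card S = card s + 3"
    and b: "(\<Sum>q\<in>s. 1 / real q) \<le> b" and large: "real p - 3 > 30 * sqrt p + 2 * real (p - 1) * b"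
  shows "sieve_split p (S - s) s"
proof -
  have "card (S - s) = 3" using s by (subst card_Diff_subset) (auto intro: finite_subset)
  moreover have "(\<Sum>q\<in>s. 2 * real (p - 1) / real q) = 2 * real (p - 1) * (\<Sum>q\<in>s. 1 / real q)"
    by (simp add: sum_distrib_left)
  moreover have "2 * real (p - 1) * (\<Sum>q\<in>s. 1 / real q) \<le> 2 * real (p - 1) * b"
    using b by (intro mult_left_mono) auto
  moreover have "S - s \<union> s = S" using s by auto
  ultimately show ?thesis using large s by (auto simp: sieve_split_def)
qed

lemma sieve_split_large:
  assumes p: "prime p" "p > 3190"
  shows "\<exists>e s. sieve_split p e s"
proof -
  define S where "S = {q. prime q \<and> q dvd p - 1}"
  define x where "x = sqrt p"
  have xx: "x * x = real p" by (simp add: x_def)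
  have n: "real (p - 1) = x * x - 1" using p by (simp add: xx of_nat_diff)
  have S: "finite S" "\<And>q. q \<in> S \<Longrightarrow> prime q" "\<And>q. q \<in> S \<Longrightarrow> q dvd p - 1"
  proof -
    have "finite {q. q dvd p - 1}" using p by (intro finite_divisors_nat) auto
    then show "finite S" by (rule finite_subset[rotated]) (auto simp: S_def)
  qed (auto simp: S_def)
  have "\<Prod>S dvd p - 1" by (rule prod_primes_dvd) (use S in auto)
  then have prod: "\<Prod>S \<le> p - 1" using p by (intro dvd_imp_le) auto
  \<comment> \<open>Five prime divisors are the critical case: with \<open>1 / 7 + 1 / 11\<close>
    the inequality needs \<open>x\<close> above about \<open>56.43\<close>, and
    \<open>1412 / 25 = 56.48\<close> has a square just below \<open>3190\<close>.\<close>
  have x: "x \<ge> (1412 / 25)"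
    unfolding x_def using p by (intro real_le_rsqrt) (simp add: power2_eq_square)
  have xx1: "x * x \<ge> (1412 / 25) * x" using x by (intro mult_right_mono) auto
  have "real p - 3 - 2 * real (p - 1) * (1 / 7 + 1 / 11) = 41 / 77 * (x * x) - (3 - 36 / 77)"
    unfolding n xx[symmetric] by (simp add: field_simps)
  then have large5: "real p - 3 > 30 * sqrt p + 2 * real (p - 1) * (1 / 7 + 1 / 11)"
    using x xx1 unfolding x_def[symmetric] by linarith
  have "2 * real (p - 1) * (1 / 7) \<le> 2 * real (p - 1) * (1 / 7 + 1 / 11)"
    by (intro mult_left_mono) auto
  then have large4: "real p - 3 > 30 * sqrt p + 2 * real (p - 1) * (1 / 7)" using large5 by linarith
  have "0 \<le> 2 * real (p - 1) * (1 / 7)" by simp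
  then have large3: "real p - 3 > 30 * sqrt p" using large4 by linarith
  have inv: "1 / real q \<le> 1 / real m" if "m \<le> q" "m > 0" for q m :: nat
    using that by (intro divide_left_mono) auto
  consider "card S \<le> 3" | "card S = 4" | "card S = 5" | "card S = 6" | "card S \<ge> 7" by linarith
  then show ?thesis
  proof cases
    case 1
    then have "(2::real) ^ card S \<le> 2 ^ 3" by (intro power_increasing) auto
    then have "(4 * 2 ^ card S - 2) * sqrt p \<le> 30 * sqrt p" by (intro mult_right_mono) auto
    then have "sieve_split p S {}" using large3 by (simp add: sieve_split_def S_def)
    then show ?thesis by blast
  next
    case 2
    obtain q where "q \<in> S" "7 \<le> q"
      using large_prime_in_set[OF card_primes_less(4) S(1,2)] 2 by auto
    then show ?thesis
      using sieve_splitI_inverse_sum[OF S(1) S_def, of "{q}", OF _ _ _ large4] inv[of 7 q] 2 by auto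
  next
    case 3
    \<comment> \<open>Once \<open>r\<close> is set aside, four primes remain, and only three primes
      lie below \<open>7\<close>.\<close>
    obtain r where r: "r \<in> S" "11 \<le> r"
      using large_prime_in_set[OF card_primes_less(5) S(1,2)] 3 by auto
    obtain q where q: "q \<in> S - {r}" "7 \<le> q"
      using large_prime_in_set[OF card_primes_less(4), of "S - {r}"] S r 3 by auto
    have "(\<Sum>q\<in>{q, r}. 1 / real q) = 1 / real q + 1 / real r" using q by auto
    also have "\<dots> \<le> 1 / 7 + 1 / 11"
      using inv[OF q(2)] inv[OF r(2)] by (intro add_mono) simp_all
    finally have "(\<Sum>q\<in>{q, r}. 1 / real q) \<le> 1 / 7 + 1 / 11" .
    then show ?thesis
      using sieve_splitI_inverse_sum[OF S(1) S_def, of "{q, r}", OF _ _ _ large5] q r 3 by auto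
  next
    case 4
    obtain t where t: "t \<in> S" "13 \<le> t"
      using large_prime_in_set[OF card_primes_less(6) S(1,2)] 4 by auto
    obtain r where r: "r \<in> S - {t}" "11 \<le> r"
      using large_prime_in_set[OF card_primes_less(5), of "S - {t}"] S t 4 by auto
    obtain q where q: "q \<in> S - {t} - {r}" "7 \<le> q"
      using large_prime_in_set[OF card_primes_less(4), of "S - {t} - {r}"] S t r 4 by auto
    \<comment> \<open>The third inverse lowers the coefficient of \<open>x * x\<close> to
      \<open>379 / 1001\<close>, for which \<open>x \<ge> 1412 / 25\<close> is too weak; the size of
      a product of six primes supplies a better bound.\<close>
    have "30030 \<le> \<Prod>S" using prod_primes_ge(1)[OF S(1,2)] 4 by simp
    then have p6: "p \<ge> 30031" using prod by linarith
    have x6: "x \<ge> 173"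
      unfolding x_def using p6 by (intro real_le_rsqrt) simp
    then have "x * x \<ge> 173 * x" by (intro mult_right_mono) auto
    moreover have "real p - 3 - 2 * real (p - 1) * (1 / 7 + 1 / 11 + 1 / 13) = 379 / 1001 * (x * x) - (3 - 622 / 1001)"
      unfolding n xx[symmetric] by (simp add: field_simps)
    ultimately have large6: "real p - 3 > 30 * sqrt p + 2 * real (p - 1) * (1 / 7 + 1 / 11 + 1 / 13)"
      using x6 unfolding x_def[symmetric] by linarith
    have "(\<Sum>q\<in>{q, r, t}. 1 / real q) = 1 / real q + 1 / real r + 1 / real t" using q r by auto
    also have "\<dots> \<le> 1 / 7 + 1 / 11 + 1 / 13"
      using inv[OF q(2)] inv[OF r(2)] inv[OF t(2)] by (intro add_mono) simp_all
    finally have "(\<Sum>q\<in>{q, r, t}. 1 / real q) \<le> 1 / 7 + 1 / 11 + 1 / 13" .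
    then show ?thesis
      using sieve_splitI_inverse_sum[OF S(1) S_def, of "{q, r, t}", OF _ _ _ large6] q r t 4 by auto
  next
    case 5
    \<comment> \<open>No prime is left to the trivial bound here. The product bound gives
      \<open>y\<^sup>2 \<le> p\<close>, and \<open>(y - 2) * x \<le> p - 2 * x\<close> is below
      \<open>p - 3\<close>.\<close>
    define y :: real where "y = 4 * 2 ^ card S"
    have "16 * 4 ^ card S \<le> p - 1" using prod_primes_ge(2)[OF S(1,2) 5] prod by linarith
    then have "real (16 * 4 ^ card S) \<le> real p" by (intro of_nat_mono) linarith
    moreover have "y\<^sup>2 = real (16 * 4 ^ card S)"
      by (simp add: y_def power2_eq_square flip: power_mult_distrib)
    ultimately have "y \<le> x" unfolding x_def by (intro real_le_rsqrt) simp
    then have "(y - 2) * x \<le> (x - 2) * x" using x by (intro mult_right_mono) auto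
    also have "\<dots> < real p - 3" using x by (simp add: algebra_simps xx)
    finally have "sieve_split p S {}" by (simp add: sieve_split_def S_def y_def x_def)
    then show ?thesis by blast
  qed
qed

theorem theorem3p1:
  fixes p :: nat and f :: "'a::{field,finite} poly"
  assumes "prime p" and "odd p" and "p \<notin> exceptional_primes"
    and "CARD('a) = p"
    and "degree f = 4"
    and "coeff f 0 \<noteq> 0"
    and "\<not> (\<exists>(\<alpha>::'a) (g::'a poly). f = smult \<alpha> (g\<^sup>2))"
  shows "\<exists>\<beta>::'a. primitive_root \<beta> \<and> is_square (poly f \<beta>)"
proof -
  obtain e s where "sieve_split p e s"
    using sieve_split_small sieve_split_large assms by (metis not_less)
  then show ?thesis
    using assms by (intro primitive_root_square_criterion[of p f e s]) (auto simp: sieve_split_def)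
qed

end
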